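(* Let $\nu_k\to0^+$, $c_k\in J_0$, $c_k\to c=(c_1,c_2,c_3)\neq0$. Assume $U_{\nu_k,\theta}\in C^1(-1,1)$ is a solution of $$\nu_k(1-x^2)U'+2\nu_kxU+\tfrac12U^2=P_{c_k}(x),\qquad -1<x<1,$$ other than $U^\pm_{\nu_k,\theta}(c_k)$. Then there exists at most one $-1<x_k<1$ such that $U_{\nu_k,\theta}(x_k)=0$, and such $x_k$ must exist if $c_1,c_2>0$. (i) If $U_{\nu_k,\theta}(x_k)=0$ for some $x_k\in(-1,1)$, then for any $\epsilon>0$, $$\lim_{k\to\infty}\left(\|U_{\nu_k,\theta}+\sqrt{2P_c}\|_{L^\infty(-1,x_k-\epsilon)}+\|U_{\nu_k,\theta}-\sqrt{2P_c}\|_{L^\infty(x_k+\epsilon,1)}\right)=0,$$ and for any $0<\beta<\alpha(c)$ there exists a constant $C>0$, depending only on $c,\epsilon$ and $\beta$, such that for large $k$, $$\left\|\tfrac12U_{\nu_k,\theta}^2-P_{c_k}\right\|_{L^\infty((-1,x_k-\epsilon)\cup(x_k+\epsilon,1))}+\nu_k^\beta\left\|\tfrac12U_{\nu_k,\theta}^2-P_{c_k}\right\|_{C^\beta((-1+\epsilon,x_k-\epsilon)\cup(x_k+\epsilon,1-\epsilon))}\le C\nu_k^{\alpha(c)}.$$ (ii) If $U_{\nu_k,\theta}(x_k)=0$ for some $x_k\in(-1,1)$ satisfying $x_k\to-1$ and $c_1=0$, or if $U_{\nu_k,\theta}\ne0$ on $(-1,1)$ and $c_2>0=c_1$, then $$\lim_{k\to\infty}\|U_{\nu_k,\theta}-\sqrt{2P_c}\|_{L^\infty(-1,1)}=0.\qquad(\mathrm{a})$$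 If $U_{\nu_k,\theta}(x_k)=0$ for some $x_k\in(-1,1)$ satisfying $x_k\to1$ and $c_2=0$, or if $U_{\nu_k,\theta}\neq0$ on $(-1,1)$ and $c_1>0=c_2$, then $$\lim_{k\to\infty}\|U_{\nu_k,\theta}+\sqrt{2P_c}\|_{L^\infty(-1,1)}=0.\qquad(\mathrm{b})$$ If $U_{\nu_k,\theta}\ne0$ on $(-1,1)$ and $c_1=c_2=0$, then, after passing to a subsequence, either (a) or (b) occurs. (iii) If $c\in\mathring J_0$, then $U_{\nu_k,\theta}(x_k)=0$ for some $x_k\in(-1,1)$, and for any $\epsilon>0$ and any positive integer $m$ there exists a constant $C>0$, depending only on $\epsilon,m$ and $c$, such that for large $k$, $$\|U_{\nu_k,\theta}+\sqrt{2P_{c_k}}\|_{L^\infty(-1,x_k-\epsilon)}+\|U_{\nu_k,\theta}-\sqrt{2P_{c_k}}\|_{L^\infty(x_k+\epsilon,1)}\le C\nu_k,$$ $$\|U_{\nu_k,\theta}+\sqrt{2P_{c_k}}\|_{C^m(-1+\epsilon,x_k-\epsilon)}+\|U_{\nu_k,\theta}-\sqrt{2P_{c_k}}\|_{C^m(x_k+\epsilon,1-\epsilon)}\le C\nu_k.$$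
   Context: For $c=(c_1,c_2,c_3)\in\mathbb{R}^3$ let $P_c(x)=c_1(1-x)+c_2(1+x)+c_3(1-x^2)$. For $\nu\ge0$ let $$\bar c_3(c_1,c_2;\nu)=-\tfrac12\left(\sqrt{\nu^2+c_1}+\sqrt{\nu^2+c_2}\right)\left(\sqrt{\nu^2+c_1}+\sqrt{\nu^2+c_2}+2\nu\right),$$ $$J_\nu=\{c\in\mathbb{R}^3: c_1\ge-\nu^2,\ c_2\ge-\nu^2,\ c_3\ge\bar c_3(c_1,c_2;\nu)\},$$ and let $\mathring J_\nu$ be its interior; $J_0\subset J_\nu$. For $c_1,c_2\ge0$, $c_3^*(c_1,c_2)=\bar c_3(c_1,c_2;0)=-\frac12(c_1+2\sqrt{c_1c_2}+c_2)$. For $c\in J_0\setminus\{0\}$ define $$\alpha(c)=\begin{cases}1,&c_1,c_2>0,\ c_3>c_3^*(c_1,c_2),\\ \frac23,&c_3=c_3^*(c_1,c_2)<0,\\ \frac12,&c_1c_2=0,\ c_3>c_3^*(c_1,c_2).\end{cases}$$ For $\nu>0$ and $c\in J_\nu$, consider the differential equation $$\nu(1-x^2)U'+2\nu xU+\tfrac12U^2=P_c(x),\qquad -1<x<1.$$ It is known that among its $C^1(-1,1)$ solutions there are a greatest one $U^+_{\nu,\theta}(c)$ and a least one $U^-_{\nu,\theta}(c)$, i.e. $U^-_{\nu,\theta}(c)\le U\le U^+_{\nu,\theta}(c)$ on $(-1,1)$ for every solution $U$; solutions extend continuously to $[-1,1]$. $C^\beta$ denotes the Hölder space. An interval $(a,b)$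 with $a\ge b$ is empty, and norms over empty sets are zero.
   Formalization: "At most one zero" is stated for each k with c_k ≠ 0 (for c_k = 0, which can occur for finitely many k, U = 0 is a non-extremal solution), and the existence of x_k, when c_1, c_2 > 0 and in (iii), is stated for all large k, since it can fail for early k. *)

theory Defs
  imports "HOL-Analysis.Analysis" "HOL-Probability.Essential_Supremum"
begin

definition P_poly :: "real^3 \<Rightarrow> real \<Rightarrow> real" where
  "P_poly c x = c $ 1 * (1 - x) + c $ 2 * (1 + x) + c $ 3 * (1 - x\<^sup>2)"

definition c3_bar :: "real \<Rightarrow> real \<Rightarrow> real \<Rightarrow> real" where
  "c3_bar c1 c2 \<nu> =
     - (1/2) * (sqrt (\<nu>\<^sup>2 + c1) + sqrt (\<nu>\<^sup>2 + c2)) * (sqrt (\<nu>\<^sup>2 + c1) + sqrt (\<nu>\<^sup>2 + c2) + 2 * \<nu>)"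

definition J_set :: "real \<Rightarrow> (real^3) set" where
  "J_set \<nu> = {c. c $ 1 \<ge> - (\<nu>\<^sup>2) \<and> c $ 2 \<ge> - (\<nu>\<^sup>2) \<and> c $ 3 \<ge> c3_bar (c $ 1) (c $ 2) \<nu>}"

definition c3_star :: "real \<Rightarrow> real \<Rightarrow> real" where
  "c3_star c1 c2 = c3_bar c1 c2 0"

(* Meaningful on J_set 0 - {0}. There the last branch is exactly the case
   c1 * c2 = 0, c3 > c3_star c1 c2. *)
definition alpha_exp :: "real^3 \<Rightarrow> real" where
  "alpha_exp c =
     (if c $ 1 > 0 \<and> c $ 2 > 0 \<and> c $ 3 > c3_star (c $ 1) (c $ 2) then 1
      else if c $ 3 = c3_star (c $ 1) (c $ 2) \<and> c $ 3 < 0 then 2/3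
      else 1/2)"

definition is_solution :: "real \<Rightarrow> real^3 \<Rightarrow> (real \<Rightarrow> real) \<Rightarrow> bool" where
  "is_solution \<nu> c U \<longleftrightarrow>
     U C1_differentiable_on {-1<..<1} \<and>
     (\<forall>x\<in>{-1<..<1}. \<nu> * (1 - x\<^sup>2) * deriv U x + 2 * \<nu> * x * U x + (1/2) * (U x)\<^sup>2 = P_poly c x)"

(* U^+ and U^- are treated as predicates, since a solution is only determined on (-1,1)
   whereas a HOL function also has (irrelevant) values elsewhere. *)
definition is_greatest_solution :: "real \<Rightarrow> real^3 \<Rightarrow> (real \<Rightarrow> real) \<Rightarrow> bool" where
  "is_greatest_solution \<nu> c U \<longleftrightarrow>
     is_solution \<nu> c U \<and> (\<forall>V. is_solution \<nu> c V \<longrightarrow> (\<forall>x\<in>{-1<..<1}. V x \<le> U x))"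

definition is_least_solution :: "real \<Rightarrow> real^3 \<Rightarrow> (real \<Rightarrow> real) \<Rightarrow> bool" where
  "is_least_solution \<nu> c U \<longleftrightarrow>
     is_solution \<nu> c U \<and> (\<forall>V. is_solution \<nu> c V \<longrightarrow> (\<forall>x\<in>{-1<..<1}. U x \<le> V x))"

definition vanishing_viscosity_seq ::
    "real^3 \<Rightarrow> (nat \<Rightarrow> real) \<Rightarrow> (nat \<Rightarrow> real^3) \<Rightarrow> (nat \<Rightarrow> real \<Rightarrow> real) \<Rightarrow> bool" where
  "vanishing_viscosity_seq c \<nu> cs U \<longleftrightarrow>
     (\<forall>k. \<nu> k > 0) \<and> \<nu> \<longlonglongrightarrow> 0 \<and> (\<forall>k. cs k \<in> J_set 0) \<and> cs \<longlonglongrightarrow> c \<and>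
     (\<forall>k. is_solution (\<nu> k) (cs k) (U k) \<and>
          \<not> is_greatest_solution (\<nu> k) (cs k) (U k) \<and>
          \<not> is_least_solution (\<nu> k) (cs k) (U k))"

definition zero_seq :: "(nat \<Rightarrow> real \<Rightarrow> real) \<Rightarrow> (nat \<Rightarrow> real) \<Rightarrow> bool" where
  "zero_seq U x \<longleftrightarrow> (\<forall>\<^sub>F k in sequentially. x k \<in> {-1<..<1} \<and> U k (x k) = 0)"

definition nonvanishing_seq :: "(nat \<Rightarrow> real \<Rightarrow> real) \<Rightarrow> bool" where
  "nonvanishing_seq U \<longleftrightarrow> (\<forall>\<^sub>F k in sequentially. \<forall>y\<in>{-1<..<1}. U k y \<noteq> 0)"

(* All norms take values in ennreal: the norm of a function outside the space is infinite,
   and, since bot = 0 in ennreal, norms over the empty set are 0. *)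

definition Linf_norm :: "real set \<Rightarrow> (real \<Rightarrow> real) \<Rightarrow> ennreal" where
  "Linf_norm S f = esssup (lebesgue_on S) (\<lambda>x. ennreal \<bar>f x\<bar>)"

(* For 0 < \<beta> \<le> 1. The pairs range over the whole of S, including pairs of points in
   different components of S. *)
definition Holder_norm :: "real \<Rightarrow> real set \<Rightarrow> (real \<Rightarrow> real) \<Rightarrow> ennreal" where
  "Holder_norm \<beta> S f =
     (SUP x\<in>S. ennreal \<bar>f x\<bar>) +
     (SUP (x, y)\<in>{(x, y). x \<in> S \<and> y \<in> S \<and> x \<noteq> y}. ennreal (\<bar>f x - f y\<bar> / \<bar>x - y\<bar> powr \<beta>))"

(* For open S *)
definition Cm_on :: "nat \<Rightarrow> real set \<Rightarrow> (real \<Rightarrow> real) \<Rightarrow> bool" where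
  "Cm_on m S f \<longleftrightarrow>
     (\<forall>j<m. \<forall>x\<in>S. (deriv ^^ j) f field_differentiable at x) \<and> continuous_on S ((deriv ^^ m) f)"

definition Cm_norm :: "nat \<Rightarrow> real set \<Rightarrow> (real \<Rightarrow> real) \<Rightarrow> ennreal" where
  "Cm_norm m S f =
     (if Cm_on m S f then \<Sum>j\<le>m. SUP x\<in>S. ennreal \<bar>(deriv ^^ j) f x\<bar> else top)"

definition conv_a :: "real^3 \<Rightarrow> (nat \<Rightarrow> real \<Rightarrow> real) \<Rightarrow> bool" where
  "conv_a c U \<longleftrightarrow> (\<lambda>k. Linf_norm {-1<..<1} (\<lambda>y. U k y - sqrt (2 * P_poly c y))) \<longlonglongrightarrow> 0"

definition conv_b :: "real^3 \<Rightarrow> (nat \<Rightarrow> real \<Rightarrow> real) \<Rightarrow> bool" where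
  "conv_b c U \<longleftrightarrow> (\<lambda>k. Linf_norm {-1<..<1} (\<lambda>y. U k y + sqrt (2 * P_poly c y))) \<longlonglongrightarrow> 0"

end

theory Submission
  imports Defs
begin

text \<open>
  Write \<open>h = U\<^sup>2/2 - P\<close>, where \<open>P\<close> is the quadratic on the right-hand side. The equation says
  \<open>h = - \<nu> ((1 - x\<^sup>2) U' + 2 x U)\<close>, so everything rests on a bound for \<open>(1 - x\<^sup>2) U'\<close> that is uniform
  in \<open>\<nu>\<close>. The source of such a bound is that, for \<open>c\<close> in \<open>J_set 0\<close>,
  \<open>P = L\<^sup>2/2 + d (1 - x\<^sup>2)\<close> with an affine \<open>L\<close> and \<open>d \<ge> 0\<close>, whence
  \<open>((1 - x\<^sup>2) P')\<^sup>2 \<le> const * P\<close>: the function \<open>sqrt (2 P)\<close> is Lipschitz for the weight \<open>1 - x\<^sup>2\<close>, however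
  degenerate \<open>P\<close> is. Therefore small perturbations of \<open>sqrt (2 P)\<close> are barriers with an error of order \<open>\<nu>\<close>:

  \<^item> \<open>sqrt (2 P + 2 K \<nu>)\<close> lies above every solution. A solution that crosses it would, followed to the
    left, satisfy a Riccati inequality and blow up before reaching \<open>-1\<close> (\<open>solution_upper\<close>).

  \<^item> \<open>s - K \<nu> / s\<close> with \<open>s = sqrt (2 P + 2 \<nu>)\<close> lies below a solution that is nonnegative on \<open>(a,1)\<close>, from
    \<open>a + \<epsilon>\<close> on. Below the barrier the gap closes at a rate proportional to \<open>K\<close>, so with \<open>K\<close> of order \<open>1/\<epsilon>\<close> it
    is closed within the distance \<open>\<epsilon>\<close> (\<open>nonneg_solution_lower\<close>).

  Hence \<open>|h| \<le> K \<nu>\<close> at distance \<open>\<epsilon>\<close> to the right of a zero, with a constant that is uniform for bounded \<open>c\<close>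
  in \<open>J_set 0\<close>. This holds even in the degenerate cases, and it is at least as strong as the rate \<open>\<nu> powr alpha_exp c\<close>
  because \<open>alpha_exp c \<le> 1\<close> and \<open>\<nu> \<le> 1\<close>. The left side follows by the reflection \<open>x \<mapsto> -x\<close>, \<open>U \<mapsto> -U\<close>,
  \<open>c1 \<leftrightarrow> c2\<close>. A Lipschitz bound for \<open>h\<close> in the interior follows by inserting \<open>|h| \<le> K \<nu>\<close> into the equation
  once more, and interpolation gives the Hoelder estimate. For \<open>conv_a\<close> and \<open>conv_b\<close> the same estimates are used with
  \<open>\<epsilon> = sqrt \<nu>\<close> and combined with the smallness of \<open>P\<close> near the end point in question.

  Zeros: an integrating factor turns the equation into the monotonicity of \<open>U\<close> times a positive function, so
  a solution changes sign at most once, from minus to plus, and the zero is unique unless \<open>P\<close> vanishes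
  identically. If \<open>c1 > 0\<close> and \<open>\<nu>\<close> is small, a solution that is positive everywhere stays above \<open>4 \<nu>\<close>
  near \<open>-1\<close>; any larger solution would then deviate from it without bound near \<open>-1\<close>. So it is the
  greatest solution (\<open>positive_solution_greatest\<close>), and by reflection a negative one is the least.

  The \<open>C\<^sup>m\<close> estimates concern \<open>E = (U - sqrt (2 P)) / \<nu>\<close> when \<open>P\<close> is bounded below. The derivative \<open>v = E'\<close>
  satisfies a linear equation \<open>\<nu> v' = - \<tau> v + r\<close> with \<open>\<tau>\<close> bounded below. For such equations a bound
  of \<open>\<nu> v\<close> up to the left end point gives a bound of \<open>v\<close> away from it (\<open>damped_bound\<close>), and
  differentiating the equation gives bounds for all derivatives (\<open>damped_unif_bdd\<close>). As \<open>\<tau>\<close> and \<open>r\<close> involve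
  no derivative of \<open>E\<close>, a bootstrap over the order completes the argument
  (\<open>deviation_quotient_unif_bdd\<close>).
\<close>

section \<open>Comparison on an interval\<close>

text \<open>The comparison principle behind all barrier arguments: between the last nonnegative point and \<open>b\<close> the
  function would be negative, hence nondecreasing. It is also used backwards: if \<open>f b < 0\<close>, then \<open>f\<close> is
  negative all the way to the left of \<open>b\<close>.\<close>

lemma nonneg_persists:
  fixes f f' :: "real \<Rightarrow> real"
  assumes "a \<le> b"
    and der: "\<And>x. x \<in> {a..b} \<Longrightarrow> (f has_real_derivative f' x) (at x)"
    and sgn: "\<And>x. x \<in> {a..b} \<Longrightarrow> f x < 0 \<Longrightarrow> f' x \<ge> 0"
    and init: "f a \<ge> 0"
  shows "f b \<ge> 0"
proof (rule ccontr)
  assume "\<not> f b \<ge> 0"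
  then have fb: "f b < 0" by simp
  define Z :: "real set" where "Z = {x \<in> {a..b}. f x \<ge> 0}"
  have cont: "continuous_on {a..b} f"
    by (meson der DERIV_isCont continuous_at_imp_continuous_on)
  have "Z = {a..b} \<inter> f -` {0..}" by (auto simp: Z_def)
  then have "closed Z"
    using continuous_closed_preimage[OF cont, of "{0..}"] by simp
  moreover have Z: "Z \<noteq> {}" "bdd_above Z" using init \<open>a \<le> b\<close> by (auto simp: Z_def)
  ultimately have s: "Sup Z \<in> Z" by (intro closed_contains_Sup)
  define s where "s = Sup Z"
  have s1: "s \<in> {a..b}" "f s \<ge> 0" using s by (auto simp: s_def Z_def)
  have neg: "f x < 0" if "x \<in> {s<..b}" for x
  proof (rule ccontr)
    assume "\<not> f x < 0"
    then have "x \<in> Z" using that s1 by (auto simp: Z_def)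
    then have "x \<le> s" unfolding s_def using Z(2) by (rule cSup_upper)
    then show False using that by simp
  qed
  have "s < b" using fb s1 by (cases "s = b") auto
  have "f s \<le> f b"
  proof (rule DERIV_nonneg_imp_increasing_open[where f = f])
    show "s \<le> b" using \<open>s < b\<close> by simp
    show "\<exists>y. (f has_real_derivative y) (at x) \<and> 0 \<le> y" if "s < x" "x < b" for x
      using der[of x] sgn[of x] neg[of x] that s1 by auto
    show "continuous_on {s..b} f" using cont s1 by (auto intro: continuous_on_subset)
  qed
  then show False using fb s1 by simp
qed

section \<open>The quadratic on the right-hand side\<close>

text \<open>For \<open>c3 = c3_star c1 c2\<close> the quadratic is half the square of an affine function, and increasing \<open>c3\<close> adds a
  multiple of \<open>1 - x\<^sup>2\<close>. This makes the nonnegativity on \<open>[-1,1]\<close> visible and locates the zeros of \<open>P\<close>.\<close>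

lemma P_poly_split:
  assumes "c \<in> J_set 0"
  shows "P_poly c x = (sqrt (c$1) * (1 - x) - sqrt (c$2) * (1 + x))\<^sup>2 / 2
            + (c$3 - c3_star (c$1) (c$2)) * (1 - x\<^sup>2)"
proof -
  define p q where "p = sqrt (c$1)" and "q = sqrt (c$2)"
  have "c$1 = p\<^sup>2" "c$2 = q\<^sup>2" using assms by (auto simp: J_set_def p_def q_def)
  then have P: "P_poly c x = p\<^sup>2 * (1 - x) + q\<^sup>2 * (1 + x) + c$3 * (1 - x\<^sup>2)"
    by (simp add: P_poly_def)
  have c3: "c3_star (c$1) (c$2) = - ((p + q)\<^sup>2 / 2)"
    by (simp add: c3_star_def c3_bar_def p_def q_def power2_eq_square)
  show ?thesis
    unfolding P c3 p_def[symmetric] q_def[symmetric] by (simp add: power2_eq_square field_simps)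
qed

lemma P_poly_nonneg:
  assumes "c \<in> J_set 0" "x \<in> {-1..1}"
  shows "P_poly c x \<ge> 0"
proof -
  have "x\<^sup>2 \<le> 1" using assms(2) by (simp add: abs_square_le_1 abs_le_iff)
  moreover have "c$3 - c3_star (c$1) (c$2) \<ge> 0"
    using assms by (auto simp: J_set_def c3_star_def)
  ultimately show ?thesis unfolding P_poly_split[OF assms(1)] by simp
qed

lemma P_poly_bound:
  assumes "norm c \<le> R" "x \<in> {-1..1}"
  shows "\<bar>P_poly c x\<bar> \<le> 5 * R"
proof -
  have c: "\<bar>c$i\<bar> \<le> R" for i using component_le_norm_cart[of c i] assms(1) by linarith
  have "x\<^sup>2 \<le> 1" using assms(2) by (simp add: abs_square_le_1 abs_le_iff)
  have "\<bar>c$1 * (1 - x)\<bar> \<le> R * 2" "\<bar>c$2 * (1 + x)\<bar> \<le> R * 2" "\<bar>c$3 * (1 - x\<^sup>2)\<bar> \<le> R * 1"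
    unfolding abs_mult using assms(2) c \<open>x\<^sup>2 \<le> 1\<close> by (intro mult_mono; auto simp: order_trans[OF abs_ge_zero c])+
  then show ?thesis unfolding P_poly_def by linarith
qed

lemma P_poly_diff: "P_poly c x - P_poly d x = P_poly (c - d) x"
  by (simp add: P_poly_def algebra_simps)

definition P_deriv :: "real^3 \<Rightarrow> real \<Rightarrow> real" where
  "P_deriv c x = c$2 - c$1 - 2 * c$3 * x"

lemma P_poly_deriv: "(P_poly c has_real_derivative P_deriv c x) (at x)"
  unfolding P_poly_def[abs_def] P_deriv_def
  by (auto intro!: derivative_eq_intros simp: algebra_simps)

lemma P_deriv_bound:
  assumes "norm c \<le> R" "x \<in> {-1..1}"
  shows "\<bar>P_deriv c x\<bar> \<le> 4 * R"
proof -
  have c: "\<bar>c$i\<bar> \<le> R" for i using component_le_norm_cart[of c i] assms(1) by linarith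
  have "\<bar>c$3 * x\<bar> \<le> R * 1"
    unfolding abs_mult using assms(2) c by (intro mult_mono; auto simp: order_trans[OF abs_ge_zero c])
  then show ?thesis unfolding P_deriv_def using c[of 1] c[of 2] by linarith
qed

text \<open>A function that is nonnegative on the whole line and has a bounded second derivative satisfies \<open>P'\<^sup>2 \<le> const * P\<close>. Here \<open>P\<close> is nonnegative only on
  \<open>[-1,1]\<close> and may have simple zeros at the end points; the weight \<open>1 - x\<^sup>2\<close> compensates for these.\<close>

lemma P_deriv_le_sqrt_P:
  assumes "c \<in> J_set 0" "norm c \<le> R" "x \<in> {-1..1}"
  shows "((1 - x\<^sup>2) * P_deriv c x)\<^sup>2 \<le> 24 * R * P_poly c x"
proof -
  define p q where "p = sqrt (c$1)" and "q = sqrt (c$2)"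
  define d where "d = c$3 - c3_star (c$1) (c$2)"
  define L where "L = p * (1 - x) - q * (1 + x)"
  have c: "\<bar>c$i\<bar> \<le> R" for i using component_le_norm_cart[of c i] assms(2) by linarith
  have nn: "c$1 \<ge> 0" "c$2 \<ge> 0" "d \<ge> 0" using assms(1) by (auto simp: J_set_def d_def c3_star_def)
  have pq: "p \<ge> 0" "q \<ge> 0" "p\<^sup>2 = c$1" "q\<^sup>2 = c$2" using nn by (auto simp: p_def q_def)
  have pq2: "(p + q)\<^sup>2 \<le> 4 * R"
  proof -
    have "(p + q)\<^sup>2 + (p - q)\<^sup>2 = 2 * (p\<^sup>2 + q\<^sup>2)" by (simp add: power2_eq_square algebra_simps)
    then have "(p + q)\<^sup>2 \<le> 2 * (p\<^sup>2 + q\<^sup>2)" using zero_le_power2[of "p - q"] by linarith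
    then have "(p + q)\<^sup>2 \<le> 2 * (c$1 + c$2)" unfolding pq .
    also have "\<dots> \<le> 4 * R" using abs_le_D1[OF c, of 1] abs_le_D1[OF c, of 2] by simp
    finally show ?thesis .
  qed
  have d3: "c$3 = d - (p + q)\<^sup>2 / 2"
    by (simp add: d_def c3_star_def c3_bar_def p_def q_def power2_eq_square)
  have dR: "d \<le> 3 * R" using d3 c[of 3] pq2 by linarith
  have y: "0 \<le> 1 - x\<^sup>2" "1 - x\<^sup>2 \<le> 1" using assms(3) by (auto simp: abs_square_le_1 abs_le_iff)
  have P: "P_poly c x = L\<^sup>2 / 2 + d * (1 - x\<^sup>2)"
    using P_poly_split[OF assms(1)] by (simp add: L_def d_def p_def q_def)
  have P': "P_deriv c x = - (L * (p + q)) - 2 * d * x"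
    unfolding P_deriv_def d3 L_def pq(3,4)[symmetric] by (simp add: power2_eq_square algebra_simps)
  have "((1 - x\<^sup>2) * P_deriv c x)\<^sup>2 = (1 - x\<^sup>2) * (1 - x\<^sup>2) * (P_deriv c x)\<^sup>2"
    by (simp add: power2_eq_square)
  also have "\<dots> \<le> (1 - x\<^sup>2) * (1 - x\<^sup>2) * (2 * (L\<^sup>2 * (p + q)\<^sup>2) + 2 * (4 * d\<^sup>2 * x\<^sup>2))"
  proof (rule mult_left_mono)
    have "(P_deriv c x)\<^sup>2 + (L * (p + q) - 2 * d * x)\<^sup>2 = 2 * (L\<^sup>2 * (p + q)\<^sup>2) + 2 * (4 * d\<^sup>2 * x\<^sup>2)"
      unfolding P' by (simp add: power2_eq_square algebra_simps)
    then show "(P_deriv c x)\<^sup>2 \<le> 2 * (L\<^sup>2 * (p + q)\<^sup>2) + 2 * (4 * d\<^sup>2 * x\<^sup>2)"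
      using zero_le_power2[of "L * (p + q) - 2 * d * x"] by linarith
  qed (use y in auto)
  also have "\<dots> = (1 - x\<^sup>2) * (1 - x\<^sup>2) * (2 * (L\<^sup>2 * (p + q)\<^sup>2))
                  + (1 - x\<^sup>2) * (8 * d * (d * (1 - x\<^sup>2)) * x\<^sup>2)"
    by (simp add: power2_eq_square algebra_simps)
  also have "\<dots> \<le> 1 * 1 * (2 * (L\<^sup>2 * (4 * R))) + 1 * (8 * (3 * R) * (d * (1 - x\<^sup>2)) * 1)"
    using y pq2 dR nn c[of 1] by (intro add_mono mult_mono mult_nonneg_nonneg) auto
  also have "\<dots> \<le> 24 * R * P_poly c x"
    using c[of 1] unfolding P by (simp add: algebra_simps)
  finally show ?thesis .
qed

section \<open>Barriers for solutions\<close>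

lemma solution_deriv:
  assumes "is_solution \<nu> c U" "\<nu> > 0" "x \<in> {-1<..<1}"
  shows "(U has_real_derivative (P_poly c x - 2 * \<nu> * x * U x - (U x)\<^sup>2 / 2) / (\<nu> * (1 - x\<^sup>2))) (at x)"
proof -
  obtain D where "\<And>x. x \<in> {-1<..<1} \<Longrightarrow> (U has_vector_derivative D x) (at x)"
    using assms(1) unfolding is_solution_def C1_differentiable_on_def by blast
  then have D: "(U has_real_derivative D x) (at x)"
    using assms(3) by (simp add: has_real_derivative_iff_has_vector_derivative)
  have "x\<^sup>2 < 1" using assms(3) by (simp add: abs_square_less_1 abs_less_iff)
  have "\<nu> * (1 - x\<^sup>2) * D x + 2 * \<nu> * x * U x + (1/2) * (U x)\<^sup>2 = P_poly c x"
    using assms(1,3) DERIV_imp_deriv[OF D] unfolding is_solution_def by (metis (no_types, lifting))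
  then have "D x = (P_poly c x - 2 * \<nu> * x * U x - (U x)\<^sup>2 / 2) / (\<nu> * (1 - x\<^sup>2))"
    using \<open>x\<^sup>2 < 1\<close> assms(2) by (simp add: field_simps)
  then show ?thesis using D by simp
qed

lemma solution_continuous:
  assumes "is_solution \<nu> c U"
  shows "continuous_on {-1<..<1} U"
  using assms C1_differentiable_imp_continuous_on unfolding is_solution_def by blast

lemma one_minus_sq_pos: "x \<in> {-1<..<1} \<Longrightarrow> 0 < 1 - x\<^sup>2" for x :: real
  by (simp add: abs_square_less_1 abs_less_iff)

text \<open>The integral of \<open>1 / (1 - x\<^sup>2)\<close> diverges at \<open>-1\<close>, so a function whose derivative is at least \<open>k / (1 - x\<^sup>2)\<close> tends to
  minus infinity there. This replaces any discussion of boundary values of solutions.\<close>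

lemma no_escape_at_left_end:
  fixes g g' :: "real \<Rightarrow> real"
  assumes "k > 0" "x0 \<in> {-1<..<1}"
    and der: "\<And>x. x \<in> {-1<..x0} \<Longrightarrow> (g has_real_derivative g' x) (at x)"
    and rate: "\<And>x. x \<in> {-1<..x0} \<Longrightarrow> k \<le> (1 - x\<^sup>2) * g' x"
    and bdd: "\<And>x. x \<in> {-1<..x0} \<Longrightarrow> B \<le> g x"
  shows False
proof -
  define h where "h x = g x - k / 2 * ln (1 + x)" for x
  have h_mono: "h x \<le> h x0" if x: "x \<in> {-1<..x0}" for x
  proof (rule DERIV_nonneg_imp_nondecreasing[where f = h])
    show "x \<le> x0" using x by simp
    show "\<exists>y. (h has_real_derivative y) (at t) \<and> 0 \<le> y" if "x \<le> t" "t \<le> x0" for t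
    proof (intro exI conjI)
      have t: "t \<in> {-1<..x0}" "t \<in> {-1<..<1}" using that x assms(2) by auto
      have "((\<lambda>x. ln (1 + x)) has_real_derivative 1 / (1 + t)) (at t)"
        using t by (auto intro!: derivative_eq_intros)
      then show "(h has_real_derivative (g' t - k / 2 * (1 / (1 + t)))) (at t)"
        unfolding h_def by (intro DERIV_diff der[OF t(1)] DERIV_cmult)
      have "k * (1 - t) \<le> k * 2" using t assms(1) by (intro mult_left_mono) auto
      then have "k * (1 - t\<^sup>2) \<le> k * 2 * (1 + t)"
        using mult_right_mono[of "k * (1 - t)" "k * 2" "1 + t"] t by (simp add: power2_eq_square algebra_simps)
      have "k / 2 * (1 / (1 + t)) \<le> k / (1 - t\<^sup>2)"
        using t one_minus_sq_pos[OF t(2)] \<open>k * (1 - t\<^sup>2) \<le> k * 2 * (1 + t)\<close> by (simp add: field_simps)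
      also have "\<dots> \<le> g' t"
        using rate[OF t(1)] one_minus_sq_pos[OF t(2)] by (simp add: field_simps)
      finally show "0 \<le> g' t - k / 2 * (1 / (1 + t))" by simp
    qed
  qed
  define A where "A = 2 / k * (B - h x0)"
  have low: "A \<le> ln (1 + x)" if "x \<in> {-1<..x0}" for x
    using h_mono[OF that] bdd[OF that] assms(1) by (simp add: A_def h_def field_simps)
  (* At this point ln (1 + x) falls below the bound A that holds on the whole interval. *)
  define x where "x = min x0 (exp (A - 1) - 1)"
  have x: "x \<in> {-1<..x0}" using assms(2) by (auto simp: x_def)
  have "0 < 1 + x" using x by simp
  moreover have "1 + x \<le> exp (A - 1)" by (simp add: x_def)
  ultimately have "ln (1 + x) \<le> ln (exp (A - 1))" by (intro ln_mono) auto
  then have "ln (1 + x) \<le> A - 1" by simp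
  with low[OF x] show False by simp
qed

lemma sqrt_P_deriv:
  assumes "c \<in> J_set 0" "x \<in> {-1<..<1}" "t > 0"
  shows "((\<lambda>x. sqrt (2 * P_poly c x + 2 * t)) has_real_derivative
           P_deriv c x / sqrt (2 * P_poly c x + 2 * t)) (at x)"
proof -
  have "2 * P_poly c x + 2 * t > 0" using P_poly_nonneg[OF assms(1), of x] assms by simp
  then show ?thesis
    by (auto intro!: derivative_eq_intros P_poly_deriv simp: field_simps)
qed

text \<open>The weighted derivative of \<open>sqrt (2 P + 2 t)\<close> is bounded uniformly in \<open>t > 0\<close>; the statement avoids the division.\<close>

lemma P_deriv_le_sqrt:
  assumes "c \<in> J_set 0" "norm c \<le> R" "1 \<le> R" "x \<in> {-1<..<1}" "t > 0"
  shows "(1 - x\<^sup>2) * \<bar>P_deriv c x\<bar> \<le> 4 * R * sqrt (2 * P_poly c x + 2 * t)"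
proof -
  have P: "P_poly c x \<ge> 0" using P_poly_nonneg[OF assms(1), of x] assms by simp
  have "((1 - x\<^sup>2) * \<bar>P_deriv c x\<bar>)\<^sup>2 = ((1 - x\<^sup>2) * P_deriv c x)\<^sup>2" by (simp add: power_mult_distrib)
  also have "\<dots> \<le> 24 * R * P_poly c x" using P_deriv_le_sqrt_P[OF assms(1,2), of x] assms(4) by simp
  also have "\<dots> \<le> 16 * R * (2 * P_poly c x + 2 * t)" using P assms by (simp add: field_simps)
  also have "\<dots> \<le> 16 * R * R * (2 * P_poly c x + 2 * t)" using P assms by (intro mult_right_mono) auto
  also have "\<dots> = (4 * R * sqrt (2 * P_poly c x + 2 * t))\<^sup>2"
    using P assms by (simp add: power_mult_distrib power2_eq_square)
  finally show ?thesis by (rule power2_le_imp_le) (use P assms in auto)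
qed

text \<open>With \<open>V = sqrt (2 P + 2 K \<nu>)\<close> and \<open>U > V\<close>, the term \<open>K \<nu>\<close> dominates all terms of order \<open>\<nu>\<close> in the equation for \<open>f = V - U\<close>, and
  what remains is the Riccati inequality \<open>(1 - x\<^sup>2) f' \<ge> f\<^sup>2 / (2 \<nu>)\<close>. Then \<open>- 1/f\<close> is positive and escapes to
  minus infinity at \<open>-1\<close>, a contradiction.\<close>

lemma solution_upper:
  assumes sol: "is_solution \<nu> c U" and J: "c \<in> J_set 0" and R: "norm c \<le> R" "1 \<le> R"
    and nu: "0 < \<nu>" "\<nu> \<le> 1" and x0: "x0 \<in> {-1<..<1}"
  shows "U x0 \<le> sqrt (2 * P_poly c x0 + 200 * R * \<nu>)"
proof (rule ccontr)
  (* Since V <= 15 R, this K exceeds 4 R + 2 V, the sum of the competing terms of order nu. *)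
  define K where "K = 100 * R"
  define V where "V x = sqrt (2 * P_poly c x + 2 * (K * \<nu>))" for x
  define U' where "U' x = (P_poly c x - 2 * \<nu> * x * U x - (U x)\<^sup>2 / 2) / (\<nu> * (1 - x\<^sup>2))" for x
  define f where "f x = V x - U x" for x
  define f' where "f' x = P_deriv c x / V x - U' x" for x
  assume "\<not> ?thesis"
  then have "f x0 < 0" by (simp add: f_def V_def K_def mult.assoc)
  have Knu: "K * \<nu> > 0" using R nu by (simp add: K_def)
  have der: "(f has_real_derivative f' x) (at x)" if "x \<in> {-1<..<1}" for x
    unfolding f_def f'_def U'_def V_def using solution_deriv[OF sol nu(1) that] sqrt_P_deriv[OF J that Knu]
    by (auto intro!: derivative_intros)
  have rate: "(f x)\<^sup>2 / (2 * \<nu>) \<le> (1 - x\<^sup>2) * f' x" if x: "x \<in> {-1<..<1}" and neg: "f x < 0" for x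
  proof -
    have P: "0 \<le> P_poly c x" "P_poly c x \<le> 5 * R"
      using P_poly_nonneg[OF J, of x] P_poly_bound[OF R(1), of x] x by auto
    have V2: "(V x)\<^sup>2 = 2 * P_poly c x + 2 * K * \<nu>" using P Knu by (simp add: V_def)
    have V0: "V x > 0" using P Knu by (simp add: V_def)
    have "(2 * \<nu>)\<^sup>2 \<le> (V x)\<^sup>2"
    proof -
      have "\<nu> * \<nu> \<le> R * \<nu>" using nu R by (intro mult_right_mono) auto
      moreover have "0 \<le> R * \<nu>" using nu R by simp
      moreover have "(2 * \<nu>)\<^sup>2 = 4 * (\<nu> * \<nu>)" "2 * (100 * R) * \<nu> = 200 * (R * \<nu>)" by (auto simp: power2_eq_square)
      ultimately show ?thesis unfolding V2 K_def using P by linarith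
    qed
    then have Vnu: "2 * \<nu> \<le> V x" by (rule power2_le_imp_le) (use V0 in simp)
    have "(V x)\<^sup>2 \<le> (15 * R)\<^sup>2"
    proof -
      have "K * \<nu> \<le> 100 * R" using nu R by (simp add: K_def)
      moreover have "R \<le> R * R" using mult_left_mono[of 1 R R] R by simp
      moreover have "(15 * R)\<^sup>2 = 225 * (R * R)" by (simp add: power2_eq_square)
      ultimately show ?thesis unfolding V2 using P by linarith
    qed
    then have V15: "V x \<le> 15 * R" by (rule power2_le_imp_le) (use R in simp)
    define a where "a = 1 - x\<^sup>2"
    have a: "a > 0" using one_minus_sq_pos[OF x] by (simp add: a_def)
    have eqn: "\<nu> * (a * f' x) = \<nu> * (a * P_deriv c x / V x) - P_poly c x + 2 * \<nu> * x * U x + (U x)\<^sup>2 / 2"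
      unfolding f'_def U'_def a_def[symmetric] using a nu V0 by (simp add: field_simps)
    have t1: "a * P_deriv c x / V x \<ge> - (4 * R)"
    proof -
      have "a * \<bar>P_deriv c x\<bar> \<le> 4 * R * V x"
        using P_deriv_le_sqrt[OF J R x Knu] by (simp add: V_def a_def)
      then have "- (4 * R * V x) \<le> a * P_deriv c x"
        using a abs_ge_minus_self[of "a * P_deriv c x"] by (simp add: abs_mult)
      then show ?thesis using V0 by (simp add: field_simps)
    qed
    have t2: "x * U x \<ge> - U x"
    proof -
      have "0 \<le> (1 + x) * U x" using x neg V0 by (intro mult_nonneg_nonneg) (auto simp: f_def)
      then show ?thesis by (simp add: algebra_simps)
    qed
    have "\<nu> * (a * P_deriv c x / V x) \<ge> \<nu> * (- (4 * R))" using t1 nu by (intro mult_left_mono) auto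
    moreover have "2 * \<nu> * (x * U x) \<ge> 2 * \<nu> * (- U x)" using t2 nu by (intro mult_left_mono) auto
    ultimately have "\<nu> * (a * f' x) \<ge> \<nu> * (- (4 * R)) - P_poly c x + 2 * \<nu> * (- U x) + (U x)\<^sup>2 / 2"
      unfolding eqn by (simp add: mult.assoc)
    also have "\<nu> * (- (4 * R)) - P_poly c x + 2 * \<nu> * (- U x) + (U x)\<^sup>2 / 2
        = \<nu> * (K - 4 * R - 2 * V x) + (V x - 2 * \<nu>) * (- f x) + (f x)\<^sup>2 / 2"
    proof -
      have "P_poly c x = (V x)\<^sup>2 / 2 - K * \<nu>" using V2 by linarith
      then show ?thesis by (simp add: f_def power2_eq_square field_simps)
    qed
    finally have "\<nu> * (a * f' x) \<ge> \<nu> * (K - 4 * R - 2 * V x) + (V x - 2 * \<nu>) * (- f x) + (f x)\<^sup>2 / 2" .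
    moreover have "0 \<le> \<nu> * (K - 4 * R - 2 * V x)" using V15 nu R by (simp add: K_def)
    moreover have "0 \<le> (V x - 2 * \<nu>) * (- f x)" using Vnu neg by (intro mult_nonneg_nonneg) auto
    ultimately have "(f x)\<^sup>2 / 2 \<le> \<nu> * (a * f' x)" by linarith
    then show ?thesis using nu by (simp add: a_def field_simps)
  qed
  have neg: "f x < 0" if x: "x \<in> {-1<..x0}" for x
  proof (rule ccontr)
    assume "\<not> f x < 0"
    have "0 \<le> f x0"
    proof (rule nonneg_persists[where f = f and f' = f' and a = x])
      show "(f has_real_derivative f' y) (at y)" if "y \<in> {x..x0}" for y
        using der[of y] that x x0 by auto
      show "0 \<le> f' y" if "y \<in> {x..x0}" "f y < 0" for y
      proof -
        have y: "y \<in> {-1<..<1}" using that x x0 by auto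
        have "0 \<le> (f y)\<^sup>2 / (2 * \<nu>)" using nu by simp
        then have "0 \<le> (1 - y\<^sup>2) * f' y" using rate[OF y that(2)] by linarith
        then show ?thesis using one_minus_sq_pos[OF y] by (simp add: zero_le_mult_iff)
      qed
    qed (use x \<open>\<not> f x < 0\<close> in auto)
    then show False using \<open>f x0 < 0\<close> by simp
  qed
  show False
  proof (rule no_escape_at_left_end[where g = "\<lambda>x. - inverse (f x)" and g' = "\<lambda>x. f' x / (f x)\<^sup>2"
        and k = "1 / (2 * \<nu>)" and B = 0 and ?x0.0 = x0])
    fix x assume x: "x \<in> {-1<..x0}"
    then have x1: "x \<in> {-1<..<1}" using x0 by auto
    show "((\<lambda>x. - inverse (f x)) has_real_derivative f' x / (f x)\<^sup>2) (at x)"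
      using der[OF x1] neg[OF x] by (auto intro!: derivative_eq_intros simp: power2_eq_square field_simps)
    have "(f x)\<^sup>2 > 0" using neg[OF x] by simp
    then show "1 / (2 * \<nu>) \<le> (1 - x\<^sup>2) * (f' x / (f x)\<^sup>2)"
      using rate[OF x1 neg[OF x]] by (simp add: field_simps)
    show "0 \<le> - inverse (f x)" using neg[OF x] by simp
  qed (use nu x0 in auto)
qed

text \<open>The barrier \<open>V = S - K \<nu> / S\<close> with \<open>S = sqrt (2 P + 2 \<nu>)\<close> may be negative where \<open>P\<close> is of order \<open>\<nu>\<close>; this is harmless since there
  the claim is trivial. Where \<open>0 \<le> U < V\<close>, one has \<open>S\<^sup>2 > K \<nu>\<close> and \<open>V\<^sup>2 \<le> 2 P + 2 \<nu> - K \<nu>\<close>, and this gain of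
  \<open>K \<nu>\<close> makes \<open>U - V\<close> grow at the rate \<open>5 R / \<epsilon>\<close>. Since \<open>V \<le> 4 R\<close>, the gap cannot survive on an interval of length \<open>\<epsilon>\<close>.\<close>

lemma nonneg_solution_lower:
  assumes sol: "is_solution \<nu> c U" and J: "c \<in> J_set 0" and R: "norm c \<le> R" "1 \<le> R"
    and nu: "0 < \<nu>" "\<nu> \<le> 1" and a: "-1 \<le> a" and eps: "\<epsilon> > 0"
    and pos: "\<And>x. x \<in> {a<..<1} \<Longrightarrow> 0 \<le> U x"
    and x0: "x0 \<in> {a + \<epsilon><..<1}"
  shows "P_poly c x0 - (34 * R + 10 * R / \<epsilon>) * \<nu> \<le> (U x0)\<^sup>2 / 2"
proof -
  (* K / 2 exceeds 17 R, a bound for the competing terms of order nu, by the desired rate 5 R / eps. *)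
  define K where "K = 34 * R + 10 * R / \<epsilon>"
  define S where "S x = sqrt (2 * P_poly c x + 2 * \<nu>)" for x
  define U' where "U' x = (P_poly c x - 2 * \<nu> * x * U x - (U x)\<^sup>2 / 2) / (\<nu> * (1 - x\<^sup>2))" for x
  define S' where "S' x = P_deriv c x / S x" for x
  define V where "V x = S x - K * \<nu> / S x" for x
  define f where "f x = U x - V x" for x
  define f' where "f' x = U' x - S' x * (1 + K * \<nu> / (S x)\<^sup>2)" for x
  have K: "K > 0" using R eps by (simp add: K_def add_pos_pos)
  have P: "0 \<le> P_poly c x" "P_poly c x \<le> 5 * R" if "x \<in> {a<..<1}" for x
    using P_poly_nonneg[OF J, of x] P_poly_bound[OF R(1), of x] that a by auto
  have S: "S x > 0" "(S x)\<^sup>2 = 2 * P_poly c x + 2 * \<nu>" "S x \<le> 4 * R" if "x \<in> {a<..<1}" for x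
  proof -
    show S2: "S x > 0" "(S x)\<^sup>2 = 2 * P_poly c x + 2 * \<nu>" using P[OF that] nu by (auto simp: S_def)
    have "R \<le> R * R" using mult_left_mono[of 1 R R] R by simp
    moreover have "(4 * R)\<^sup>2 = 16 * (R * R)" by (simp add: power2_eq_square)
    ultimately have "(S x)\<^sup>2 \<le> (4 * R)\<^sup>2" unfolding S2(2) using P[OF that] nu R by linarith
    then show "S x \<le> 4 * R" by (rule power2_le_imp_le) (use R in simp)
  qed
  have der: "(f has_real_derivative f' x) (at x)" if "x \<in> {a<..<1}" for x
  proof -
    have x: "x \<in> {-1<..<1}" using that a by auto
    have dS: "(S has_real_derivative S' x) (at x)"
      unfolding S_def[abs_def] S'_def S_def by (rule sqrt_P_deriv[OF J x nu(1)])
    show ?thesis unfolding f_def V_def f'_def U'_def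
      using S(1)[OF that] solution_deriv[OF sol nu(1) x] dS
      by (auto intro!: derivative_eq_intros simp: power2_eq_square field_simps)
  qed
  have rate: "5 * R / \<epsilon> \<le> f' x" if xa: "x \<in> {a<..<1}" and neg: "f x < 0" for x
  proof -
    have x: "x \<in> {-1<..<1}" using xa a by auto
    define b where "b = 1 - x\<^sup>2"
    have b: "b > 0" "b \<le> 1" using one_minus_sq_pos[OF x] by (auto simp: b_def)
    note Sx = S[OF xa]
    have UV: "0 \<le> U x" "U x < V x" using pos[OF xa] neg by (auto simp: f_def)
    have "K * \<nu> / S x < S x" using UV by (simp add: V_def)
    then have KS: "K * \<nu> < (S x)\<^sup>2" using Sx(1) by (simp add: field_simps power2_eq_square)
    have VS: "V x \<le> S x" using Sx K nu by (simp add: V_def)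
    have "(V x)\<^sup>2 = (S x)\<^sup>2 - 2 * (K * \<nu>) + K * \<nu> * (K * \<nu> / (S x)\<^sup>2)"
      using Sx(1) by (simp add: V_def power2_eq_square field_simps)
    also have "\<dots> \<le> (S x)\<^sup>2 - 2 * (K * \<nu>) + K * \<nu> * 1"
      using KS Sx(1) K nu by (intro add_left_mono mult_left_mono) (auto simp: field_simps)
    finally have V2: "(V x)\<^sup>2 \<le> 2 * P_poly c x + 2 * \<nu> - K * \<nu>" using Sx by simp
    have U2: "(U x)\<^sup>2 \<le> (V x)\<^sup>2" using UV by (intro power_mono) auto
    have xU: "x * U x \<le> 4 * R"
    proof -
      have "x * U x \<le> 1 * U x" using UV x by (intro mult_right_mono) auto
      then show ?thesis using UV VS Sx by linarith
    qed
    have "b * (S' x * (1 + K * \<nu> / (S x)\<^sup>2)) \<le> 8 * R"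
    proof -
      have "b * \<bar>P_deriv c x\<bar> \<le> 4 * R * S x"
        using P_deriv_le_sqrt[OF J R x nu(1)] by (simp add: S_def b_def)
      then have "b * \<bar>S' x\<bar> \<le> 4 * R" using Sx by (simp add: S'_def field_simps)
      moreover have "K * \<nu> / (S x)\<^sup>2 \<le> 1" "0 \<le> K * \<nu> / (S x)\<^sup>2" using KS K nu Sx(1) by (auto simp: field_simps)
      ultimately have "b * \<bar>S' x\<bar> * (1 + K * \<nu> / (S x)\<^sup>2) \<le> 4 * R * 2"
        using R by (intro mult_mono[of "b * \<bar>S' x\<bar>"]) auto
      moreover have "b * S' x * (1 + K * \<nu> / (S x)\<^sup>2) \<le> b * \<bar>S' x\<bar> * (1 + K * \<nu> / (S x)\<^sup>2)"
        using b \<open>0 \<le> K * \<nu> / (S x)\<^sup>2\<close> by (intro mult_right_mono mult_left_mono) auto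
      ultimately show ?thesis by (simp add: mult.assoc)
    qed
    then have t1: "\<nu> * (b * (S' x * (1 + K * \<nu> / (S x)\<^sup>2))) \<le> \<nu> * (8 * R)"
      using nu by (intro mult_left_mono) auto
    have t2: "2 * \<nu> * (x * U x) \<le> 2 * \<nu> * (4 * R)" using xU nu by (intro mult_left_mono) auto
    have "\<nu> * (b * f' x) = P_poly c x - 2 * \<nu> * (x * U x) - (U x)\<^sup>2 / 2
                 - \<nu> * (b * (S' x * (1 + K * \<nu> / (S x)\<^sup>2)))"
      unfolding f'_def U'_def b_def[symmetric] using b nu by (simp add: field_simps)
    also have "\<dots> \<ge> \<nu> * (K / 2 - 1 - 16 * R)"
    proof -
      have e: "\<nu> * (K / 2 - 1 - 16 * R) = K * \<nu> / 2 - \<nu> - \<nu> * (8 * R) - 2 * \<nu> * (4 * R)"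
        by (simp add: algebra_simps)
      show ?thesis unfolding e using U2 V2 t1 t2 by linarith
    qed
    finally have "K / 2 - 1 - 16 * R \<le> b * f' x" using nu by (simp add: mult_le_cancel_left_pos)
    moreover have "K / 2 = 17 * R + 5 * R / \<epsilon>" by (simp add: K_def add_divide_distrib)
    then have "5 * R / \<epsilon> \<le> K / 2 - 1 - 16 * R" using R by linarith
    ultimately have "5 * R / \<epsilon> \<le> b * f' x" by linarith
    moreover have "0 < 5 * R / \<epsilon>" using R eps by simp
    ultimately have "0 < b * f' x" by linarith
    then have "0 < f' x" using b by (simp add: zero_less_mult_iff)
    then have "b * f' x \<le> 1 * f' x" using b by (intro mult_right_mono) auto
    then show ?thesis using \<open>5 * R / \<epsilon> \<le> b * f' x\<close> by linarith
  qed
  have rate0: "0 \<le> f' x" if "x \<in> {a<..<1}" "f x < 0" for x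
  proof -
    have "0 < 5 * R / \<epsilon>" using R eps by simp
    then show ?thesis using rate[OF that] by linarith
  qed
  have x0a: "x0 \<in> {a<..<1}" "x0 - \<epsilon> \<in> {a<..<1}" using x0 eps by auto
  have "V x0 \<le> U x0"
  proof (rule ccontr)
    assume "\<not> ?thesis"
    then have f0: "f x0 < 0" by (simp add: f_def)
    have neg: "f x < 0" if x: "x \<in> {x0 - \<epsilon>..x0}" for x
    proof (rule ccontr)
      assume "\<not> f x < 0"
      have "0 \<le> f x0"
      proof (rule nonneg_persists[where f = f and f' = f' and a = x])
        fix y assume y: "y \<in> {x..x0}"
        then have y: "y \<in> {a<..<1}" using x x0a by auto
        show "(f has_real_derivative f' y) (at y)" by (rule der[OF y])
        show "0 \<le> f' y" if "f y < 0" by (rule rate0[OF y that])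
      qed (use x \<open>\<not> f x < 0\<close> in auto)
      then show False using f0 by simp
    qed
    define g where "g x = f x - 5 * R / \<epsilon> * x" for x
    have "g (x0 - \<epsilon>) \<le> g x0"
    proof (rule DERIV_nonneg_imp_nondecreasing[where f = g])
      show "x0 - \<epsilon> \<le> x0" using eps by simp
      fix y assume y: "x0 - \<epsilon> \<le> y" "y \<le> x0"
      then have ya: "y \<in> {a<..<1}" using x0a by auto
      show "\<exists>z. (g has_real_derivative z) (at y) \<and> 0 \<le> z"
      proof (intro exI conjI)
        show "(g has_real_derivative (f' y - 5 * R / \<epsilon>)) (at y)"
          unfolding g_def by (intro DERIV_diff der[OF ya] DERIV_cmult_Id)
        show "0 \<le> f' y - 5 * R / \<epsilon>" using rate[OF ya neg] y by simp
      qed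
    qed
    have "f (x0 - \<epsilon>) + 5 * R \<le> f x0"
    proof -
      have "5 * R / \<epsilon> * x0 = 5 * R / \<epsilon> * (x0 - \<epsilon>) + 5 * R"
        using eps by (simp add: right_diff_distrib)
      then show ?thesis using \<open>g (x0 - \<epsilon>) \<le> g x0\<close> unfolding g_def by linarith
    qed
    moreover have "f (x0 - \<epsilon>) \<ge> - (4 * R)"
    proof -
      have "V (x0 - \<epsilon>) \<le> S (x0 - \<epsilon>)" using S(1)[OF x0a(2)] K nu by (simp add: V_def)
      then show ?thesis using S(3)[OF x0a(2)] pos[OF x0a(2)] by (simp add: f_def)
    qed
    ultimately show False using f0 R by linarith
  qed
  show ?thesis
  proof (cases "V x0 \<ge> 0")
    case True
    have "(V x0)\<^sup>2 = (S x0)\<^sup>2 - 2 * (K * \<nu>) + (K * \<nu> / S x0)\<^sup>2"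
      using S(1)[OF x0a(1)] by (simp add: V_def power2_eq_square field_simps)
    then have "(S x0)\<^sup>2 - 2 * (K * \<nu>) \<le> (V x0)\<^sup>2" by simp
    moreover have "(V x0)\<^sup>2 \<le> (U x0)\<^sup>2" using True \<open>V x0 \<le> U x0\<close> by (intro power_mono) auto
    ultimately show ?thesis using S(2)[OF x0a(1)] nu unfolding K_def[symmetric] by linarith
  next
    case False
    then have "S x0 < K * \<nu> / S x0" by (simp add: V_def)
    then have "(S x0)\<^sup>2 < K * \<nu>" using S(1)[OF x0a(1)] by (simp add: field_simps power2_eq_square)
    then have "2 * P_poly c x0 < K * \<nu>" using S(2)[OF x0a(1)] nu by linarith
    then have "P_poly c x0 - K * \<nu> \<le> 0" using P[OF x0a(1)] by linarith
    then show ?thesis unfolding K_def[symmetric] using zero_le_power2[of "U x0"] by linarith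
  qed
qed

section \<open>Signs, zeros and extremal solutions\<close>

lemma integrating_factor:
  assumes nu: "\<nu> > 0" and yz: "y \<in> {-1<..<1}" "z \<in> {-1<..<1}" "y \<le> z"
    and q: "continuous_on {-1<..<1} q"
  obtains E where "\<And>x. E x > (0::real)"
    "\<And>x. x \<in> {y..z} \<Longrightarrow> (E has_real_derivative E x * (q x / (\<nu> * (1 - x\<^sup>2)))) (at x within {y..z})"
proof -
  have "continuous_on {y..z} (\<lambda>x. q x / (\<nu> * (1 - x\<^sup>2)))"
  proof (rule continuous_on_divide)
    show "continuous_on {y..z} q" using q yz by (auto intro: continuous_on_subset)
    show "continuous_on {y..z} (\<lambda>x. \<nu> * (1 - x\<^sup>2))" by (intro continuous_intros)
    show "\<forall>x\<in>{y..z}. \<nu> * (1 - x\<^sup>2) \<noteq> 0"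
    proof
      fix x assume "x \<in> {y..z}"
      then have "x \<in> {-1<..<1}" using yz by auto
      then show "\<nu> * (1 - x\<^sup>2) \<noteq> 0" using nu one_minus_sq_pos[of x] by simp
    qed
  qed
  then obtain G where G: "\<And>x. x \<in> {y..z} \<Longrightarrow>
      (G has_vector_derivative q x / (\<nu> * (1 - x\<^sup>2))) (at x within {y..z})"
    using antiderivative_continuous by blast
  show ?thesis
  proof (rule that[of "\<lambda>x. exp (G x)"])
    fix x assume x: "x \<in> {y..z}"
    have "(G has_real_derivative q x / (\<nu> * (1 - x\<^sup>2))) (at x within {y..z})"
      using G[OF x] by (simp add: has_real_derivative_iff_has_vector_derivative)
    then show "((\<lambda>x. exp (G x)) has_real_derivative exp (G x) * (q x / (\<nu> * (1 - x\<^sup>2)))) (at x within {y..z})"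
      by (auto intro!: derivative_eq_intros)
  qed simp
qed

text \<open>The logarithmic derivative of \<open>E\<close> is \<open>(2 \<nu> x + U/2) / (\<nu> (1 - x\<^sup>2))\<close>, so that \<open>(U E)' = E P / (\<nu> (1 - x\<^sup>2)) \<ge> 0\<close>.\<close>

lemma solution_weighted_mono:
  assumes sol: "is_solution \<nu> c U" "\<nu> > 0" and J: "c \<in> J_set 0"
    and yz: "y \<in> {-1<..<1}" "z \<in> {-1<..<1}" "y \<le> z"
  obtains E where "\<And>x. E x > (0::real)" "\<And>s t. y \<le> s \<Longrightarrow> s \<le> t \<Longrightarrow> t \<le> z \<Longrightarrow> U s * E s \<le> U t * E t"
proof -
  have "continuous_on {-1<..<1} (\<lambda>x. 2 * \<nu> * x + U x / 2)"
    by (intro continuous_intros solution_continuous[OF sol(1)]) auto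
  from integrating_factor[OF sol(2) yz this] obtain E where E: "\<And>x. E x > 0"
    "\<And>x. x \<in> {y..z} \<Longrightarrow> (E has_real_derivative E x * ((2 * \<nu> * x + U x / 2) / (\<nu> * (1 - x\<^sup>2)))) (at x within {y..z})"
    by blast
  have der: "((\<lambda>x. U x * E x) has_real_derivative E x * P_poly c x / (\<nu> * (1 - x\<^sup>2))) (at x within {y..z})"
    if x: "x \<in> {y..z}" for x
  proof -
    have x1: "x \<in> {-1<..<1}" using x yz by auto
    have b: "1 - x\<^sup>2 > 0" by (rule one_minus_sq_pos[OF x1])
    have U: "(U has_real_derivative (P_poly c x - 2 * \<nu> * x * U x - (U x)\<^sup>2 / 2) / (\<nu> * (1 - x\<^sup>2))) (at x within {y..z})"
      by (rule has_field_derivative_at_within[OF solution_deriv[OF sol x1]])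
    have eq: "(P_poly c x - 2 * \<nu> * x * U x - (U x)\<^sup>2 / 2) / (\<nu> * (1 - x\<^sup>2)) * E x
        + E x * ((2 * \<nu> * x + U x / 2) / (\<nu> * (1 - x\<^sup>2))) * U x = E x * P_poly c x / (\<nu> * (1 - x\<^sup>2))"
      using b sol(2) by (simp add: divide_simps) (simp add: power2_eq_square algebra_simps)
    show ?thesis using DERIV_mult[OF U E(2)[OF x]] unfolding eq .
  qed
  show ?thesis
  proof (rule that[OF E(1)])
    fix s t assume st: "y \<le> s" "s \<le> t" "t \<le> z"
    show "U s * E s \<le> U t * E t"
    proof (rule DERIV_nonneg_imp_increasing_open[where f = "\<lambda>x. U x * E x"])
      show "continuous_on {s..t} (\<lambda>x. U x * E x)"
        by (rule continuous_on_subset[of "{y..z}"])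
           (use st in \<open>auto intro!: DERIV_continuous_on[OF der]\<close>)
      fix x assume x: "s < x" "x < t"
      then have x1: "x \<in> {y..z}" "x \<in> {-1<..<1}" using st yz by auto
      have "at x within {y..z} = at x" using x st by (intro at_within_interior) auto
      then have "((\<lambda>x. U x * E x) has_real_derivative E x * P_poly c x / (\<nu> * (1 - x\<^sup>2))) (at x)"
        using der[OF x1(1)] by simp
      moreover have "0 \<le> E x * P_poly c x / (\<nu> * (1 - x\<^sup>2))"
        using E(1)[of x] P_poly_nonneg[OF J, of x] one_minus_sq_pos[OF x1(2)] sol(2) x1
        by (intro divide_nonneg_nonneg mult_nonneg_nonneg) auto
      ultimately show "\<exists>d. ((\<lambda>x. U x * E x) has_real_derivative d) (at x) \<and> 0 \<le> d" by blast
    qed (use st in auto)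
  qed
qed

lemma solution_nonneg_right_of_zero:
  assumes "is_solution \<nu> c U" "\<nu> > 0" "c \<in> J_set 0"
    and "y \<in> {-1<..<1}" "z \<in> {-1<..<1}" "y \<le> z" "U y \<ge> 0"
  shows "U z \<ge> 0"
proof -
  obtain E where E: "\<And>x. E x > (0::real)" "U y * E y \<le> U z * E z"
    using solution_weighted_mono[OF assms(1-6)] assms(6) by (metis order_refl)
  have "0 \<le> U y * E y" using assms(7) E(1)[of y] by simp
  then show ?thesis using E(1)[of z] E(2) zero_le_mult_iff[of "U z" "E z"] by linarith
qed

lemma P_poly_zero_on_interval:
  assumes "a < b" "\<And>x. x \<in> {a<..<b} \<Longrightarrow> P_poly c x = 0"
  shows "c = 0"
proof -
  (* Three points in arithmetic progression determine the coefficients through second and first differences. *)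
  define m t where "m = (a + b) / 2" and "t = (b - a) / 4"
  have t: "t > 0" "m \<in> {a<..<b}" "m + t \<in> {a<..<b}" "m - t \<in> {a<..<b}"
    using assms(1) by (auto simp: m_def t_def field_simps)
  note z = assms(2)[OF t(2)] assms(2)[OF t(3)] assms(2)[OF t(4)]
  have "P_poly c (m + t) + P_poly c (m - t) - 2 * P_poly c m = - 2 * c$3 * t\<^sup>2"
    by (simp add: P_poly_def power2_eq_square algebra_simps)
  then have c3: "c$3 = 0" using z t by simp
  have "P_poly c (m + t) - P_poly c (m - t) = 2 * t * (c$2 - c$1)"
    by (simp add: P_poly_def c3 algebra_simps)
  then have c2: "c$2 = c$1" using z t by simp
  have "c$1 = 0" using z(1) by (simp add: P_poly_def c3 c2 algebra_simps)
  then show ?thesis using c2 c3 by (simp add: vec_eq_iff forall_3)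
qed

text \<open>Two zeros make the nondecreasing function \<open>U E\<close> vanish between them; by the equation \<open>P\<close> vanishes there too.\<close>

lemma solution_zero_unique:
  assumes sol: "is_solution \<nu> c U" "\<nu> > 0" and J: "c \<in> J_set 0" and "c \<noteq> 0"
    and "y \<in> {-1<..<1}" "z \<in> {-1<..<1}" "U y = 0" "U z = 0"
  shows "y = z"
proof -
  have False if yz: "y \<in> {-1<..<1}" "z \<in> {-1<..<1}" "y < z" and 0: "U y = 0" "U z = 0" for y z
  proof -
    obtain E where E: "\<And>x. E x > (0::real)" "\<And>s t. y \<le> s \<Longrightarrow> s \<le> t \<Longrightarrow> t \<le> z \<Longrightarrow> U s * E s \<le> U t * E t"
      using solution_weighted_mono[OF sol J yz(1,2)] yz(3) by (metis less_imp_le)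
    have U0: "U x = 0" if "x \<in> {y..z}" for x
    proof -
      have "U x * E x = 0" using E(2)[of y x] E(2)[of x z] that 0 by simp
      then show ?thesis using E(1)[of x] by simp
    qed
    have "P_poly c x = 0" if x: "x \<in> {y<..<z}" for x
    proof -
      have x1: "x \<in> {-1<..<1}" using x yz by auto
      have "((\<lambda>x. 0) has_real_derivative (P_poly c x - 2 * \<nu> * x * U x - (U x)\<^sup>2 / 2) / (\<nu> * (1 - x\<^sup>2))) (at x)"
        by (rule has_field_derivative_transform_within_open[OF solution_deriv[OF sol x1], of "{y<..<z}"])
           (use x U0 in auto)
      then have "(P_poly c x - 2 * \<nu> * x * U x - (U x)\<^sup>2 / 2) / (\<nu> * (1 - x\<^sup>2)) = 0"
        using DERIV_unique DERIV_const by blast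
      then show ?thesis using one_minus_sq_pos[OF x1] sol(2) U0[of x] x by simp
    qed
    then have "c = 0" using P_poly_zero_on_interval[OF yz(3)] by blast
    then show False using \<open>c \<noteq> 0\<close> by simp
  qed
  from this[of y z] this[of z y] assms(5-8) show ?thesis by (meson linorder_neqE_linordered_idom)
qed

text \<open>The reflection \<open>x \<mapsto> -x\<close> maps the equation to itself with \<open>c1\<close> and \<open>c2\<close> exchanged, provided that \<open>U\<close> also changes its sign.\<close>

definition reflect_c :: "real^3 \<Rightarrow> real^3" where
  "reflect_c c = vector [c$2, c$1, c$3]"

definition reflect_U :: "(real \<Rightarrow> real) \<Rightarrow> real \<Rightarrow> real" where
  "reflect_U U x = - U (- x)"

lemma reflect_c_nth [simp]: "reflect_c c $ 1 = c$2" "reflect_c c $ 2 = c$1" "reflect_c c $ 3 = c$3"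
  by (simp_all add: reflect_c_def)

lemma reflect_c_invol [simp]: "reflect_c (reflect_c c) = c"
  by (simp add: vec_eq_iff forall_3)

lemma reflect_U_invol [simp]: "reflect_U (reflect_U U) = U"
  by (simp add: reflect_U_def fun_eq_iff)

lemma P_poly_reflect [simp]: "P_poly (reflect_c c) x = P_poly c (- x)"
  by (simp add: P_poly_def)

lemma norm_reflect_c [simp]: "norm (reflect_c c) = norm c"
  by (simp add: norm_vec_def L2_set_def sum_3)

lemma reflect_c_diff: "reflect_c c - reflect_c d = reflect_c (c - d)"
  by (simp add: vec_eq_iff forall_3)

lemma J_set_reflect: "c \<in> J_set \<nu> \<Longrightarrow> reflect_c c \<in> J_set \<nu>"
  by (simp add: J_set_def c3_bar_def add.commute mult.commute)

lemma solution_reflect: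
  assumes "is_solution \<nu> c U" "\<nu> > 0"
  shows "is_solution \<nu> (reflect_c c) (reflect_U U)"
proof -
  define D where "D x = (P_poly c (-x) + 2 * \<nu> * x * U (-x) - (U (-x))\<^sup>2 / 2) / (\<nu> * (1 - x\<^sup>2))" for x
  have D: "(reflect_U U has_real_derivative D x) (at x)" if "x \<in> {-1<..<1}" for x
  proof -
    have "- x \<in> {-1<..<1}" using that by simp
    from solution_deriv[OF assms this]
    have "(U has_real_derivative D x) (at (- x))" by (simp add: D_def)
    then have "((\<lambda>x. U (- x)) has_real_derivative - D x) (at x)"
      by (simp add: DERIV_mirror)
    then show ?thesis unfolding reflect_U_def[abs_def] using DERIV_minus by fastforce
  qed
  have U: "continuous_on {-1<..<1} (\<lambda>x. U (- x))"
    by (rule continuous_on_compose2[OF solution_continuous[OF assms(1)]]) (auto intro!: continuous_intros)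
  have "continuous_on {-1<..<1} D"
    unfolding D_def P_poly_def
  proof (intro continuous_intros U ballI)
    fix x :: real assume "x \<in> {-1<..<1}"
    then show "\<nu> * (1 - x\<^sup>2) \<noteq> 0" using assms(2) one_minus_sq_pos[of x] by simp
  qed auto
  then have "reflect_U U C1_differentiable_on {-1<..<1}"
    using D unfolding C1_differentiable_on_def
    by (intro exI[of _ D]) (auto simp: has_real_derivative_iff_has_vector_derivative)
  moreover have "\<nu> * (1 - x\<^sup>2) * deriv (reflect_U U) x + 2 * \<nu> * x * reflect_U U x + (1/2) * (reflect_U U x)\<^sup>2
      = P_poly (reflect_c c) x" if "x \<in> {-1<..<1}" for x
    using DERIV_imp_deriv[OF D[OF that]] one_minus_sq_pos[OF that] assms(2) by (simp add: reflect_U_def D_def)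
  ultimately show ?thesis unfolding is_solution_def by blast
qed

lemma least_if_reflect_greatest:
  assumes U: "is_greatest_solution \<nu> (reflect_c c) (reflect_U U)" and nu: "\<nu> > 0"
  shows "is_least_solution \<nu> c U"
  unfolding is_least_solution_def
proof (intro conjI allI impI ballI)
  show "is_solution \<nu> c U"
    using U solution_reflect[OF _ nu, of "reflect_c c" "reflect_U U"] by (simp add: is_greatest_solution_def)
  fix V x assume V: "is_solution \<nu> c V" and x: "x \<in> {-1<..<1::real}"
  have "reflect_U V (- x) \<le> reflect_U U (- x)"
    using U solution_reflect[OF V nu] x unfolding is_greatest_solution_def by fastforce
  then show "U x \<le> V x" by (simp add: reflect_U_def)
qed

lemma greatest_if_reflect_least:
  assumes U: "is_least_solution \<nu> (reflect_c c) (reflect_U U)" and nu: "\<nu> > 0"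
  shows "is_greatest_solution \<nu> c U"
  unfolding is_greatest_solution_def
proof (intro conjI allI impI ballI)
  show "is_solution \<nu> c U"
    using U solution_reflect[OF _ nu, of "reflect_c c" "reflect_U U"] by (simp add: is_least_solution_def)
  fix V x assume V: "is_solution \<nu> c V" and x: "x \<in> {-1<..<1::real}"
  have "reflect_U U (- x) \<le> reflect_U V (- x)"
    using U solution_reflect[OF V nu] x unfolding is_least_solution_def by fastforce
  then show "V x \<le> U x" by (simp add: reflect_U_def)
qed

text \<open>Near \<open>-1\<close> a positive solution satisfies \<open>U \<ge> 4 \<nu>\<close>: below this level \<open>U\<close> would grow at a rate of order
  \<open>1 / (1 - x\<^sup>2)\<close> and therefore be negative further to the left. If another solution \<open>V\<close> exceeds \<open>U\<close> somewhere, then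
  \<open>D = V - U\<close> satisfies a linear homogeneous equation and stays positive. Near \<open>-1\<close> its damping coefficient
  \<open>2 \<nu> x + (U + V)/2\<close> is at least \<open>2 \<nu>\<close>, so \<open>D\<close> is unbounded there, against the upper bound for \<open>V\<close>.\<close>

lemma positive_solution_greatest:
  assumes sol: "is_solution \<nu> c U" and J: "c \<in> J_set 0" and nu: "0 < \<nu>" "\<nu> \<le> 1"
    and small: "32 * \<nu>\<^sup>2 \<le> c$1" and pos: "\<And>x. x \<in> {-1<..<1} \<Longrightarrow> U x > 0"
  shows "is_greatest_solution \<nu> c U"
  unfolding is_greatest_solution_def
proof (intro conjI allI impI ballI)
  show "is_solution \<nu> c U" by fact
  fix V and x0 :: real assume V: "is_solution \<nu> c V" and x0: "x0 \<in> {-1<..<1}"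
  have c1: "c$1 > 0" using small nu by (smt (verit) zero_less_power)
  have "isCont (P_poly c) (-1)" using P_poly_deriv DERIV_isCont by blast
  moreover have "P_poly c (-1) = 2 * c$1" by (simp add: P_poly_def)
  ultimately have "((P_poly c) \<longlongrightarrow> 2 * c$1) (at (-1))" by (simp add: isCont_def)
  then have "eventually (\<lambda>x. P_poly c x > c$1) (at (-1))" by (rule order_tendstoD) (use c1 in simp)
  then obtain d where d: "d > 0" "\<And>x. x \<noteq> -1 \<Longrightarrow> dist x (-1) < d \<Longrightarrow> P_poly c x > c$1"
    unfolding eventually_at by blast
  define x1 where "x1 = min 0 (-1 + d / 2)"
  have x1: "x1 \<in> {-1<..<1}" using d(1) by (auto simp: x1_def)
  have Pc: "P_poly c x > c$1" if "x \<in> {-1<..x1}" for x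
    using d(2)[of x] that d(1) by (auto simp: x1_def dist_real_def)
  have Ulow: "4 * \<nu> \<le> U x" if x: "x \<in> {-1<..x1}" for x
  proof (rule ccontr)
    define f where "f y = U y - 4 * \<nu>" for y
    define f' where "f' y = (P_poly c y - 2 * \<nu> * y * U y - (U y)\<^sup>2 / 2) / (\<nu> * (1 - y\<^sup>2))" for y
    assume "\<not> ?thesis"
    then have fx: "f x < 0" by (simp add: f_def)
    have der: "(f has_real_derivative f' y) (at y)" if "y \<in> {-1<..x}" for y
      unfolding f_def f'_def using solution_deriv[OF sol nu(1), of y] that x x1
      by (auto intro!: derivative_eq_intros)
    have rate: "c$1 / (2 * \<nu>) \<le> (1 - y\<^sup>2) * f' y" if y: "y \<in> {-1<..x}" and neg: "f y < 0" for y
    proof -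
      have y1: "y \<in> {-1<..<1}" "y \<in> {-1<..x1}" using y x x1 by auto
      have U: "0 < U y" "U y < 4 * \<nu>" using pos[OF y1(1)] neg by (auto simp: f_def)
      have "U y * U y \<le> (4 * \<nu>) * (4 * \<nu>)" using U by (intro mult_mono) auto
      moreover have "\<nu> * (y * U y) \<le> \<nu> * (4 * \<nu>)"
      proof (rule mult_left_mono)
        have "y * U y \<le> 1 * U y" using y1 U by (intro mult_right_mono) auto
        then show "y * U y \<le> 4 * \<nu>" using U by linarith
      qed (use nu in auto)
      ultimately have "c$1 / 2 \<le> P_poly c y - 2 * \<nu> * y * U y - (U y)\<^sup>2 / 2"
        using Pc[OF y1(2)] small by (simp add: power2_eq_square mult.assoc)
      moreover have "(1 - y\<^sup>2) * f' y = (P_poly c y - 2 * \<nu> * y * U y - (U y)\<^sup>2 / 2) / \<nu>"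
        using one_minus_sq_pos[OF y1(1)] nu by (simp add: f'_def)
      moreover have "c$1 / (2 * \<nu>) = (c$1 / 2) / \<nu>" by simp
      ultimately show ?thesis using nu by (simp only: divide_right_mono less_imp_le)
    qed
    have neg: "f y < 0" if y: "y \<in> {-1<..x}" for y
    proof (rule ccontr)
      assume "\<not> f y < 0"
      have "0 \<le> f x"
      proof (rule nonneg_persists[where f = f and f' = f' and a = y])
        fix t assume t: "t \<in> {y..x}"
        then have t: "t \<in> {-1<..x}" "t \<in> {-1<..<1}" using y x x1 by auto
        show "(f has_real_derivative f' t) (at t)" by (rule der[OF t(1)])
        assume "f t < 0"
        have "0 < c$1 / (2 * \<nu>)" using c1 nu by simp
        then have "0 < (1 - t\<^sup>2) * f' t" using rate[OF t(1) \<open>f t < 0\<close>] by linarith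
        then show "0 \<le> f' t" using one_minus_sq_pos[OF t(2)] by (simp add: zero_less_mult_iff)
      qed (use y \<open>\<not> f y < 0\<close> in auto)
      then show False using fx by simp
    qed
    show False
      by (rule no_escape_at_left_end[where g = f and g' = f' and k = "c$1 / (2 * \<nu>)" and ?x0.0 = x and B = "- 4 * \<nu>"])
         (use c1 nu x x1 der rate neg pos in \<open>force simp: f_def less_imp_le\<close>)+
  qed
  show "V x0 \<le> U x0"
  proof (rule ccontr)
    assume VU: "\<not> V x0 \<le> U x0"
    define D where "D x = V x - U x" for x
    define q where "q x = 2 * \<nu> * x + (U x + V x) / 2" for x
    have q: "continuous_on {-1<..<1} q"
      unfolding q_def by (intro continuous_intros solution_continuous[OF sol] solution_continuous[OF V]) auto
    have der: "(D has_real_derivative - D x * (q x / (\<nu> * (1 - x\<^sup>2)))) (at x)" if x: "x \<in> {-1<..<1}" for x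
    proof -
      have "(P_poly c x - 2 * \<nu> * x * V x - (V x)\<^sup>2 / 2) / (\<nu> * (1 - x\<^sup>2)) -
            (P_poly c x - 2 * \<nu> * x * U x - (U x)\<^sup>2 / 2) / (\<nu> * (1 - x\<^sup>2)) = - D x * (q x / (\<nu> * (1 - x\<^sup>2)))"
        using one_minus_sq_pos[OF x] nu
        by (simp add: D_def q_def divide_simps) (simp add: power2_eq_square algebra_simps)
      then show ?thesis unfolding D_def[abs_def] using DERIV_diff[OF solution_deriv[OF V nu(1) x] solution_deriv[OF sol nu(1) x]]
        by (simp add: D_def)
    qed
    have Dpos: "D x > 0" if x: "x \<in> {-1<..x0}" for x
    proof -
      have x': "x \<in> {-1<..<1}" "x \<le> x0" using x x0 by auto
      obtain E where E: "\<And>x. E x > (0::real)"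
        "\<And>y. y \<in> {x..x0} \<Longrightarrow> (E has_real_derivative E y * (q y / (\<nu> * (1 - y\<^sup>2)))) (at y within {x..x0})"
        using integrating_factor[OF nu(1) x'(1) x0 x'(2) q] by blast
      have "D x * E x = D x0 * E x0"
      proof (rule has_field_derivative_zero_constant[of "{x..x0}" "\<lambda>y. D y * E y", THEN exE])
        fix y assume y: "y \<in> {x..x0}"
        then have y1: "y \<in> {-1<..<1}" using x x0 by auto
        show "((\<lambda>y. D y * E y) has_real_derivative 0) (at y within {x..x0})"
          using DERIV_mult[OF has_field_derivative_at_within[OF der[OF y1], of "{x..x0}"] E(2)[OF y]]
          by (simp add: algebra_simps)
      next
        fix k assume "\<forall>y\<in>{x..x0}. D y * E y = k"
        then show ?thesis using x' by auto
      qed auto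
      moreover have "D x0 * E x0 > 0" using VU E(1)[of x0] by (simp add: D_def)
      ultimately have "0 < D x * E x" by simp
      then show ?thesis using E(1)[of x] zero_less_mult_pos2 by blast
    qed
    define x2 where "x2 = min x0 x1"
    have x2: "x2 \<in> {-1<..<1}" using x0 x1 by (auto simp: x2_def)
    have rate: "2 * D x \<le> (1 - x\<^sup>2) * (D x * (q x / (\<nu> * (1 - x\<^sup>2))))" if x: "x \<in> {-1<..x2}" for x
    proof -
      have x': "x \<in> {-1<..<1}" "x \<in> {-1<..x1}" "x \<in> {-1<..x0}" using x x2 by (auto simp: x2_def)
      have "q x \<ge> 2 * \<nu>"
      proof -
        have "- \<nu> \<le> \<nu> * x" using x' nu mult_left_mono[of "-1" x \<nu>] by simp
        then show ?thesis using Ulow[OF x'(2)] Dpos[OF x'(3)] by (simp add: q_def D_def field_simps)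
      qed
      then have "D x * (2 * \<nu>) \<le> D x * q x" using Dpos[OF x'(3)] by (intro mult_left_mono) auto
      then have "2 * D x \<le> D x * q x / \<nu>" using nu by (simp add: field_simps)
      moreover have "(1 - x\<^sup>2) * (D x * (q x / (\<nu> * (1 - x\<^sup>2)))) = D x * q x / \<nu>"
        using one_minus_sq_pos[OF x'(1)] by simp
      ultimately show ?thesis by simp
    qed
    have dec: "D x2 \<le> D x" if x: "x \<in> {-1<..x2}" for x
    proof (rule DERIV_nonpos_imp_nonincreasing[where f = D])
      fix y assume y: "x \<le> y" "y \<le> x2"
      then have y': "y \<in> {-1<..<1}" "y \<in> {-1<..x2}" "y \<in> {-1<..x0}" using x x2 by (auto simp: x2_def)
      have "0 < (1 - y\<^sup>2) * (D y * (q y / (\<nu> * (1 - y\<^sup>2))))"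
        using rate[OF y'(2)] Dpos[OF y'(3)] by linarith
      then have "0 < D y * (q y / (\<nu> * (1 - y\<^sup>2)))"
        using one_minus_sq_pos[OF y'(1)] zero_less_mult_pos by blast
      then show "\<exists>z. (D has_real_derivative z) (at y) \<and> z \<le> 0"
        using der[OF y'(1)] by (intro exI[of _ "- D y * (q y / (\<nu> * (1 - y\<^sup>2)))"]) simp
    qed (use x in auto)
    define R where "R = norm c + 1"
    show False
    proof (rule no_escape_at_left_end[where g = "\<lambda>x. - D x" and g' = "\<lambda>x. D x * (q x / (\<nu> * (1 - x\<^sup>2)))"
          and k = "2 * D x2" and ?x0.0 = x2 and B = "- sqrt (10 * R + 200 * R * \<nu>)"])
      show "0 < 2 * D x2" using Dpos[of x2] x2 by (auto simp: x2_def)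
      show "x2 \<in> {-1<..<1}" by fact
      fix x assume x: "x \<in> {-1<..x2}"
      then have x': "x \<in> {-1<..<1}" using x2 by auto
      show "((\<lambda>x. - D x) has_real_derivative D x * (q x / (\<nu> * (1 - x\<^sup>2)))) (at x)"
        using DERIV_minus[OF der[OF x']] by simp
      show "2 * D x2 \<le> (1 - x\<^sup>2) * (D x * (q x / (\<nu> * (1 - x\<^sup>2))))"
        using rate[OF x] dec[OF x] by linarith
      have "V x \<le> sqrt (2 * P_poly c x + 200 * R * \<nu>)"
        by (rule solution_upper[OF V J _ _ nu x']) (auto simp: R_def)
      also have "\<dots> \<le> sqrt (10 * R + 200 * R * \<nu>)"
        using P_poly_bound[of c R x] x' by (simp add: R_def)
      finally show "- sqrt (10 * R + 200 * R * \<nu>) \<le> - D x"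
        using pos[OF x'] by (simp add: D_def)
    qed
  qed
qed

lemma negative_solution_least:
  assumes sol: "is_solution \<nu> c U" and J: "c \<in> J_set 0" and nu: "0 < \<nu>" "\<nu> \<le> 1"
    and small: "32 * \<nu>\<^sup>2 \<le> c$2" and neg: "\<And>x. x \<in> {-1<..<1} \<Longrightarrow> U x < 0"
  shows "is_least_solution \<nu> c U"
proof -
  have "is_greatest_solution \<nu> (reflect_c c) (reflect_U U)"
    by (rule positive_solution_greatest)
       (use assms in \<open>auto simp: reflect_U_def intro: solution_reflect J_set_reflect\<close>)
  then show ?thesis by (rule least_if_reflect_greatest) (rule nu)
qed

section \<open>The residual is of order of the viscosity\<close>

text \<open>The upper barrier, applied to the solution and to its reflection.\<close>

lemma solution_sq_upper:
  assumes sol: "is_solution \<nu> c U" and J: "c \<in> J_set 0" and R: "norm c \<le> R" "1 \<le> R"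
    and nu: "0 < \<nu>" "\<nu> \<le> 1" and x: "x \<in> {-1<..<1}"
  shows "(U x)\<^sup>2 \<le> 2 * P_poly c x + 200 * R * \<nu>"
proof -
  have P: "0 \<le> 2 * P_poly c x + 200 * R * \<nu>" using P_poly_nonneg[OF J, of x] R nu x by simp
  have "U x \<le> sqrt (2 * P_poly c x + 200 * R * \<nu>)"
    by (rule solution_upper[OF sol J R nu x])
  moreover have "reflect_U U (- x) \<le> sqrt (2 * P_poly (reflect_c c) (- x) + 200 * R * \<nu>)"
    by (rule solution_upper[OF solution_reflect[OF sol nu(1)] J_set_reflect[OF J]]) (use R nu x in auto)
  ultimately have "\<bar>U x\<bar> \<le> sqrt (2 * P_poly c x + 200 * R * \<nu>)" by (simp add: reflect_U_def)
  then have "\<bar>U x\<bar>\<^sup>2 \<le> (sqrt (2 * P_poly c x + 200 * R * \<nu>))\<^sup>2" by (intro power_mono) auto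
  then show ?thesis using P by simp
qed

lemma residual_bound_right:
  assumes sol: "is_solution \<nu> c U" and J: "c \<in> J_set 0" and R: "norm c \<le> R" "1 \<le> R"
    and nu: "0 < \<nu>" "\<nu> \<le> 1" and a: "-1 \<le> a" and eps: "\<epsilon> > 0"
    and pos: "\<And>x. x \<in> {a<..<1} \<Longrightarrow> 0 \<le> U x"
    and x: "x \<in> {a + \<epsilon><..<1}"
  shows "\<bar>(1/2) * (U x)\<^sup>2 - P_poly c x\<bar> \<le> (100 * R + 10 * R / \<epsilon>) * \<nu>"
proof -
  have x1: "x \<in> {-1<..<1}" using x a eps by auto
  have lo: "P_poly c x - (34 * R + 10 * R / \<epsilon>) * \<nu> \<le> (U x)\<^sup>2 / 2"
    by (rule nonneg_solution_lower[OF sol J R nu a eps pos x])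
  have hi: "(U x)\<^sup>2 \<le> 2 * P_poly c x + 200 * R * \<nu>"
    by (rule solution_sq_upper[OF sol J R nu x1])
  have "0 \<le> R * \<nu>" "0 \<le> 10 * R / \<epsilon> * \<nu>" using R nu eps by auto
  then have "(34 * R + 10 * R / \<epsilon>) * \<nu> \<le> (100 * R + 10 * R / \<epsilon>) * \<nu>"
    "100 * R * \<nu> \<le> (100 * R + 10 * R / \<epsilon>) * \<nu>" by (auto simp: algebra_simps)
  then show ?thesis using lo hi by (auto simp: abs_le_iff)
qed

text \<open>To the right of a zero the solution is nonnegative, so both barriers are available; the left side is reflected.\<close>

lemma residual_bound_zero:
  assumes sol: "is_solution \<nu> c U" and J: "c \<in> J_set 0" and R: "norm c \<le> R" "1 \<le> R"
    and nu: "0 < \<nu>" "\<nu> \<le> 1" and z: "z \<in> {-1<..<1}" "U z = 0" and eps: "\<epsilon> > 0"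
  shows "x \<in> {z + \<epsilon><..<1} \<Longrightarrow> 0 \<le> U x \<and> \<bar>(1/2) * (U x)\<^sup>2 - P_poly c x\<bar> \<le> (100 * R + 10 * R / \<epsilon>) * \<nu>"
    and "x \<in> {-1<..<z - \<epsilon>} \<Longrightarrow> U x \<le> 0 \<and> \<bar>(1/2) * (U x)\<^sup>2 - P_poly c x\<bar> \<le> (100 * R + 10 * R / \<epsilon>) * \<nu>"
proof -
  have right: "0 \<le> V x \<and> \<bar>(1/2) * (V x)\<^sup>2 - P_poly d x\<bar> \<le> (100 * R + 10 * R / \<epsilon>) * \<nu>"
    if V: "is_solution \<nu> d V" and d: "d \<in> J_set 0" "norm d \<le> R" and w: "w \<in> {-1<..<1}" "V w = 0" 
      and x: "x \<in> {w + \<epsilon><..<1}" for d V w x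
  proof -
    have pos: "0 \<le> V y" if "y \<in> {w<..<1}" for y
      using solution_nonneg_right_of_zero[OF V nu(1) d(1) w(1)] that w by auto
    moreover have "x \<in> {w<..<1}" using x eps by auto
    ultimately show ?thesis using residual_bound_right[OF V d R(2) nu _ eps pos x] w(1) by auto
  qed
  show "x \<in> {z + \<epsilon><..<1} \<Longrightarrow> 0 \<le> U x \<and> \<bar>(1/2) * (U x)\<^sup>2 - P_poly c x\<bar> \<le> (100 * R + 10 * R / \<epsilon>) * \<nu>"
    by (rule right[OF sol J R(1) z])
  assume "x \<in> {-1<..<z - \<epsilon>}"
  then have "0 \<le> reflect_U U (- x) \<and> \<bar>(1/2) * (reflect_U U (- x))\<^sup>2 - P_poly (reflect_c c) (- x)\<bar>
      \<le> (100 * R + 10 * R / \<epsilon>) * \<nu>"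
    by (intro right[where w = "- z"] solution_reflect sol nu J_set_reflect J)
       (use z R in \<open>auto simp: reflect_U_def\<close>)
  then show "U x \<le> 0 \<and> \<bar>(1/2) * (U x)\<^sup>2 - P_poly c x\<bar> \<le> (100 * R + 10 * R / \<epsilon>) * \<nu>"
    by (simp add: reflect_U_def)
qed

text \<open>From a bound on the residual for a nearby quadratic \<open>q\<close> to the distance of \<open>u\<close> from \<open>sqrt (2 p)\<close>. Only the square root of the error
  survives, as \<open>p\<close> may vanish.\<close>

lemma abs_diff_sqrt_le:
  assumes "0 \<le> u" "0 \<le> p" "\<bar>(1/2) * u\<^sup>2 - q\<bar> \<le> \<delta>" "\<bar>q - p\<bar> \<le> \<eta>"
  shows "\<bar>u - sqrt (2 * p)\<bar> \<le> sqrt (2 * \<delta> + 2 * \<eta>)"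
proof -
  have "\<bar>u - sqrt (2 * p)\<bar>\<^sup>2 \<le> \<bar>u - sqrt (2 * p)\<bar> * \<bar>u + sqrt (2 * p)\<bar>"
  proof -
    have "0 \<le> sqrt (2 * p)" using assms(2) by simp
    then have "\<bar>u - sqrt (2 * p)\<bar> \<le> \<bar>u + sqrt (2 * p)\<bar>" using assms(1) by linarith
    then show ?thesis unfolding power2_eq_square by (intro mult_left_mono) auto
  qed
  also have "\<dots> = \<bar>u\<^sup>2 - 2 * p\<bar>"
    using assms(2) by (simp add: abs_mult[symmetric] power2_eq_square algebra_simps)
  also have "\<dots> \<le> 2 * \<delta> + 2 * \<eta>" using assms(3,4) by (auto simp: abs_le_iff)
  finally show ?thesis by (intro real_le_rsqrt)
qed

lemma P_poly_close:
  assumes "x \<in> {-1<..<1}"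
  shows "\<bar>P_poly c x - P_poly d x\<bar> \<le> 5 * norm (c - d)"
  unfolding P_poly_diff using assms by (intro P_poly_bound) auto

section \<open>Bounds for the norms\<close>

lemma Linf_norm_le:
  assumes "open S" "continuous_on S f" "\<And>x. x \<in> S \<Longrightarrow> \<bar>f x\<bar> \<le> B"
  shows "Linf_norm S f \<le> ennreal B"
proof -
  have S: "S \<in> sets lebesgue" using assms(1) by (simp add: lmeasurable_open borel_open)
  have [measurable]: "f \<in> borel_measurable (lebesgue_on S)"
    by (rule continuous_imp_measurable_on_sets_lebesgue[OF assms(2) S])
  show ?thesis unfolding Linf_norm_def
  proof (rule esssup_I)
    show "(\<lambda>x. ennreal \<bar>f x\<bar>) \<in> borel_measurable (lebesgue_on S)" by measurable
    show "AE x in lebesgue_on S. ennreal \<bar>f x\<bar> \<le> ennreal B"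
      by (rule AE_I2) (use assms(3) in \<open>auto simp: space_restrict_space intro!: ennreal_leI\<close>)
  qed
qed

lemma P_poly_continuous: "continuous_on S (P_poly c)"
  unfolding P_poly_def[abs_def] by (intro continuous_intros)

text \<open>Interpolation between the bound \<open>A \<nu>\<close>, used for points at distance at least \<open>\<nu>\<close>, and the Lipschitz constant \<open>L\<close>, needed only
  for closer points. For small \<open>\<nu>\<close>, close points lie in the same component of a set that is a union of separated intervals.\<close>

lemma Holder_norm_le:
  assumes nu: "0 < \<nu>" "\<nu> \<le> 1" and beta: "0 < \<beta>" "\<beta> < 1" and AL: "0 \<le> A" "0 \<le> L"
    and bdd: "\<And>x. x \<in> S \<Longrightarrow> \<bar>f x\<bar> \<le> A * \<nu>"
    and lip: "\<And>x y. x \<in> S \<Longrightarrow> y \<in> S \<Longrightarrow> \<bar>x - y\<bar> < \<nu> \<Longrightarrow> \<bar>f x - f y\<bar> \<le> L * \<bar>x - y\<bar>"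
  shows "Holder_norm \<beta> S f \<le> ennreal ((3 * A + L) * \<nu> powr (1 - \<beta>))"
proof -
  define m where "m = \<nu> powr (1 - \<beta>)"
  have m: "0 < m" using nu by (simp add: m_def)
  have num: "\<nu> \<le> m" using powr_mono'[of "1 - \<beta>" 1 \<nu>] nu beta by (simp add: m_def)
  have "(SUP x\<in>S. ennreal \<bar>f x\<bar>) \<le> ennreal (A * m)"
  proof (rule SUP_least)
    fix x assume "x \<in> S"
    then have "\<bar>f x\<bar> \<le> A * \<nu>" by (rule bdd)
    also have "\<dots> \<le> A * m" using num AL by (intro mult_left_mono)
    finally show "ennreal \<bar>f x\<bar> \<le> ennreal (A * m)" by (rule ennreal_leI)
  qed
  moreover have "(SUP (x, y)\<in>{(x, y). x \<in> S \<and> y \<in> S \<and> x \<noteq> y}. ennreal (\<bar>f x - f y\<bar> / \<bar>x - y\<bar> powr \<beta>))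
      \<le> ennreal ((2 * A + L) * m)"
  proof (rule SUP_least, clarify, rule ennreal_leI)
    fix x y assume xy: "x \<in> S" "y \<in> S" "x \<noteq> y"
    define t where "t = \<bar>x - y\<bar>"
    have t: "t > 0" using xy by (simp add: t_def)
    show "\<bar>f x - f y\<bar> / \<bar>x - y\<bar> powr \<beta> \<le> (2 * A + L) * m"
    proof (cases "t < \<nu>")
      case True
      have "\<bar>f x - f y\<bar> / t powr \<beta> \<le> L * t / t powr \<beta>"
        using lip[OF xy(1,2)] True by (intro divide_right_mono) (auto simp: t_def)
      also have "\<dots> = L * t powr (1 - \<beta>)" using t by (simp add: powr_diff)
      also have "\<dots> \<le> L * m" unfolding m_def using True t beta AL by (intro mult_left_mono powr_mono2) auto
      also have "\<dots> \<le> (2 * A + L) * m" using AL m by (intro mult_right_mono) auto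
      finally show ?thesis by (simp add: t_def)
    next
      case False
      have "\<bar>f x - f y\<bar> \<le> 2 * A * \<nu>" using bdd[OF xy(1)] bdd[OF xy(2)] by linarith
      then have "\<bar>f x - f y\<bar> / t powr \<beta> \<le> 2 * A * \<nu> / \<nu> powr \<beta>"
        using False nu AL beta t by (intro frac_le powr_mono2) auto
      also have "\<dots> = 2 * A * m" using nu by (simp add: m_def powr_diff)
      also have "\<dots> \<le> (2 * A + L) * m" using AL m by (intro mult_right_mono) auto
      finally show ?thesis by (simp add: t_def)
    qed
  qed
  ultimately have "Holder_norm \<beta> S f \<le> ennreal (A * m) + ennreal ((2 * A + L) * m)"
    unfolding Holder_norm_def by (rule add_mono)
  also have "\<dots> = ennreal ((3 * A + L) * m)"
    using AL m by (subst ennreal_plus[symmetric]) (auto simp: algebra_simps)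
  finally show ?thesis by (simp add: m_def)
qed

lemma one_minus_sq_ge:
  assumes "x \<in> {-1 + \<epsilon><..<1 - \<epsilon>}" "(0::real) < \<epsilon>"
  shows "\<epsilon> \<le> 1 - x\<^sup>2"
proof -
  have x: "\<bar>x\<bar> \<le> 1 - \<epsilon>" using assms by auto
  have "(1 - \<bar>x\<bar>) * 1 \<le> (1 - \<bar>x\<bar>) * (1 + \<bar>x\<bar>)" using x assms by (intro mult_left_mono) auto
  also have "\<dots> = 1 - x\<^sup>2" by (simp add: algebra_simps power2_eq_square)
  finally show ?thesis using x by simp
qed

text \<open>The derivative of \<open>h\<close> is \<open>U U' - P'\<close>, and the equation expresses \<open>U'\<close> through \<open>h / \<nu>\<close>, which is bounded. The condition
  \<open>\<nu> \<le> 2 \<epsilon>\<close> separates the two components for the interpolation.\<close>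

lemma residual_norm_bound:
  assumes sol: "is_solution \<nu> c U" and J: "c \<in> J_set 0" and R: "norm c \<le> R" "1 \<le> R"
    and nu: "0 < \<nu>" "\<nu> \<le> 1" "\<nu> \<le> 2 * \<epsilon>" and z: "z \<in> {-1<..<1}" "U z = 0" and eps: "\<epsilon> > 0"
    and beta: "0 < \<beta>" "\<beta> < 1"
    and K: "K = 100 * R + 10 * R / \<epsilon>" and L: "L = 15 * R * ((K + 30 * R) / \<epsilon>) + 4 * R"
  shows "Linf_norm ({-1<..<z - \<epsilon>} \<union> {z + \<epsilon><..<1}) (\<lambda>y. (1/2) * (U y)\<^sup>2 - P_poly c y)
         + ennreal (\<nu> powr \<beta>) * Holder_norm \<beta> ({-1 + \<epsilon><..<z - \<epsilon>} \<union> {z + \<epsilon><..<1 - \<epsilon>})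
             (\<lambda>y. (1/2) * (U y)\<^sup>2 - P_poly c y) \<le> ennreal ((4 * K + L) * \<nu>)"
proof -
  define h where "h y = (1/2) * (U y)\<^sup>2 - P_poly c y" for y
  have K0: "0 \<le> K" using R eps by (simp add: K)
  have L0: "0 \<le> L" using R eps K0 by (simp add: L)
  have h: "\<bar>h x\<bar> \<le> K * \<nu>" if "x \<in> {-1<..<z - \<epsilon>} \<union> {z + \<epsilon><..<1}" for x
    using residual_bound_zero[OF sol J R nu(1,2) z eps] that unfolding h_def K by blast
  have Uc: "continuous_on {-1<..<1} U" by (rule solution_continuous[OF sol])
  have "Linf_norm ({-1<..<z - \<epsilon>} \<union> {z + \<epsilon><..<1}) h \<le> ennreal (K * \<nu>)"
  proof (rule Linf_norm_le[OF _ _ h])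
    show "continuous_on ({-1<..<z - \<epsilon>} \<union> {z + \<epsilon><..<1}) h"
      unfolding h_def using z eps
      by (intro continuous_intros P_poly_continuous continuous_on_subset[OF Uc]) auto
  qed auto
  moreover have "Holder_norm \<beta> ({-1 + \<epsilon><..<z - \<epsilon>} \<union> {z + \<epsilon><..<1 - \<epsilon>}) h
      \<le> ennreal ((3 * K + L) * \<nu> powr (1 - \<beta>))" (is "Holder_norm _ ?S _ \<le> _")
  proof (rule Holder_norm_le[OF nu(1,2) beta K0 L0])
    show "\<bar>h x\<bar> \<le> K * \<nu>" if "x \<in> ?S" for x using that eps by (intro h) auto
    fix x y assume xy: "x \<in> ?S" "y \<in> ?S" "\<bar>x - y\<bar> < \<nu>"
    have der: "\<exists>d. (h has_real_derivative d) (at t) \<and> \<bar>d\<bar> \<le> L" if t: "t \<in> ?S" for t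
    proof -
      have t1: "t \<in> {-1<..<1}" "t \<in> {-1+\<epsilon><..<1-\<epsilon>}" using t eps z by auto
      have ht: "\<bar>h t\<bar> \<le> K * \<nu>" using t eps by (intro h) auto
      define U' where "U' = (P_poly c t - 2 * \<nu> * t * U t - (U t)\<^sup>2 / 2) / (\<nu> * (1 - t\<^sup>2))"
      have b: "\<epsilon> \<le> 1 - t\<^sup>2" by (rule one_minus_sq_ge[OF t1(2) eps])
      have "(U t)\<^sup>2 \<le> 2 * P_poly c t + 200 * R * \<nu>"
        by (rule solution_sq_upper[OF sol J R nu(1,2) t1(1)])
      also have "\<dots> \<le> 2 * (5 * R) + 200 * R * 1"
        using P_poly_bound[OF R(1), of t] t1 R nu by (intro add_mono mult_left_mono) auto
      also have "\<dots> \<le> (15 * R)\<^sup>2"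
        using mult_left_mono[of 1 R R] R by (simp add: power2_eq_square)
      finally have "\<bar>U t\<bar>\<^sup>2 \<le> (15 * R)\<^sup>2" by simp
      then have Ut: "\<bar>U t\<bar> \<le> 15 * R" by (rule power2_le_imp_le) (use R in simp)
      have "\<bar>P_poly c t - 2 * \<nu> * t * U t - (U t)\<^sup>2 / 2\<bar> = \<bar>- h t - 2 * \<nu> * (t * U t)\<bar>"
        by (simp add: h_def algebra_simps)
      also have "\<dots> \<le> \<bar>h t\<bar> + \<bar>2 * \<nu> * (t * U t)\<bar>"
        using abs_triangle_ineq4[of "- h t" "2 * \<nu> * (t * U t)"] by simp
      also have "\<dots> = \<bar>h t\<bar> + 2 * \<nu> * (\<bar>t\<bar> * \<bar>U t\<bar>)"
        using nu by (simp add: abs_mult)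
      also have "\<dots> \<le> K * \<nu> + 2 * \<nu> * (1 * (15 * R))"
        using ht Ut nu t1 by (intro add_mono mult_left_mono mult_mono) auto
      finally have num: "\<bar>P_poly c t - 2 * \<nu> * t * U t - (U t)\<^sup>2 / 2\<bar> \<le> \<nu> * (K + 30 * R)"
        by (simp add: algebra_simps)
      have "\<bar>U'\<bar> \<le> \<nu> * (K + 30 * R) / (\<nu> * \<epsilon>)"
      proof -
        have "\<bar>U'\<bar> = \<bar>P_poly c t - 2 * \<nu> * t * U t - (U t)\<^sup>2 / 2\<bar> / (\<nu> * (1 - t\<^sup>2))"
          using b eps nu by (simp add: U'_def abs_divide abs_mult)
        also have "\<dots> \<le> \<nu> * (K + 30 * R) / (\<nu> * \<epsilon>)"
          using num b eps nu by (intro frac_le) auto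
        finally show ?thesis .
      qed
      then have U': "\<bar>U'\<bar> \<le> (K + 30 * R) / \<epsilon>" using nu by simp
      have "(h has_real_derivative U t * U' - P_deriv c t) (at t)"
        unfolding h_def
        by (auto intro!: derivative_eq_intros P_poly_deriv solution_deriv[OF sol nu(1) t1(1)] simp: U'_def)
      moreover have "\<bar>U t * U'\<bar> \<le> 15 * R * ((K + 30 * R) / \<epsilon>)"
        unfolding abs_mult using Ut U' R by (intro mult_mono) auto
      then have "\<bar>U t * U' - P_deriv c t\<bar> \<le> L"
        using P_deriv_bound[OF R(1), of t] t1 unfolding L by simp
      ultimately show ?thesis by blast
    qed
    obtain I where I: "I = {-1 + \<epsilon><..<z - \<epsilon>} \<or> I = {z + \<epsilon><..<1 - \<epsilon>}" "x \<in> I" "y \<in> I"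
    proof -
      have "\<not> (x < z - \<epsilon> \<and> z + \<epsilon> < y)" "\<not> (y < z - \<epsilon> \<and> z + \<epsilon> < x)" using xy(3) nu(3) by auto
      then have "x \<in> {-1 + \<epsilon><..<z - \<epsilon>} \<and> y \<in> {-1 + \<epsilon><..<z - \<epsilon>}
          \<or> x \<in> {z + \<epsilon><..<1 - \<epsilon>} \<and> y \<in> {z + \<epsilon><..<1 - \<epsilon>}" using xy(1,2) by auto
      then show ?thesis using that by blast
    qed
    then have IS: "I \<subseteq> ?S" "convex I" by auto
    obtain d where d: "\<And>t. t \<in> I \<Longrightarrow> (h has_real_derivative d t) (at t) \<and> \<bar>d t\<bar> \<le> L"
      using der IS by (metis subsetD)
    have "norm (h x - h y) \<le> L * norm (x - y)"
      by (rule field_differentiable_bound[OF IS(2), of _ d])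
         (use d I in \<open>auto intro: has_field_derivative_at_within\<close>)
    then show "\<bar>h x - h y\<bar> \<le> L * \<bar>x - y\<bar>" by simp
  qed
  then have "ennreal (\<nu> powr \<beta>) * Holder_norm \<beta> ?S h
      \<le> ennreal (\<nu> powr \<beta>) * ennreal ((3 * K + L) * \<nu> powr (1 - \<beta>))"
    by (intro mult_left_mono) auto
  moreover have "\<dots> = ennreal ((3 * K + L) * \<nu>)"
  proof -
    have "\<nu> powr \<beta> * ((3 * K + L) * \<nu> powr (1 - \<beta>)) = (3 * K + L) * (\<nu> powr \<beta> * \<nu> powr (1 - \<beta>))" by simp
    also have "\<nu> powr \<beta> * \<nu> powr (1 - \<beta>) = \<nu>" using nu by (simp add: powr_add[symmetric])
    finally have e: "\<nu> powr \<beta> * ((3 * K + L) * \<nu> powr (1 - \<beta>)) = (3 * K + L) * \<nu>" .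
    have "ennreal (\<nu> powr \<beta>) * ennreal ((3 * K + L) * \<nu> powr (1 - \<beta>))
        = ennreal (\<nu> powr \<beta> * ((3 * K + L) * \<nu> powr (1 - \<beta>)))"
      by (rule ennreal_mult'[symmetric]) simp
    then show ?thesis unfolding e .
  qed
  ultimately have "Linf_norm ({-1<..<z - \<epsilon>} \<union> {z + \<epsilon><..<1}) h + ennreal (\<nu> powr \<beta>) * Holder_norm \<beta> ?S h
      \<le> ennreal (K * \<nu>) + ennreal ((3 * K + L) * \<nu>)"
    by (intro add_mono) auto
  also have "\<dots> = ennreal ((4 * K + L) * \<nu>)"
    using K0 L0 nu by (subst ennreal_plus[symmetric]) (auto simp: algebra_simps)
  finally show ?thesis unfolding h_def .
qed

section \<open>Families with uniformly bounded derivatives\<close>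

text \<open>Uniform bounds for the derivatives up to order \<open>n\<close> of a family of functions \<open>f i\<close> on sets \<open>I i\<close>. With the family as a whole as the
  subject, constants that are uniform in the parameters never have to be named, and the closure under products needs no
  Leibniz formula, as the derivative is only asserted to exist with the same property one order lower.\<close>

fun unif_bdd :: "nat \<Rightarrow> 'i set \<Rightarrow> ('i \<Rightarrow> real set) \<Rightarrow> ('i \<Rightarrow> real \<Rightarrow> real) \<Rightarrow> bool" where
  "unif_bdd 0 A I f \<longleftrightarrow> (\<exists>M. \<forall>i\<in>A. \<forall>x\<in>I i. \<bar>f i x\<bar> \<le> M)"
| "unif_bdd (Suc n) A I f \<longleftrightarrow> (\<exists>M. \<forall>i\<in>A. \<forall>x\<in>I i. \<bar>f i x\<bar> \<le> M) \<and>
     (\<exists>f'. (\<forall>i\<in>A. \<forall>x\<in>I i. (f i has_real_derivative f' i x) (at x)) \<and> unif_bdd n A I f')"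

lemma unif_bdd_0D: "unif_bdd n A I f \<Longrightarrow> \<exists>M. \<forall>i\<in>A. \<forall>x\<in>I i. \<bar>f i x\<bar> \<le> M"
  by (cases n) auto

lemma unif_bdd_bound:
  assumes "unif_bdd n A I f"
  obtains M where "M > 0" "\<forall>i\<in>A. \<forall>x\<in>I i. \<bar>f i x\<bar> \<le> M"
proof -
  obtain M where "\<forall>i\<in>A. \<forall>x\<in>I i. \<bar>f i x\<bar> \<le> M" using unif_bdd_0D[OF assms] by blast
  then have "\<forall>i\<in>A. \<forall>x\<in>I i. \<bar>f i x\<bar> \<le> max M 1" by (meson max.coboundedI1)
  then show ?thesis by (intro that[of "max M 1"]) simp_all
qed

lemma unif_bdd_0I:
  assumes "\<And>i x. i \<in> A \<Longrightarrow> x \<in> I i \<Longrightarrow> \<bar>f i x\<bar> \<le> M"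
  shows "unif_bdd 0 A I f"
  unfolding unif_bdd.simps using assms by blast

lemma unif_bdd_SucE:
  assumes "unif_bdd (Suc n) A I f"
  obtains f' where "\<forall>i\<in>A. \<forall>x\<in>I i. (f i has_real_derivative f' i x) (at x)"
    and "unif_bdd n A I f'"
  using assms unfolding unif_bdd.simps by blast

lemma unif_bdd_SucI:
  assumes "unif_bdd 0 A I f" "\<And>i x. i \<in> A \<Longrightarrow> x \<in> I i \<Longrightarrow> (f i has_real_derivative f' i x) (at x)"
    and "unif_bdd n A I f'"
  shows "unif_bdd (Suc n) A I f"
  using assms by auto

lemma unif_bdd_pred: "unif_bdd (Suc n) A I f \<Longrightarrow> unif_bdd n A I f"
proof (induction n arbitrary: f)
  case (Suc n)
  then obtain f' where f': "\<forall>i\<in>A. \<forall>x\<in>I i. (f i has_real_derivative f' i x) (at x)" "unif_bdd (Suc n) A I f'"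
    by auto
  then show ?case using Suc.prems Suc.IH[OF f'(2)] by auto
qed auto

lemma unif_bdd_0: "unif_bdd n A I f \<Longrightarrow> unif_bdd 0 A I f"
  using unif_bdd_0D by simp

lemma unif_bdd_subset:
  "unif_bdd n A I f \<Longrightarrow> (\<And>i. i \<in> A \<Longrightarrow> J i \<subseteq> I i) \<Longrightarrow> unif_bdd n A J f"
proof (induction n arbitrary: f)
  case 0
  obtain M where "M > 0" "\<forall>i\<in>A. \<forall>x\<in>I i. \<bar>f i x\<bar> \<le> M" by (rule unif_bdd_bound[OF 0(1)])
  then show ?case using 0(2) by (intro unif_bdd_0I[of _ _ _ M]) blast
next
  case (Suc n)
  obtain f' where f': "\<forall>i\<in>A. \<forall>x\<in>I i. (f i has_real_derivative f' i x) (at x)" "unif_bdd n A I f'"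
    by (rule unif_bdd_SucE[OF Suc.prems(1)])
  show ?case
  proof (rule unif_bdd_SucI[OF _ _ Suc.IH[OF f'(2) Suc.prems(2)]])
    show "unif_bdd 0 A J f"
      by (rule unif_bdd_0[OF Suc.IH[OF unif_bdd_pred[OF Suc.prems(1)] Suc.prems(2)]])
    show "(f i has_real_derivative f' i x) (at x)" if "i \<in> A" "x \<in> J i" for i x
      using f'(1) Suc.prems(2) that by blast
  qed
qed

lemma unif_bdd_add:
  "unif_bdd n A I f \<Longrightarrow> unif_bdd n A I g \<Longrightarrow> unif_bdd n A I (\<lambda>i x. f i x + g i x)"
proof (induction n arbitrary: f g)
  case 0
  obtain M N where "\<forall>i\<in>A. \<forall>x\<in>I i. \<bar>f i x\<bar> \<le> M" "\<forall>i\<in>A. \<forall>x\<in>I i. \<bar>g i x\<bar> \<le> N"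
    using 0 by auto
  then have "\<bar>f i x + g i x\<bar> \<le> M + N" if "i \<in> A" "x \<in> I i" for i x
    using that by (intro order_trans[OF abs_triangle_ineq add_mono]) auto
  then show ?case by (rule unif_bdd_0I)
next
  case (Suc n)
  obtain f' g' where d: "\<forall>i\<in>A. \<forall>x\<in>I i. (f i has_real_derivative f' i x) (at x)" "unif_bdd n A I f'"
    "\<forall>i\<in>A. \<forall>x\<in>I i. (g i has_real_derivative g' i x) (at x)" "unif_bdd n A I g'" using Suc.prems by auto
  show ?case
  proof (rule unif_bdd_SucI[OF _ _ Suc.IH[OF d(2,4)]])
    show "unif_bdd 0 A I (\<lambda>i x. f i x + g i x)"
      using unif_bdd_0[OF Suc.IH[OF unif_bdd_pred[OF Suc.prems(1)] unif_bdd_pred[OF Suc.prems(2)]]] .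
  qed (use d in \<open>auto intro!: DERIV_add\<close>)
qed

lemma unif_bdd_mult:
  "unif_bdd n A I f \<Longrightarrow> unif_bdd n A I g \<Longrightarrow> unif_bdd n A I (\<lambda>i x. f i x * g i x)"
proof (induction n arbitrary: f g)
  case 0
  obtain M where M: "M > 0" "\<forall>i\<in>A. \<forall>x\<in>I i. \<bar>f i x\<bar> \<le> M" by (rule unif_bdd_bound[OF 0(1)])
  obtain N where N: "N > 0" "\<forall>i\<in>A. \<forall>x\<in>I i. \<bar>g i x\<bar> \<le> N" by (rule unif_bdd_bound[OF 0(2)])
  then have "\<forall>i\<in>A. \<forall>x\<in>I i. \<bar>f i x * g i x\<bar> \<le> M * N"
    unfolding abs_mult using M N by (auto intro!: mult_mono)
  then show ?case by auto
next
  case (Suc n)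
  obtain f' g' where d: "\<forall>i\<in>A. \<forall>x\<in>I i. (f i has_real_derivative f' i x) (at x)" "unif_bdd n A I f'"
    "\<forall>i\<in>A. \<forall>x\<in>I i. (g i has_real_derivative g' i x) (at x)" "unif_bdd n A I g'" using Suc.prems by auto
  note p = unif_bdd_pred[OF Suc.prems(1)] unif_bdd_pred[OF Suc.prems(2)]
  show ?case
  proof (rule unif_bdd_SucI[OF _ _ unif_bdd_add[OF Suc.IH[OF d(2) p(2)] Suc.IH[OF d(4) p(1)]]])
    show "unif_bdd 0 A I (\<lambda>i x. f i x * g i x)"
      using unif_bdd_0[OF Suc.IH[OF p]] .
  qed (use d in \<open>auto intro!: DERIV_mult\<close>)
qed

lemma unif_bdd_const:
  assumes "\<And>i. i \<in> A \<Longrightarrow> \<bar>k i\<bar> \<le> M"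
  shows "unif_bdd n A I (\<lambda>i x. k i)"
proof (cases n)
  case (Suc m)
  have z: "unif_bdd m A I (\<lambda>i x. 0)" for m
    by (induction m) (auto intro!: exI[of _ "\<lambda>i x. 0"] exI[of _ 0])
  show ?thesis unfolding Suc
    by (rule unif_bdd_SucI[OF _ _ z]) (use assms in auto)
qed (use assms in auto)

lemma unif_bdd_cmult: "unif_bdd n A I f \<Longrightarrow> unif_bdd n A I (\<lambda>i x. k * f i x)" for k :: real
  by (rule unif_bdd_mult[OF unif_bdd_const[of A "\<lambda>_. k" "\<bar>k\<bar>"]]) auto

lemma unif_bdd_minus: "unif_bdd n A I f \<Longrightarrow> unif_bdd n A I (\<lambda>i x. - f i x)"
  using unif_bdd_cmult[of n A I f "-1"] by simp

lemma unif_bdd_diff: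
  "unif_bdd n A I f \<Longrightarrow> unif_bdd n A I g \<Longrightarrow> unif_bdd n A I (\<lambda>i x. f i x - g i x)"
  using unif_bdd_add[OF _ unif_bdd_minus, of n A I f g] by simp

lemma unif_bdd_ident:
  assumes "\<And>i. i \<in> A \<Longrightarrow> I i \<subseteq> {-1<..<1}"
  shows "unif_bdd n A I (\<lambda>i x. x)"
proof -
  have "\<bar>x\<bar> \<le> 1" if "i \<in> A" "x \<in> I i" for i x
  proof -
    have "x \<in> {-1<..<1}" using assms that by blast
    then show ?thesis by auto
  qed
  then have 0: "unif_bdd 0 A I (\<lambda>i x. x)" by (rule unif_bdd_0I)
  show ?thesis
  proof (cases n)
    case (Suc m)
    show ?thesis unfolding Suc
      by (rule unif_bdd_SucI[OF 0 _ unif_bdd_const[of A "\<lambda>_. 1" 1]]) auto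
  qed (use 0 in simp)
qed

lemma unif_bdd_inverse:
  assumes "m > 0" "\<And>i x. i \<in> A \<Longrightarrow> x \<in> I i \<Longrightarrow> m \<le> f i x"
  shows "unif_bdd n A I f \<Longrightarrow> unif_bdd n A I (\<lambda>i x. inverse (f i x))"
proof (induction n)
  case 0
  have "\<bar>inverse (f i x)\<bar> \<le> inverse m" if "i \<in> A" "x \<in> I i" for i x
    using assms(2)[OF that] assms(1) by (simp add: abs_inverse le_imp_inverse_le)
  then show ?case by (rule unif_bdd_0I)
next
  case (Suc n)
  then obtain f' where d: "\<forall>i\<in>A. \<forall>x\<in>I i. (f i has_real_derivative f' i x) (at x)" "unif_bdd n A I f'"
    by auto
  have IH: "unif_bdd n A I (\<lambda>i x. inverse (f i x))" by (rule Suc.IH[OF unif_bdd_pred[OF Suc.prems]])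
  show ?case
  proof (rule unif_bdd_SucI[OF unif_bdd_0[OF IH] _
        unif_bdd_minus[OF unif_bdd_mult[OF unif_bdd_mult[OF IH d(2)] IH]]])
    fix i x assume ix: "i \<in> A" "x \<in> I i"
    have "f i x \<noteq> 0" using assms(2)[OF ix] assms(1) by linarith
    then show "((\<lambda>x. inverse (f i x)) has_real_derivative - (inverse (f i x) * f' i x * inverse (f i x))) (at x)"
      using DERIV_inverse'[of "f i" "f' i x" x] d(1) ix by blast
  qed
qed

lemma unif_bdd_sqrt:
  assumes "m > 0" "\<And>i x. i \<in> A \<Longrightarrow> x \<in> I i \<Longrightarrow> m \<le> f i x"
  shows "unif_bdd n A I f \<Longrightarrow> unif_bdd n A I (\<lambda>i x. sqrt (f i x))"
proof (induction n)
  case 0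
  then obtain M where M: "\<forall>i\<in>A. \<forall>x\<in>I i. \<bar>f i x\<bar> \<le> M" by auto
  have "\<bar>sqrt (f i x)\<bar> \<le> sqrt M" if "i \<in> A" "x \<in> I i" for i x
  proof -
    have "0 \<le> f i x" using assms(2)[OF that] assms(1) by linarith
    moreover have "f i x \<le> M" using M that abs_le_D1 by blast
    ultimately show ?thesis by simp
  qed
  then show ?case by (rule unif_bdd_0I)
next
  case (Suc n)
  then obtain f' where d: "\<forall>i\<in>A. \<forall>x\<in>I i. (f i has_real_derivative f' i x) (at x)" "unif_bdd n A I f'"
    by auto
  have IH: "unif_bdd n A I (\<lambda>i x. sqrt (f i x))" by (rule Suc.IH[OF unif_bdd_pred[OF Suc.prems]])
  have inv: "unif_bdd n A I (\<lambda>i x. inverse (sqrt (f i x)))"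
    by (rule unif_bdd_inverse[OF _ _ IH, of "sqrt m"]) (use assms in auto)
  show ?case
  proof (rule unif_bdd_SucI[OF unif_bdd_0[OF IH] _ unif_bdd_cmult[OF unif_bdd_mult[OF d(2) inv], of "1/2"]])
    fix i x assume ix: "i \<in> A" "x \<in> I i"
    have "f i x > 0" using assms(2)[OF ix] assms(1) by linarith
    moreover have "(f i has_real_derivative f' i x) (at x)" using d(1) ix by blast
    ultimately have "((\<lambda>x. sqrt (f i x)) has_real_derivative inverse (sqrt (f i x)) / 2 * f' i x) (at x)"
      using DERIV_chain2[OF DERIV_real_sqrt] by blast
    then show "((\<lambda>x. sqrt (f i x)) has_real_derivative 1/2 * (f' i x * inverse (sqrt (f i x)))) (at x)"
      by (simp add: mult.commute)
  qed
qed

lemma unif_bdd_reflect: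
  "unif_bdd n A I f \<Longrightarrow> (\<And>i. i \<in> A \<Longrightarrow> uminus ` J i \<subseteq> I i) \<Longrightarrow> unif_bdd n A J (\<lambda>i x. f i (- x))"
proof (induction n arbitrary: f)
  case 0
  then obtain M where M: "\<forall>i\<in>A. \<forall>x\<in>I i. \<bar>f i x\<bar> \<le> M" by auto
  have "\<bar>f i (- x)\<bar> \<le> M" if "i \<in> A" "x \<in> J i" for i x using M 0(2) that by blast
  then show ?case by (rule unif_bdd_0I)
next
  case (Suc n)
  then obtain f' where d: "\<forall>i\<in>A. \<forall>x\<in>I i. (f i has_real_derivative f' i x) (at x)" "unif_bdd n A I f'"
    by auto
  have "unif_bdd n A J (\<lambda>i x. f i (- x))" by (rule Suc.IH[OF unif_bdd_pred[OF Suc.prems(1)] Suc.prems(2)])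
  show ?case
  proof (rule unif_bdd_SucI[OF unif_bdd_0[OF \<open>unif_bdd n A J (\<lambda>i x. f i (- x))\<close>] _
        unif_bdd_minus[OF Suc.IH[OF d(2) Suc.prems(2)]]])
    fix i x assume ix: "i \<in> A" "x \<in> J i"
    then have "- x \<in> I i" using Suc.prems(2) by blast
    then have "(f i has_real_derivative f' i (- x)) (at (- x))" using d(1) ix by blast
    then show "((\<lambda>x. f i (- x)) has_real_derivative - f' i (- x)) (at x)" by (simp add: DERIV_mirror)
  qed
qed

text \<open>The way back to iterated derivatives. One order is spent on the differentiability of the highest derivative.\<close>

lemma unif_bdd_deriv_bounds:
  assumes "unif_bdd (Suc m) A I f" "\<And>i. i \<in> A \<Longrightarrow> open (I i)"
  obtains M where "M > 0" "\<forall>i\<in>A. \<forall>j\<le>m. \<forall>x\<in>I i.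
      \<bar>(deriv ^^ j) (f i) x\<bar> \<le> M \<and> (\<exists>d. ((deriv ^^ j) (f i) has_real_derivative d) (at x))"
proof -
  have "\<exists>M. \<forall>i\<in>A. \<forall>x\<in>I i. \<bar>(deriv ^^ j) (f i) x\<bar> \<le> M \<and> (\<exists>d. ((deriv ^^ j) (f i) has_real_derivative d) (at x))"
    if "j \<le> m" for j
  proof -
    have "\<exists>g. (\<forall>i\<in>A. \<forall>x\<in>I i. g i x = (deriv ^^ j) (f i) x) \<and> unif_bdd (Suc (m - j)) A I g"
      using that
    proof (induction j)
      case 0
      then show ?case using assms(1) by auto
    next
      case (Suc j)
      then obtain g where g: "\<forall>i\<in>A. \<forall>x\<in>I i. g i x = (deriv ^^ j) (f i) x" "unif_bdd (Suc (m - j)) A I g"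
        using Suc_leD by blast
      obtain g' where g': "\<forall>i\<in>A. \<forall>x\<in>I i. (g i has_real_derivative g' i x) (at x)" "unif_bdd (m - j) A I g'"
        by (rule unif_bdd_SucE[OF g(2)])
      have "g' i x = (deriv ^^ Suc j) (f i) x" if ix: "i \<in> A" "x \<in> I i" for i x
      proof -
        have "((deriv ^^ j) (f i) has_real_derivative g' i x) (at x)"
          by (rule has_field_derivative_transform_within_open[OF g'(1)[rule_format, OF ix] assms(2)[OF ix(1)]]) (use g(1) ix in auto)
        then show ?thesis by (simp add: DERIV_imp_deriv)
      qed
      moreover have "m - j = Suc (m - Suc j)" using Suc.prems by simp
      ultimately show ?case using g'(2) by (intro exI[of _ g']) auto
    qed
    then obtain g where g: "\<forall>i\<in>A. \<forall>x\<in>I i. g i x = (deriv ^^ j) (f i) x" "unif_bdd (Suc (m - j)) A I g"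
      by blast
    obtain M where "M > 0" and M: "\<forall>i\<in>A. \<forall>x\<in>I i. \<bar>g i x\<bar> \<le> M"
      by (rule unif_bdd_bound[OF g(2)])
    obtain g' where g': "\<forall>i\<in>A. \<forall>x\<in>I i. (g i has_real_derivative g' i x) (at x)"
      and "unif_bdd (m - j) A I g'"
      by (rule unif_bdd_SucE[OF g(2)])
    have "\<exists>d. ((deriv ^^ j) (f i) has_real_derivative d) (at x)" if ix: "i \<in> A" "x \<in> I i" for i x
    proof
      show "((deriv ^^ j) (f i) has_real_derivative g' i x) (at x)"
        by (rule has_field_derivative_transform_within_open[OF g'[rule_format, OF ix] assms(2)[OF ix(1)]]) (use g(1) ix in auto)
    qed
    moreover have "\<bar>(deriv ^^ j) (f i) x\<bar> \<le> M" if "i \<in> A" "x \<in> I i" for i x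
      using M g(1) that by metis
    ultimately show ?thesis by blast
  qed
  then obtain M where M: "\<And>j. j \<le> m \<Longrightarrow> \<forall>i\<in>A. \<forall>x\<in>I i. \<bar>(deriv ^^ j) (f i) x\<bar> \<le> M j \<and>
      (\<exists>d. ((deriv ^^ j) (f i) has_real_derivative d) (at x))" by metis
  show ?thesis
  proof (rule that[of "1 + (\<Sum>j\<le>m. \<bar>M j\<bar>)"])
    show "0 < 1 + (\<Sum>j\<le>m. \<bar>M j\<bar>)" by (simp add: add_pos_nonneg sum_nonneg)
  next
    show "\<forall>i\<in>A. \<forall>j\<le>m. \<forall>x\<in>I i. \<bar>(deriv ^^ j) (f i) x\<bar> \<le> 1 + (\<Sum>j\<le>m. \<bar>M j\<bar>) \<and>
        (\<exists>d. ((deriv ^^ j) (f i) has_real_derivative d) (at x))"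
    proof (intro ballI allI impI)
      fix i j x assume ijx: "i \<in> A" "j \<le> m" "x \<in> I i"
      have "\<bar>M j\<bar> \<le> (\<Sum>j\<le>m. \<bar>M j\<bar>)" using ijx by (intro member_le_sum) auto
      moreover have "\<bar>(deriv ^^ j) (f i) x\<bar> \<le> M j" and d: "\<exists>d. ((deriv ^^ j) (f i) has_real_derivative d) (at x)"
        using M[OF ijx(2)] ijx by blast+
      ultimately have "\<bar>(deriv ^^ j) (f i) x\<bar> \<le> 1 + (\<Sum>j\<le>m. \<bar>M j\<bar>)" by linarith
      then show "\<bar>(deriv ^^ j) (f i) x\<bar> \<le> 1 + (\<Sum>j\<le>m. \<bar>M j\<bar>) \<and> (\<exists>d. ((deriv ^^ j) (f i) has_real_derivative d) (at x))"
        using d by simp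
    qed
  qed
qed

section \<open>Singularly perturbed linear equations\<close>

text \<open>The weight removes the initial layer: \<open>F = (x - y) v\<close> starts from \<open>0\<close> and satisfies \<open>\<nu> F' = - \<tau> F + (\<nu> v + (x - y) r)\<close>, where the bracket
  is at most \<open>M + 2 M\<close> by the length of the interval. So \<open>|F|\<close> cannot exceed \<open>3 M / \<tau>0\<close>, although \<open>v\<close> itself may be of order \<open>1 / \<nu>\<close>
  near \<open>y\<close>.\<close>

lemma damped_bound:
  fixes v :: "real \<Rightarrow> real"
  assumes pos: "0 < \<nu>" "0 < \<tau>0" "0 < \<delta>" "0 < M" and len: "z \<le> y + 2"
    and der: "\<And>x. x \<in> {y<..<z} \<Longrightarrow> (v has_real_derivative (- \<tau> x * v x + r x) / \<nu>) (at x)"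
    and tau: "\<And>x. x \<in> {y<..<z} \<Longrightarrow> \<tau>0 \<le> \<tau> x"
    and r: "\<And>x. x \<in> {y<..<z} \<Longrightarrow> \<bar>r x\<bar> \<le> M"
    and v: "\<And>x. x \<in> {y<..<z} \<Longrightarrow> \<bar>\<nu> * v x\<bar> \<le> M"
    and x: "x \<in> {y + \<delta><..<z}"
  shows "\<bar>v x\<bar> \<le> 3 * M / (\<tau>0 * \<delta>)"
proof -
  define B where "B = 3 * M / \<tau>0"
  have B: "B > 0" using pos by (simp add: B_def)
  have half: "(x - y) * w x \<le> B"
    if der: "\<And>t. t \<in> {y<..<z} \<Longrightarrow> (w has_real_derivative (- \<tau> t * w t + s t) / \<nu>) (at t)"
      and s: "\<And>t. t \<in> {y<..<z} \<Longrightarrow> \<bar>s t\<bar> \<le> M" and w: "\<And>t. t \<in> {y<..<z} \<Longrightarrow> \<bar>\<nu> * w t\<bar> \<le> M"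
    for w s :: "real \<Rightarrow> real"
  proof -
    (* Close to y the weight beats the bound M / nu on w, so the comparison can start at x1. *)
    define x1 where "x1 = min x (y + B * \<nu> / M)"
    have x1: "y < x1" "x1 \<le> x" "(x1 - y) * M \<le> B * \<nu>"
    proof -
      have "0 < B * \<nu> / M" using B pos by simp
      then show "y < x1" using x pos by (auto simp: x1_def)
      have "(x1 - y) * M \<le> (B * \<nu> / M) * M" using pos by (intro mult_right_mono) (auto simp: x1_def)
      then show "(x1 - y) * M \<le> B * \<nu>" using pos by simp
    qed (simp add: x1_def)
    define f where "f t = B - (t - y) * w t" for t
    define f' where "f' t = - (w t + (t - y) * ((- \<tau> t * w t + s t) / \<nu>))" for t
    have "0 \<le> f x"
    proof (rule nonneg_persists[where f = f and f' = f' and a = x1])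
      show "x1 \<le> x" by (rule x1)
      fix t assume "t \<in> {x1..x}"
      then have t: "t \<in> {y<..<z}" using x1 x by auto
      show "(f has_real_derivative f' t) (at t)"
        unfolding f_def f'_def using der[OF t] by (auto intro!: derivative_eq_intros)
      assume neg: "f t < 0"
      have ty: "0 \<le> t - y" "t - y \<le> 2" using t len by auto
      have "\<tau>0 * B \<le> \<tau> t * ((t - y) * w t)"
        using tau[OF t] neg B pos by (intro mult_mono) (auto simp: f_def)
      then have "3 * M \<le> \<tau> t * ((t - y) * w t)" using pos by (simp add: B_def)
      moreover have "(t - y) * s t \<le> 2 * M"
      proof -
        have "(t - y) * s t \<le> (t - y) * \<bar>s t\<bar>" using ty by (intro mult_left_mono) auto
        also have "\<dots> \<le> 2 * M" using ty s[OF t] by (intro mult_mono) auto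
        finally show ?thesis .
      qed
      moreover have "\<nu> * w t \<le> M" using w[OF t] by linarith
      ultimately have "0 \<le> - (\<nu> * w t + (t - y) * (- \<tau> t * w t + s t))" by (simp add: algebra_simps)
      also have "\<dots> = \<nu> * f' t"
      proof -
        have "\<nu> * ((t - y) * ((- \<tau> t * w t + s t) / \<nu>)) = (t - y) * (- \<tau> t * w t + s t)" using pos by simp
        then show ?thesis by (simp add: f'_def right_diff_distrib)
      qed
      finally show "0 \<le> f' t" using pos by (simp add: zero_le_mult_iff)
    next
      have x1': "x1 \<in> {y<..<z}" using x1 x by auto
      have "\<nu> * ((x1 - y) * w x1) = (x1 - y) * (\<nu> * w x1)" by simp
      also have "\<dots> \<le> (x1 - y) * M"
        using w[OF x1'] x1 by (intro mult_left_mono) auto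
      also have "\<dots> \<le> \<nu> * B" using x1(3) by (simp add: mult.commute)
      finally show "0 \<le> f x1" using pos by (simp add: f_def)
    qed
    then show ?thesis by (simp add: f_def)
  qed
  have "(x - y) * v x \<le> B" by (rule half[OF der r v])
  moreover have "(x - y) * (- v x) \<le> B"
  proof (rule half[where s = "\<lambda>t. - r t"])
    fix t assume t: "t \<in> {y<..<z}"
    show "((\<lambda>t. - v t) has_real_derivative (- \<tau> t * - v t + - r t) / \<nu>) (at t)"
      using DERIV_minus[OF der[OF t]] by (simp add: minus_divide_left)
  qed (use r v in auto)
  ultimately have "(x - y) * \<bar>v x\<bar> \<le> B" by (cases "0 \<le> v x") auto
  moreover have "\<delta> * \<bar>v x\<bar> \<le> (x - y) * \<bar>v x\<bar>" using x by (intro mult_right_mono) auto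
  ultimately have "\<delta> * \<bar>v x\<bar> \<le> B" by linarith
  then show ?thesis using pos by (simp add: B_def field_simps)
qed

lemma damped_first_bound:
  fixes y z :: "'i \<Rightarrow> real"
  assumes nu: "\<And>i. i \<in> A \<Longrightarrow> 0 < \<nu> i" and len: "\<And>i. i \<in> A \<Longrightarrow> z i \<le> y i + 2"
    and tau: "0 < \<tau>0" "\<And>i x. i \<in> A \<Longrightarrow> x \<in> {y i<..<z i} \<Longrightarrow> \<tau>0 \<le> \<tau> i x"
    and der: "\<And>i x. i \<in> A \<Longrightarrow> x \<in> {y i<..<z i} \<Longrightarrow>
        (v i has_real_derivative (- \<tau> i x * v i x + r i x) / \<nu> i) (at x)"
    and r: "unif_bdd 0 A (\<lambda>i. {y i<..<z i}) r" and nv: "unif_bdd 0 A (\<lambda>i. {y i<..<z i}) (\<lambda>i x. \<nu> i * v i x)"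
    and delta: "\<delta> > 0"
  shows "unif_bdd 0 A (\<lambda>i. {y i + \<delta><..<z i}) v"
proof -
  obtain M where M: "M > 0" "\<forall>i\<in>A. \<forall>x\<in>{y i<..<z i}. \<bar>r i x\<bar> \<le> M"
    by (rule unif_bdd_bound[OF r])
  obtain N where N: "N > 0" "\<forall>i\<in>A. \<forall>x\<in>{y i<..<z i}. \<bar>\<nu> i * v i x\<bar> \<le> N"
    by (rule unif_bdd_bound[OF nv])
  have "\<bar>v i x\<bar> \<le> 3 * (max M N) / (\<tau>0 * \<delta>)" if ix: "i \<in> A" "x \<in> {y i + \<delta><..<z i}" for i x
  proof (rule damped_bound[OF nu[OF ix(1)] tau(1) delta _ len[OF ix(1)] der[OF ix(1)] tau(2)[OF ix(1)] _ _ ix(2)])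
    show "0 < max M N" using M(1) by simp
    fix t assume t: "t \<in> {y i<..<z i}"
    show "t \<in> {y i<..<z i}" "t \<in> {y i<..<z i}" by (rule t)+
    have "\<bar>r i t\<bar> \<le> M" using M(2) ix(1) t by blast
    then show "\<bar>r i t\<bar> \<le> max M N" by simp
    have "\<bar>\<nu> i * v i t\<bar> \<le> N" using N(2) ix(1) t by blast
    then show "\<bar>\<nu> i * v i t\<bar> \<le> max M N" by simp
  qed
  then show ?thesis by (rule unif_bdd_0I)
qed

text \<open>Differentiation of \<open>\<nu> u' = - \<tau> u + r\<close> gives an equation of the same form for \<open>v = u'\<close>, with the inhomogeneity \<open>r' - \<tau>' u\<close>. The
  equation for \<open>u\<close> bounds \<open>\<nu> v\<close>, so \<open>v\<close> is bounded after a loss of domain, and the induction hypothesis applies to \<open>v\<close>. The shares of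
  \<open>\<delta>\<close> are the domains lost in the successive steps.\<close>

lemma damped_unif_bdd:
  fixes y z :: "'i \<Rightarrow> real"
  assumes nu: "\<And>i. i \<in> A \<Longrightarrow> 0 < \<nu> i" and tau0: "0 < \<tau>0"
  shows "(\<And>i. i \<in> A \<Longrightarrow> z i \<le> y i + 2) \<Longrightarrow>
    (\<And>i x. i \<in> A \<Longrightarrow> x \<in> {y i<..<z i} \<Longrightarrow> \<tau>0 \<le> \<tau> i x) \<Longrightarrow>
    (\<And>i x. i \<in> A \<Longrightarrow> x \<in> {y i<..<z i} \<Longrightarrow>
        (u i has_real_derivative (- \<tau> i x * u i x + r i x) / \<nu> i) (at x)) \<Longrightarrow>
    unif_bdd n A (\<lambda>i. {y i<..<z i}) \<tau> \<Longrightarrow> unif_bdd n A (\<lambda>i. {y i<..<z i}) r \<Longrightarrow>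
    unif_bdd 0 A (\<lambda>i. {y i<..<z i}) u \<Longrightarrow> \<delta> > 0 \<Longrightarrow>
    unif_bdd n A (\<lambda>i. {y i + \<delta><..<z i}) u"
proof (induction n arbitrary: u r \<delta> y)
  case 0
  show ?case by (rule unif_bdd_subset[OF 0(6)]) (use 0(7) in auto)
next
  case (Suc n)
  note len = Suc.prems(1) and tau = Suc.prems(2) and der = Suc.prems(3) and delta = Suc.prems(7)
  let ?I = "\<lambda>d i. {y i + d<..<z i}"
  have sub: "unif_bdd k A (\<lambda>i. {y i<..<z i}) f \<Longrightarrow> d \<ge> 0 \<Longrightarrow> unif_bdd k A (?I d) f" for k f d
    by (erule unif_bdd_subset) auto
  obtain \<tau>' where tau': "\<forall>i\<in>A. \<forall>x\<in>{y i<..<z i}. (\<tau> i has_real_derivative \<tau>' i x) (at x)"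
    "unif_bdd n A (\<lambda>i. {y i<..<z i}) \<tau>'"
    by (rule unif_bdd_SucE[OF Suc.prems(4)])
  obtain r' where r': "\<forall>i\<in>A. \<forall>x\<in>{y i<..<z i}. (r i has_real_derivative r' i x) (at x)"
    "unif_bdd n A (\<lambda>i. {y i<..<z i}) r'"
    by (rule unif_bdd_SucE[OF Suc.prems(5)])
  have u_n: "unif_bdd n A (?I (\<delta>/4)) u"
    by (rule Suc.IH[OF len tau der unif_bdd_pred[OF Suc.prems(4)] unif_bdd_pred[OF Suc.prems(5)] Suc.prems(6)])
       (use delta in simp_all)
  define v where "v i x = (- \<tau> i x * u i x + r i x) / \<nu> i" for i x
  define s where "s i x = r' i x - \<tau>' i x * u i x" for i x
  have dv: "(v i has_real_derivative (- \<tau> i x * v i x + s i x) / \<nu> i) (at x)"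
    if ix: "i \<in> A" "x \<in> {y i<..<z i}" for i x
  proof -
    have "(v i has_real_derivative (- \<tau>' i x * u i x + v i x * - \<tau> i x + r' i x) / \<nu> i) (at x)"
      unfolding v_def[abs_def]
      using DERIV_cdivide[OF DERIV_add[OF DERIV_mult[OF DERIV_minus[OF tau'(1)[rule_format, OF ix]] der[OF ix]]
            r'(1)[rule_format, OF ix]], of "\<nu> i"] .
    then show ?thesis by (simp add: s_def algebra_simps)
  qed
  have nv: "unif_bdd 0 A (?I (\<delta>/4)) (\<lambda>i x. \<nu> i * v i x)"
  proof -
    have "unif_bdd 0 A (?I (\<delta>/4)) (\<lambda>i x. - \<tau> i x * u i x + r i x)"
      by (intro unif_bdd_add unif_bdd_mult unif_bdd_minus unif_bdd_0[OF sub[OF Suc.prems(4)]]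
          unif_bdd_0[OF sub[OF Suc.prems(5)]] sub[OF Suc.prems(6)]) (use delta in auto)
    then obtain M where M: "M > 0" "\<forall>i\<in>A. \<forall>x\<in>?I (\<delta>/4) i. \<bar>- \<tau> i x * u i x + r i x\<bar> \<le> M"
      by (rule unif_bdd_bound)
    have "\<nu> i * v i x = - \<tau> i x * u i x + r i x" if "i \<in> A" for i x
      using nu[OF that] by (simp add: v_def)
    then show ?thesis using M(2) by (intro unif_bdd_0I[of _ _ _ M]) metis
  qed
  have s_n: "unif_bdd n A (?I (\<delta>/4)) s"
    unfolding s_def[abs_def]
    by (intro unif_bdd_diff unif_bdd_mult u_n sub[OF r'(2)] sub[OF tau'(2)]) (use delta in auto)
  have v_0: "unif_bdd 0 A (?I (\<delta>/2)) v"
  proof -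
    have "unif_bdd 0 A (\<lambda>i. {(y i + \<delta>/4) + \<delta>/4<..<z i}) v"
    proof (rule damped_first_bound[OF nu _ tau0 _ _ unif_bdd_0[OF s_n] nv])
      fix i x assume ix: "i \<in> A" "x \<in> ?I (\<delta>/4) i"
      then have x: "x \<in> {y i<..<z i}" using delta by auto
      show "\<tau>0 \<le> \<tau> i x" by (rule tau[OF ix(1) x])
      show "(v i has_real_derivative (- \<tau> i x * v i x + s i x) / \<nu> i) (at x)" by (rule dv[OF ix(1) x])
    next
      fix i assume "i \<in> A"
      then show "z i \<le> y i + \<delta>/4 + 2" using len[of i] delta by simp
    qed (use delta in auto)
    then show ?thesis by (rule unif_bdd_subset) auto
  qed
  have "unif_bdd n A (\<lambda>i. {(y i + \<delta>/2) + \<delta>/2<..<z i}) v"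
  proof (rule Suc.IH[where r = s])
    show "unif_bdd n A (?I (\<delta>/2)) \<tau>" by (rule sub[OF unif_bdd_pred[OF Suc.prems(4)]]) (use delta in auto)
    show "unif_bdd n A (?I (\<delta>/2)) s" by (rule unif_bdd_subset[OF s_n]) (use delta in auto)
    show "unif_bdd 0 A (?I (\<delta>/2)) v" by (rule v_0)
  next
    fix i assume "i \<in> A" then show "z i \<le> y i + \<delta>/2 + 2" using len[of i] delta by simp
  next
    fix i x assume ix: "i \<in> A" "x \<in> ?I (\<delta>/2) i"
    then have x: "x \<in> {y i<..<z i}" using delta by auto
    show "\<tau>0 \<le> \<tau> i x" by (rule tau[OF ix(1) x])
    show "(v i has_real_derivative (- \<tau> i x * v i x + s i x) / \<nu> i) (at x)" by (rule dv[OF ix(1) x])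
  qed (use delta in simp)
  then have v_n: "unif_bdd n A (?I \<delta>) v" by (rule unif_bdd_subset) auto
  show ?case
  proof (rule unif_bdd_SucI[OF sub[OF Suc.prems(6)] _ v_n])
    fix i x assume ix: "i \<in> A" "x \<in> {y i + \<delta><..<z i}"
    then have x: "x \<in> {y i<..<z i}" using delta by auto
    show "(u i has_real_derivative v i x) (at x)" unfolding v_def by (rule der[OF ix(1) x])
  qed (use delta in simp)
qed

section \<open>The deviation divided by the viscosity\<close>

text \<open>A lower bound on \<open>p\<close> keeps the full order of the error.\<close>

lemma deviation_bound:
  assumes "0 \<le> u" "0 < p0" "p0 \<le> p" "\<bar>(1/2) * u\<^sup>2 - p\<bar> \<le> d"
  shows "\<bar>u - sqrt (2 * p)\<bar> \<le> 2 * d / sqrt p0"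
proof -
  have s: "sqrt p0 > 0" "sqrt p0 \<le> sqrt (2 * p)" using assms(2,3) by auto
  have "\<bar>u - sqrt (2 * p)\<bar> * sqrt p0 \<le> \<bar>u - sqrt (2 * p)\<bar> * \<bar>u + sqrt (2 * p)\<bar>"
  proof (rule mult_left_mono)
    show "sqrt p0 \<le> \<bar>u + sqrt (2 * p)\<bar>" using s assms(1) by linarith
  qed simp
  also have "\<dots> = \<bar>u\<^sup>2 - 2 * p\<bar>"
    using assms(2,3) by (simp add: abs_mult[symmetric] power2_eq_square algebra_simps)
  also have "\<dots> \<le> 2 * d" using assms(4) by (auto simp: abs_le_iff)
  finally show ?thesis using s by (simp add: field_simps)
qed

text \<open>With \<open>b = 1 / (1 - x\<^sup>2)\<close>, \<open>w = 2 x b\<close>, \<open>S = sqrt (2 P)\<close> and \<open>S1 = S'\<close>, the differentiated function is the right-hand side of the equation for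
  \<open>E' = v\<close>, so this is the linear equation \<open>\<nu> v' = - \<tau> v + r\<close>. The coefficient \<open>\<tau> = b (S + \<nu> E) + \<nu> w\<close> equals \<open>b (U + 2 \<nu> x)\<close>.\<close>

lemma quotient_eq_deriv:
  assumes "(b has_real_derivative b') (at x)" "(w has_real_derivative w') (at x)"
    "(S has_real_derivative S1 x) (at x)" "(S1 has_real_derivative S2) (at x)"
    "(E has_real_derivative v) (at x)"
  shows "((\<lambda>x. (- (b x * (S x + \<nu> / 2 * E x) * E x) - w x * (S x + \<nu> * E x) - S1 x) / \<nu>) has_real_derivative
     (- (b x * (S x + \<nu> * E x) + \<nu> * w x) * v
        + (- (b' * (S x + \<nu> / 2 * E x) * E x) - b x * S1 x * E x - w' * (S x + \<nu> * E x) - w x * S1 x - S2)) / \<nu>) (at x)"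
proof (rule DERIV_cdivide)
  note [derivative_intros] = assms
  show "((\<lambda>x. - (b x * (S x + \<nu> / 2 * E x) * E x) - w x * (S x + \<nu> * E x) - S1 x) has_real_derivative
     - (b x * (S x + \<nu> * E x) + \<nu> * w x) * v
        + (- (b' * (S x + \<nu> / 2 * E x) * E x) - b x * S1 x * E x - w' * (S x + \<nu> * E x) - w x * S1 x - S2)) (at x)"
    by (rule derivative_eq_intros assms refl)+ (simp add: field_simps)
qed

text \<open>The bootstrap: bounds for \<open>E\<close> up to order \<open>n\<close> give bounds of that order for \<open>\<tau>\<close> and \<open>r\<close>, hence for \<open>v = E'\<close>, which are
  bounds for \<open>E\<close> up to order \<open>n + 1\<close>. The two smallness conditions on \<open>\<nu>\<close> provide \<open>U\<^sup>2 \<ge> p0\<close> and \<open>U + 2 \<nu> x \<ge> sqrt p0 / 2\<close>.\<close>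

lemma deviation_quotient_unif_bdd:
  fixes \<nu> y :: "'i \<Rightarrow> real" and c :: "'i \<Rightarrow> real^3" and U :: "'i \<Rightarrow> real \<Rightarrow> real"
  assumes R: "1 \<le> R" and eps: "0 < \<epsilon>" and p0: "0 < p0" and K: "K = 100 * R + 10 * R / (\<epsilon> / 2)"
    and nu: "\<And>i. i \<in> A \<Longrightarrow> 0 < \<nu> i \<and> \<nu> i \<le> 1 \<and> 2 * K * \<nu> i \<le> p0 \<and> 4 * \<nu> i \<le> sqrt p0"
    and c: "\<And>i. i \<in> A \<Longrightarrow> c i \<in> J_set 0 \<and> norm (c i) \<le> R"
    and sol: "\<And>i. i \<in> A \<Longrightarrow> is_solution (\<nu> i) (c i) (U i)"
    and y: "\<And>i. i \<in> A \<Longrightarrow> -1 \<le> y i"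
    and pos: "\<And>i x. i \<in> A \<Longrightarrow> x \<in> {y i<..<1} \<Longrightarrow> 0 \<le> U i x"
    and P: "\<And>i x. i \<in> A \<Longrightarrow> x \<in> {-1<..<1} \<Longrightarrow> p0 \<le> P_poly (c i) x"
  shows "unif_bdd n A (\<lambda>i. {y i + \<epsilon><..<1 - \<epsilon>}) (\<lambda>i x. (U i x - sqrt (2 * P_poly (c i) x)) / \<nu> i)"
proof -
  define y0 where "y0 i = y i + \<epsilon> / 2" for i
  define z :: real where "z = 1 - \<epsilon>"
  let ?I = "\<lambda>i. {y0 i<..<z}" and ?J = "\<lambda>d i. {y0 i + d<..<z}"
  have I: "x \<in> {-1<..<1}" "\<epsilon> / 2 \<le> 1 - x\<^sup>2" "x \<in> {y i + \<epsilon>/2<..<1}" if "i \<in> A" "x \<in> ?I i" for i x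
  proof -
    have x: "x \<in> {-1 + \<epsilon>/2<..<1 - \<epsilon>/2}" "x < 1" using that y[OF that(1)] eps by (auto simp: y0_def z_def)
    then show "x \<in> {-1<..<1}" using eps by auto
    show "\<epsilon> / 2 \<le> 1 - x\<^sup>2" by (rule one_minus_sq_ge[OF x(1)]) (use eps in simp)
    show "x \<in> {y i + \<epsilon>/2<..<1}" using that x by (auto simp: y0_def)
  qed
  define s0 where "s0 = sqrt p0"
  have s0: "0 < s0" using p0 by (simp add: s0_def)
  define S where "S i x = sqrt (2 * P_poly (c i) x)" for i x
  define E where "E i x = (U i x - S i x) / \<nu> i" for i x
  define b :: "'i \<Rightarrow> real \<Rightarrow> real" where "b i x = inverse (1 - x * x)" for i x
  define b' :: "'i \<Rightarrow> real \<Rightarrow> real" where "b' i x = 2 * x * (b i x * b i x)" for i x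
  define w :: "'i \<Rightarrow> real \<Rightarrow> real" where "w i x = 2 * x * b i x" for i x
  define w' :: "'i \<Rightarrow> real \<Rightarrow> real" where "w' i x = 2 * b i x + 2 * x * b' i x" for i x
  define iS where "iS i x = inverse (S i x)" for i x
  define S1 where "S1 i x = P_deriv (c i) x * iS i x" for i x
  define S2 where "S2 i x = - 2 * c i $ 3 * iS i x - P_deriv (c i) x * (iS i x * S1 i x * iS i x)" for i x

  (* The coefficients have uniformly bounded derivatives of every order. *)
  have X: "unif_bdd n A ?I (\<lambda>i x. x)" for n
    by (rule unif_bdd_ident) (use I(1) in blast)
  have C: "unif_bdd n A ?I (\<lambda>i x. c i $ j)" for n j
    by (rule unif_bdd_const[where M = R]) (use c component_le_norm_cart order_trans in blast)
  have N: "unif_bdd n A ?I (\<lambda>i x. \<nu> i)" for n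
    by (rule unif_bdd_const[where M = 1]) (use nu in force)
  have k: "unif_bdd n A ?I (\<lambda>i x. k)" for n and k :: real
    by (rule unif_bdd_const[where M = "\<bar>k\<bar>"]) simp
  have Pn: "unif_bdd n A ?I (\<lambda>i x. P_poly (c i) x)" for n
    unfolding P_poly_def power2_eq_square by (intro unif_bdd_add unif_bdd_diff unif_bdd_mult C k X)
  have P1n: "unif_bdd n A ?I (\<lambda>i x. P_deriv (c i) x)" for n
    unfolding P_deriv_def by (intro unif_bdd_diff unif_bdd_mult C k X)
  have S: "unif_bdd n A ?I S" for n
    unfolding S_def[abs_def]
    by (rule unif_bdd_sqrt[of "2 * p0"]) (use p0 P I(1) in \<open>auto intro!: unif_bdd_cmult Pn\<close>)
  have S_low: "s0 \<le> S i x" "0 < S i x" if "i \<in> A" "x \<in> ?I i" for i x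
  proof -
    have "p0 \<le> 2 * P_poly (c i) x" using P[OF that(1) I(1)[OF that]] p0 by linarith
    then show "s0 \<le> S i x" by (simp add: s0_def S_def)
    then show "0 < S i x" using s0 by linarith
  qed
  have iS: "unif_bdd n A ?I iS" for n
    unfolding iS_def[abs_def] by (rule unif_bdd_inverse[OF s0 S_low(1) S])
  have S1: "unif_bdd n A ?I S1" for n unfolding S1_def[abs_def] by (intro unif_bdd_mult P1n iS)
  have S2: "unif_bdd n A ?I S2" for n
    unfolding S2_def[abs_def] by (intro unif_bdd_diff unif_bdd_mult P1n iS S1 C k)
  have b: "unif_bdd n A ?I b" for n
    unfolding b_def[abs_def]
  proof (rule unif_bdd_inverse[of "\<epsilon>/2"])
    show "unif_bdd n A ?I (\<lambda>i x. 1 - x * x)" by (intro unif_bdd_diff unif_bdd_mult X k)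
  qed (use eps I(2) in \<open>simp_all add: power2_eq_square\<close>)
  have b': "unif_bdd n A ?I b'" for n unfolding b'_def[abs_def] by (intro unif_bdd_mult X k b)
  have w: "unif_bdd n A ?I w" for n unfolding w_def[abs_def] by (intro unif_bdd_mult X k b)
  have w': "unif_bdd n A ?I w'" for n unfolding w'_def[abs_def] by (intro unif_bdd_add unif_bdd_mult X k b b')

  (* Half of the distance eps is spent on the barrier estimates, the other half on the bootstrap. *)
  have res: "\<bar>(1/2) * (U i x)\<^sup>2 - P_poly (c i) x\<bar> \<le> K * \<nu> i" "0 \<le> U i x"
    if ix: "i \<in> A" "x \<in> ?I i" for i x
  proof -
    show "\<bar>(1/2) * (U i x)\<^sup>2 - P_poly (c i) x\<bar> \<le> K * \<nu> i"
      unfolding K by (rule residual_bound_right[OF sol[OF ix(1)] _ _ R _ _ y[OF ix(1)] _ pos[OF ix(1)] I(3)[OF ix]])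
        (use nu[OF ix(1)] c[OF ix(1)] eps in auto)
    show "0 \<le> U i x" by (rule pos[OF ix(1)]) (use I(3)[OF ix] eps in auto)
  qed
  have U_low: "s0 \<le> U i x" if ix: "i \<in> A" "x \<in> ?I i" for i x
  proof -
    have "2 * P_poly (c i) x - 2 * K * \<nu> i \<le> (U i x)\<^sup>2" using res(1)[OF ix] by (auto simp: abs_le_iff)
    then have "p0 \<le> (U i x)\<^sup>2" using P[OF ix(1) I(1)[OF ix]] nu[OF ix(1)] by linarith
    then have "s0 \<le> sqrt ((U i x)\<^sup>2)" unfolding s0_def by (rule real_sqrt_le_mono)
    then show ?thesis using res(2)[OF ix] by simp
  qed
  have UE: "S i x + \<nu> i * E i x = U i x" if "i \<in> A" for i x
    using nu[OF that] by (simp add: E_def)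
  have E0: "unif_bdd 0 A ?I E"
  proof (rule unif_bdd_0I[where M = "2 * K / sqrt p0"])
    fix i x assume ix: "i \<in> A" "x \<in> ?I i"
    have "\<bar>U i x - S i x\<bar> \<le> 2 * (K * \<nu> i) / sqrt p0"
      unfolding S_def by (rule deviation_bound[OF res(2)[OF ix] p0 P[OF ix(1) I(1)[OF ix]] res(1)[OF ix]])
    then show "\<bar>E i x\<bar> \<le> 2 * K / sqrt p0"
      using nu[OF ix(1)] p0 by (simp add: E_def abs_divide field_simps)
  qed

  define v where "v i x = (- (b i x * (S i x + \<nu> i / 2 * E i x) * E i x) - w i x * (S i x + \<nu> i * E i x) - S1 i x) / \<nu> i" for i x
  define \<tau> where "\<tau> i x = b i x * (S i x + \<nu> i * E i x) + \<nu> i * w i x" for i x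
  define r where "r i x = - (b' i x * (S i x + \<nu> i / 2 * E i x) * E i x) - b i x * S1 i x * E i x
      - w' i x * (S i x + \<nu> i * E i x) - w i x * S1 i x - S2 i x" for i x
  have dS: "(S i has_real_derivative S1 i x) (at x)" if ix: "i \<in> A" "x \<in> ?I i" for i x
  proof -
    have "0 < P_poly (c i) x" using P[OF ix(1) I(1)[OF ix]] p0 by linarith
    then show ?thesis unfolding S_def[abs_def] S1_def iS_def S_def
      by (auto intro!: derivative_eq_intros P_poly_deriv simp: field_simps)
  qed
  have dS1: "(S1 i has_real_derivative S2 i x) (at x)" if ix: "i \<in> A" "x \<in> ?I i" for i x
  proof -
    have "(iS i has_real_derivative - (iS i x * S1 i x * iS i x)) (at x)"
      unfolding iS_def[abs_def] using S_low(2)[OF ix] by (intro DERIV_inverse' dS[OF ix]) simp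
    moreover have "(P_deriv (c i) has_real_derivative - 2 * c i $ 3) (at x)"
      unfolding P_deriv_def[abs_def] by (auto intro!: derivative_eq_intros)
    ultimately have "((\<lambda>x. P_deriv (c i) x * iS i x) has_real_derivative
        - 2 * c i $ 3 * iS i x + - (iS i x * S1 i x * iS i x) * P_deriv (c i) x) (at x)"
      by (intro DERIV_mult)
    then show ?thesis unfolding S1_def[abs_def] S2_def by (simp add: S1_def algebra_simps)
  qed
  have db: "(b i has_real_derivative b' i x) (at x)" if ix: "i \<in> A" "x \<in> ?I i" for i x
  proof -
    have "((\<lambda>x. 1 - x * x) has_real_derivative - 2 * x) (at x)" by (auto intro!: derivative_eq_intros)
    moreover have "1 - x * x \<noteq> 0" using I(2)[OF ix] eps by (simp add: power2_eq_square)
    ultimately have "((\<lambda>x. inverse (1 - x * x)) has_real_derivative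
        - (inverse (1 - x * x) * (- 2 * x) * inverse (1 - x * x))) (at x)"
      by (intro DERIV_inverse')
    then show ?thesis unfolding b_def[abs_def] b'_def by (simp add: b_def algebra_simps)
  qed
  have dw: "(w i has_real_derivative w' i x) (at x)" if ix: "i \<in> A" "x \<in> ?I i" for i x
    unfolding w_def[abs_def] w'_def by (rule derivative_eq_intros db[OF ix] refl)+ (simp add: algebra_simps)
  have dE: "(E i has_real_derivative v i x) (at x)" if ix: "i \<in> A" "x \<in> ?I i" for i x
  proof -
    define U' where "U' = (P_poly (c i) x - 2 * \<nu> i * x * U i x - (U i x)\<^sup>2 / 2) / (\<nu> i * (1 - x\<^sup>2))"
    have n: "\<nu> i \<noteq> 0" "1 - x\<^sup>2 \<noteq> 0" using nu[OF ix(1)] I(2)[OF ix] eps by auto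
    have "(E i has_real_derivative (U' - S1 i x) / \<nu> i) (at x)"
      unfolding E_def[abs_def] U'_def using nu[OF ix(1)]
      by (intro DERIV_cdivide DERIV_diff dS[OF ix] solution_deriv[OF sol[OF ix(1)] _ I(1)[OF ix]]) auto
    moreover have "U' = - (b i x * (S i x + \<nu> i / 2 * E i x) * E i x) - w i x * (S i x + \<nu> i * E i x)"
    proof -
      have "P_poly (c i) x = (S i x)\<^sup>2 / 2"
        using P[OF ix(1) I(1)[OF ix]] p0 by (simp add: S_def)
      then have "U' = ((S i x)\<^sup>2 / 2 - 2 * \<nu> i * x * U i x - (U i x)\<^sup>2 / 2) / (\<nu> i * (1 - x\<^sup>2))"
        unfolding U'_def by (simp only:)
      also have "\<dots> = b i x * ((S i x)\<^sup>2 / 2 - 2 * \<nu> i * x * U i x - (U i x)\<^sup>2 / 2) / \<nu> i"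
      proof -
        have "N / (\<nu> i * (1 - x\<^sup>2)) = inverse (1 - x * x) * N / \<nu> i" for N
          unfolding power2_eq_square by (simp add: divide_inverse)
        then show ?thesis unfolding b_def .
      qed
      also have "\<dots> = - (b i x * (S i x + \<nu> i / 2 * E i x) * E i x) - w i x * (S i x + \<nu> i * E i x)"
      proof -
        have "(S i x)\<^sup>2 / 2 - 2 * \<nu> i * x * (S i x + \<nu> i * E i x) - (S i x + \<nu> i * E i x)\<^sup>2 / 2
            = \<nu> i * (- ((S i x + \<nu> i / 2 * E i x) * E i x) - 2 * x * (S i x + \<nu> i * E i x))"
          by (simp add: power2_eq_square field_simps)
        then have "b i x * ((S i x)\<^sup>2 / 2 - 2 * \<nu> i * x * U i x - (U i x)\<^sup>2 / 2) / \<nu> i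
            = b i x * (- ((S i x + \<nu> i / 2 * E i x) * E i x) - 2 * x * (S i x + \<nu> i * E i x))"
          unfolding UE[OF ix(1), of x] using n(1) by simp
        also have "\<dots> = - (b i x * (S i x + \<nu> i / 2 * E i x) * E i x) - w i x * (S i x + \<nu> i * E i x)"
          unfolding w_def by (simp add: algebra_simps)
        finally show ?thesis .
      qed
      finally show ?thesis .
    qed
    ultimately show ?thesis by (simp add: v_def)
  qed
  have dv: "(v i has_real_derivative (- \<tau> i x * v i x + r i x) / \<nu> i) (at x)" if ix: "i \<in> A" "x \<in> ?I i" for i x
  proof -
    define D where "D = (- \<tau> i x * v i x + r i x) / \<nu> i"
    have "v i = (\<lambda>x. (- (b i x * (S i x + \<nu> i / 2 * E i x) * E i x) - w i x * (S i x + \<nu> i * E i x) - S1 i x) / \<nu> i)"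
      by (simp add: v_def fun_eq_iff)
    moreover have "((\<lambda>x. (- (b i x * (S i x + \<nu> i / 2 * E i x) * E i x) - w i x * (S i x + \<nu> i * E i x) - S1 i x) / \<nu> i)
        has_real_derivative D) (at x)"
      unfolding D_def \<tau>_def r_def
      by (rule quotient_eq_deriv[OF db[OF ix] dw[OF ix] dS[OF ix] dS1[OF ix] dE[OF ix]])
    ultimately have "(v i has_real_derivative D) (at x)" by simp
    then show ?thesis by (simp only: D_def)
  qed
  have tau_low: "s0 / 2 \<le> \<tau> i x" if ix: "i \<in> A" "x \<in> ?I i" for i x
  proof -
    have x: "x \<in> {-1<..<1}" by (rule I(1)[OF ix])
    have "0 < 1 - x * x" "1 - x * x \<le> 1" using one_minus_sq_pos[OF x] by (auto simp: power2_eq_square)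
    then have b1: "1 \<le> b i x" unfolding b_def by (rule one_le_inverse)
    have "- \<nu> i \<le> \<nu> i * x" using mult_left_mono[of "-1" x "\<nu> i"] x nu[OF ix(1)] by simp
    then have "s0 / 2 \<le> U i x + 2 * \<nu> i * x" using U_low[OF ix] nu[OF ix(1)] by (simp add: s0_def)
    then have "1 * (s0 / 2) \<le> b i x * (U i x + 2 * \<nu> i * x)" using b1 s0 by (intro mult_mono) auto
    then show ?thesis by (simp add: \<tau>_def UE[OF ix(1)] w_def algebra_simps)
  qed
  have sub: "unif_bdd n A ?I f \<Longrightarrow> 0 \<le> d \<Longrightarrow> unif_bdd n A (?J d) f" for n f d
    by (erule unif_bdd_subset) auto
  have len: "z \<le> y0 i + d + 2" if "i \<in> A" "0 \<le> d" for i d using y[OF that(1)] eps that by (simp add: y0_def z_def)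
  have tau_n: "unif_bdd n A (?J d) \<tau>" if "unif_bdd n A (?J d) E" "0 \<le> d" for n d
    unfolding \<tau>_def[abs_def]
    by (intro unif_bdd_add unif_bdd_mult sub[OF b] sub[OF S] sub[OF N] sub[OF w] that)
  have r_n: "unif_bdd n A (?J d) r" if "unif_bdd n A (?J d) E" "0 \<le> d" for n d
    unfolding r_def[abs_def] divide_inverse
    by (intro unif_bdd_add unif_bdd_diff unif_bdd_minus unif_bdd_mult sub[OF b] sub[OF S] sub[OF N] sub[OF w]
        sub[OF b'] sub[OF w'] sub[OF S1] sub[OF S2] sub[OF k] that)
  have v0: "unif_bdd 0 A (?J d) v" if d: "0 < d" for d
  proof (rule damped_first_bound[of A \<nu> "\<lambda>_. z" y0 "s0 / 2" \<tau>, OF _ _ _ tau_low dv])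
    have E0': "unif_bdd 0 A (?J 0) E" using E0 by simp
    show "unif_bdd 0 A ?I r" using r_n[OF E0'] by simp
    have "unif_bdd 0 A ?I (\<lambda>i x. - (b i x * (S i x + \<nu> i / 2 * E i x) * E i x) - w i x * (S i x + \<nu> i * E i x) - S1 i x)"
      unfolding divide_inverse
      by (intro unif_bdd_add unif_bdd_diff unif_bdd_minus unif_bdd_mult b S N w S1 k E0)
    then obtain M where M: "M > 0" "\<forall>i\<in>A. \<forall>x\<in>?I i.
        \<bar>- (b i x * (S i x + \<nu> i / 2 * E i x) * E i x) - w i x * (S i x + \<nu> i * E i x) - S1 i x\<bar> \<le> M"
      by (rule unif_bdd_bound)
    show "unif_bdd 0 A ?I (\<lambda>i x. \<nu> i * v i x)"
    proof (rule unif_bdd_0I)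
      fix i x assume ix: "i \<in> A" "x \<in> ?I i"
      have "\<nu> i * v i x = - (b i x * (S i x + \<nu> i / 2 * E i x) * E i x) - w i x * (S i x + \<nu> i * E i x) - S1 i x"
        using nu[OF ix(1)] by (simp add: v_def)
      then show "\<bar>\<nu> i * v i x\<bar> \<le> M" using M(2) ix by metis
    qed
  next
    show "z \<le> y0 i + 2" if "i \<in> A" for i using len[OF that, of 0] by simp
  qed (use nu s0 d in auto)
  have "unif_bdd n A (?J d) E" if "0 < d" for d
    using that
  proof (induction n arbitrary: d)
    case 0
    then show ?case by (intro sub[OF E0]) simp
  next
    case (Suc n)
    have En: "unif_bdd n A (?J (d/2)) E" by (rule Suc.IH) (use Suc.prems in simp)
    have "unif_bdd n A (\<lambda>i. {(y0 i + d/2) + d/2<..<z}) v"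
    proof (rule damped_unif_bdd[of A \<nu> "s0 / 2" "\<lambda>_. z" "\<lambda>i. y0 i + d/2" \<tau> v r])
      fix i x assume ix: "i \<in> A" "x \<in> {y0 i + d/2<..<z}"
      then have x: "x \<in> ?I i" using Suc.prems by auto
      show "s0 / 2 \<le> \<tau> i x" by (rule tau_low[OF ix(1) x])
      show "(v i has_real_derivative (- \<tau> i x * v i x + r i x) / \<nu> i) (at x)" by (rule dv[OF ix(1) x])
    next
      show "unif_bdd n A (?J (d/2)) \<tau>" by (rule tau_n[OF En]) (use Suc.prems in simp)
      show "unif_bdd n A (?J (d/2)) r" by (rule r_n[OF En]) (use Suc.prems in simp)
      show "unif_bdd 0 A (?J (d/2)) v" by (rule v0) (use Suc.prems in simp)
      show "z \<le> y0 i + d/2 + 2" if "i \<in> A" for i using len[OF that] Suc.prems by simp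
    qed (use nu s0 Suc.prems in auto)
    then have vn: "unif_bdd n A (?J d) v" by (rule unif_bdd_subset) auto
    show ?case
    proof (rule unif_bdd_SucI[OF sub[OF E0] _ vn])
      fix i x assume ix: "i \<in> A" "x \<in> ?J d i"
      then have x: "x \<in> ?I i" using Suc.prems by auto
      show "(E i has_real_derivative v i x) (at x)" by (rule dE[OF ix(1) x])
    qed (use Suc.prems in simp)
  qed
  from this[of "\<epsilon> / 2"] eps have "unif_bdd n A (?J (\<epsilon> / 2)) E" by simp
  then have "unif_bdd n A (\<lambda>i. {y i + \<epsilon><..<1 - \<epsilon>}) E"
    by (rule unif_bdd_subset) (auto simp: y0_def z_def)
  then show ?thesis by (simp add: E_def[abs_def] S_def[abs_def])
qed

lemma Cm_norm_scaled_le: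
  assumes "open S" "\<nu> > 0" "M > 0"
    and g: "\<And>j x. j \<le> m \<Longrightarrow> x \<in> S \<Longrightarrow> \<bar>(deriv ^^ j) g x\<bar> \<le> M \<and> (\<exists>d. ((deriv ^^ j) g has_real_derivative d) (at x))"
  shows "Cm_norm m S (\<lambda>x. \<nu> * g x) \<le> ennreal (real (Suc m) * M * \<nu>)"
proof -
  define f where "f x = \<nu> * g x" for x
  have main: "(\<forall>x\<in>S. (deriv ^^ j) f x = \<nu> * (deriv ^^ j) g x \<and>
       ((deriv ^^ j) f has_real_derivative \<nu> * deriv ((deriv ^^ j) g) x) (at x))" if "j \<le> m" for j
    using that
  proof (induction j)
    case 0
    show ?case
    proof
      fix x assume x: "x \<in> S"
      have "(g has_real_derivative deriv g x) (at x)" using g[of 0 x] x DERIV_imp_deriv by fastforce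
      then show "(deriv ^^ 0) f x = \<nu> * (deriv ^^ 0) g x \<and>
          ((deriv ^^ 0) f has_real_derivative \<nu> * deriv ((deriv ^^ 0) g) x) (at x)"
        unfolding f_def[abs_def] by (auto intro!: DERIV_cmult)
    qed
  next
    case (Suc j)
    have eq: "(deriv ^^ Suc j) f x = \<nu> * (deriv ^^ Suc j) g x" if "x \<in> S" for x
      using Suc.IH Suc.prems that DERIV_imp_deriv by fastforce
    show ?case
    proof
      fix x assume x: "x \<in> S"
      obtain d where d: "((deriv ^^ Suc j) g has_real_derivative d) (at x)" using g[OF Suc.prems x] by blast
      then have "((\<lambda>x. \<nu> * (deriv ^^ Suc j) g x) has_real_derivative \<nu> * d) (at x)" by (rule DERIV_cmult)
      then have "((deriv ^^ Suc j) f has_real_derivative \<nu> * d) (at x)"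
        by (rule has_field_derivative_transform_within_open[OF _ assms(1) x]) (simp only: eq)
      then show "(deriv ^^ Suc j) f x = \<nu> * (deriv ^^ Suc j) g x \<and>
          ((deriv ^^ Suc j) f has_real_derivative \<nu> * deriv ((deriv ^^ Suc j) g) x) (at x)"
        using eq[OF x] DERIV_imp_deriv[OF d] by simp
    qed
  qed
  have "Cm_on m S f"
    unfolding Cm_on_def
  proof (intro conjI allI impI ballI)
    fix j x assume "j < m" "x \<in> S"
    then show "(deriv ^^ j) f field_differentiable at x"
      using main[of j] unfolding field_differentiable_def by fastforce
  next
    show "continuous_on S ((deriv ^^ m) f)"
      using main[of m] by (intro continuous_at_imp_continuous_on ballI) (blast intro: DERIV_isCont)
  qed
  then have "Cm_norm m S f = (\<Sum>j\<le>m. SUP x\<in>S. ennreal \<bar>(deriv ^^ j) f x\<bar>)" by (simp add: Cm_norm_def)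
  also have "\<dots> \<le> (\<Sum>j\<le>m. ennreal (M * \<nu>))"
  proof (intro sum_mono SUP_least ennreal_leI)
    fix j x assume "j \<in> {..m}" "x \<in> S"
    then have "\<bar>(deriv ^^ j) f x\<bar> = \<nu> * \<bar>(deriv ^^ j) g x\<bar>" "\<bar>(deriv ^^ j) g x\<bar> \<le> M"
      using main[of j] g[of j x] assms(2) by (auto simp: abs_mult)
    then show "\<bar>(deriv ^^ j) f x\<bar> \<le> M * \<nu>" using assms(2) by simp
  qed
  also have "\<dots> = ennreal (real (Suc m) * M * \<nu>)"
    using assms(2,3) by (simp add: sum_ennreal ennreal_mult'' ennreal_of_nat_eq_real_of_nat mult.assoc)
  finally show ?thesis by (simp add: f_def[abs_def])
qed

section \<open>Sequences with vanishing viscosity\<close>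

lemma ennreal_tendsto_0_sandwich:
  assumes "\<forall>\<^sub>F k in sequentially. f k \<le> ennreal (B k)" "B \<longlonglongrightarrow> 0"
  shows "f \<longlonglongrightarrow> (0 :: ennreal)"
proof (rule tendsto_sandwich[OF _ assms(1) tendsto_const])
  show "(\<lambda>k. ennreal (B k)) \<longlonglongrightarrow> 0" using tendsto_ennrealI[OF assms(2)] by simp
qed auto

lemma vanishing_seq_limit_in_J:
  assumes "vanishing_viscosity_seq c \<nu> cs U"
  shows "c \<in> J_set 0"
proof -
  have cs: "cs \<longlonglongrightarrow> c" "\<And>k. cs k \<in> J_set 0" using assms by (auto simp: vanishing_viscosity_seq_def)
  have i: "(\<lambda>k. cs k $ i) \<longlonglongrightarrow> c $ i" for i by (rule tendsto_vec_nth[OF cs(1)])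
  have "0 \<le> c$1" "0 \<le> c$2"
    using cs(2) by (auto simp: J_set_def intro!: LIMSEQ_le_const[OF i])
  moreover have "(\<lambda>k. c3_bar (cs k $ 1) (cs k $ 2) 0) \<longlonglongrightarrow> c3_bar (c$1) (c$2) 0"
    unfolding c3_bar_def by (intro tendsto_intros i)
  then have "c3_bar (c$1) (c$2) 0 \<le> c$3"
    by (rule LIMSEQ_le[OF _ i]) (use cs(2) in \<open>auto simp: J_set_def\<close>)
  ultimately show ?thesis by (simp add: J_set_def)
qed

text \<open>Along a sequence, all the uniform estimates apply eventually with \<open>R = norm c + 1\<close>.\<close>

lemma vanishing_seq_eventually:
  assumes "vanishing_viscosity_seq c \<nu> cs U" "\<delta> > 0"
  shows "\<forall>\<^sub>F k in sequentially. norm (cs k) \<le> norm c + 1 \<and> \<nu> k \<le> \<delta> \<and> norm (cs k - c) \<le> \<delta>"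
proof -
  have cs: "cs \<longlonglongrightarrow> c" and nu: "\<nu> \<longlonglongrightarrow> 0" using assms by (auto simp: vanishing_viscosity_seq_def)
  have "\<forall>\<^sub>F k in sequentially. norm (cs k) < norm c + 1"
    by (rule order_tendstoD(2)[OF tendsto_norm[OF cs]]) simp
  moreover have "\<forall>\<^sub>F k in sequentially. \<nu> k < \<delta>"
    by (rule order_tendstoD(2)[OF nu assms(2)])
  moreover have "\<forall>\<^sub>F k in sequentially. norm (cs k - c) < \<delta>"
    using tendstoD[OF cs assms(2)] by (simp add: dist_norm)
  ultimately show ?thesis by eventually_elim auto
qed

lemma alpha_exp_le_1: "alpha_exp c \<le> 1"
  by (simp add: alpha_exp_def)

text \<open>The lower barrier holds from \<open>a k + \<epsilon>\<close> on with an error of order \<open>\<nu> / \<epsilon>\<close>. The choice \<open>\<epsilon> = sqrt (\<nu> k)\<close> makes both tend to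
  zero. To the left of this point \<open>P\<close> is small because \<open>c1 = 0\<close>, and the upper barrier forces \<open>U\<close> to be small as well. The bound is
  pointwise so that it can be reflected.\<close>

lemma nonneg_solutions_converge:
  assumes c1: "c$1 = 0" and V: "vanishing_viscosity_seq c \<nu> cs U'"
    and sol: "\<And>k. is_solution (\<nu> k) (cs k) (U k)"
    and a: "a \<longlonglongrightarrow> -1"
    and pos: "\<forall>\<^sub>F k in sequentially. -1 \<le> a k \<and> (\<forall>x\<in>{a k<..<1}. 0 \<le> U k x)"
  shows "\<exists>B. B \<longlonglongrightarrow> 0 \<and> (\<forall>\<^sub>F k in sequentially. \<forall>x\<in>{-1<..<1}. \<bar>U k x - sqrt (2 * P_poly c x)\<bar> \<le> B k)"
proof -
  define R where "R = norm c + 1"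
  have R: "1 \<le> R" "norm c \<le> R" by (auto simp: R_def)
  have nu: "\<nu> \<longlonglongrightarrow> 0" "\<And>k. \<nu> k > 0" and cs: "cs \<longlonglongrightarrow> c" "\<And>k. cs k \<in> J_set 0"
    using V by (auto simp: vanishing_viscosity_seq_def)
  have cJ: "c \<in> J_set 0" by (rule vanishing_seq_limit_in_J[OF V])
  define \<eta> where "\<eta> k = norm (cs k - c)" for k
  have eta: "\<eta> \<longlonglongrightarrow> 0" unfolding \<eta>_def using tendsto_norm[OF LIM_zero[OF cs(1)]] by simp
  have snu: "(\<lambda>k. sqrt (\<nu> k)) \<longlonglongrightarrow> 0" using tendsto_real_sqrt[OF nu(1)] by simp
  define B1 where "B1 k = sqrt (2 * ((100 * R + 10 * R / sqrt (\<nu> k)) * \<nu> k) + 2 * (5 * \<eta> k))" for k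
  define B2 where "B2 k = 2 * sqrt (2 * (3 * R * (1 + (a k + sqrt (\<nu> k)))) + 10 * \<eta> k + 200 * R * \<nu> k)" for k
  have B1: "B1 \<longlonglongrightarrow> 0"
  proof -
    have e: "(100 * R + 10 * R / sqrt (\<nu> k)) * \<nu> k = 100 * R * \<nu> k + 10 * R * sqrt (\<nu> k)" for k
    proof -
      have "10 * R / sqrt (\<nu> k) * \<nu> k = 10 * R * (\<nu> k / sqrt (\<nu> k))" by simp
      also have "\<nu> k / sqrt (\<nu> k) = sqrt (\<nu> k)" using nu(2)[of k] real_div_sqrt by simp
      finally show ?thesis by (simp add: distrib_right)
    qed
    have "(\<lambda>k. sqrt (2 * (100 * R * \<nu> k + 10 * R * sqrt (\<nu> k)) + 2 * (5 * \<eta> k)))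
        \<longlonglongrightarrow> sqrt (2 * (100 * R * 0 + 10 * R * 0) + 2 * (5 * 0))"
      by (intro tendsto_intros nu snu eta)
    then show ?thesis by (simp add: B1_def[abs_def] e)
  qed
  have B2: "B2 \<longlonglongrightarrow> 0"
  proof -
    have "(\<lambda>k. 2 * sqrt (2 * (3 * R * (1 + (a k + sqrt (\<nu> k)))) + 10 * \<eta> k + 200 * R * \<nu> k))
        \<longlonglongrightarrow> 2 * sqrt (2 * (3 * R * (1 + (-1 + 0))) + 10 * 0 + 200 * R * 0)"
      by (intro tendsto_intros nu snu eta a)
    then show ?thesis by (simp add: B2_def[abs_def])
  qed
  have "(\<lambda>k. \<bar>B1 k\<bar> + \<bar>B2 k\<bar>) \<longlonglongrightarrow> 0"
    using tendsto_add[OF tendsto_rabs_zero[OF B1] tendsto_rabs_zero[OF B2]] by simp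
  moreover have "\<forall>\<^sub>F k in sequentially. \<forall>x\<in>{-1<..<1}. \<bar>U k x - sqrt (2 * P_poly c x)\<bar> \<le> \<bar>B1 k\<bar> + \<bar>B2 k\<bar>"
    using vanishing_seq_eventually[OF V zero_less_one] pos
  proof eventually_elim
    case (elim k)
    show ?case
    proof
      fix x :: real assume x: "x \<in> {-1<..<1}"
      have Rk: "norm (cs k) \<le> R" and nuk: "\<nu> k \<le> 1" using elim by (auto simp: R_def)
      have Pc: "\<bar>P_poly (cs k) x - P_poly c x\<bar> \<le> 5 * \<eta> k" unfolding \<eta>_def by (rule P_poly_close[OF x])
      have Pc0: "0 \<le> P_poly c x" using P_poly_nonneg[OF cJ, of x] x by simp
      show "\<bar>U k x - sqrt (2 * P_poly c x)\<bar> \<le> \<bar>B1 k\<bar> + \<bar>B2 k\<bar>"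
      proof (cases "a k + sqrt (\<nu> k) < x")
        case True
        have sq: "sqrt (\<nu> k) > 0" using nu by simp
        then have "a k < x" using True by linarith
        then have "x \<in> {a k<..<1}" using x by simp
        then have U0: "0 \<le> U k x" using elim by blast
        have "\<bar>(1/2) * (U k x)\<^sup>2 - P_poly (cs k) x\<bar> \<le> (100 * R + 10 * R / sqrt (\<nu> k)) * \<nu> k"
          by (rule residual_bound_right[OF sol cs(2) Rk R(1) nu(2) nuk, of "a k"])
             (use elim True x sq in auto)
        then have "\<bar>U k x - sqrt (2 * P_poly c x)\<bar> \<le> B1 k"
          unfolding B1_def by (rule abs_diff_sqrt_le[OF U0 Pc0 _ Pc])
        then show ?thesis by linarith
      next
        case False
        have "P_poly c x = (1 + x) * (c$2 + c$3 * (1 - x))"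
          using c1 by (simp add: P_poly_def power2_eq_square algebra_simps)
        also have "\<dots> \<le> (1 + x) * (3 * R)"
        proof (rule mult_left_mono)
          have c: "\<bar>c$i\<bar> \<le> R" for i using component_le_norm_cart[of c i] R by linarith
          have "c$3 * (1 - x) \<le> \<bar>c$3\<bar> * (1 - x)" using x by (intro mult_right_mono) auto
          also have "\<dots> \<le> R * 2" using c x R by (intro mult_mono) auto
          finally show "c$2 + c$3 * (1 - x) \<le> 3 * R" using abs_le_D1[OF c, of 2] by linarith
        qed (use x in auto)
        also have "\<dots> \<le> (1 + (a k + sqrt (\<nu> k))) * (3 * R)" using False R by (intro mult_right_mono) auto
        finally have Pub: "P_poly c x \<le> 3 * R * (1 + (a k + sqrt (\<nu> k)))" by (simp add: mult.commute)
        have nn: "0 \<le> \<eta> k" "0 \<le> R * \<nu> k" using R nu(2)[of k] by (auto simp: \<eta>_def)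
        have "(U k x)\<^sup>2 \<le> 2 * P_poly (cs k) x + 200 * R * \<nu> k"
          by (rule solution_sq_upper[OF sol cs(2) Rk R(1) nu(2) nuk x])
        also have "\<dots> \<le> 2 * (3 * R * (1 + (a k + sqrt (\<nu> k)))) + 10 * \<eta> k + 200 * R * \<nu> k"
          using Pc Pub by (auto simp: abs_le_iff)
        finally have "\<bar>U k x\<bar>\<^sup>2 \<le> 2 * (3 * R * (1 + (a k + sqrt (\<nu> k)))) + 10 * \<eta> k + 200 * R * \<nu> k" by simp
        from real_le_rsqrt[OF this] have "\<bar>U k x\<bar> \<le> B2 k / 2" unfolding B2_def by simp
        moreover have "sqrt (2 * P_poly c x) \<le> B2 k / 2"
          unfolding B2_def using Pub nn by simp
        moreover have "0 \<le> sqrt (2 * P_poly c x)" using Pc0 by simp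
        ultimately show ?thesis by linarith
      qed
    qed
  qed
  ultimately show ?thesis by blast
qed

lemma interior_J_positive:
  assumes "c \<in> interior (J_set 0)"
  shows "c$1 > 0" "c$2 > 0" "c$3 > c3_star (c$1) (c$2)"
proof -
  obtain e where e: "e > 0" "ball c e \<subseteq> J_set 0" using assms mem_interior by blast
  have J: "c - (e/2) *\<^sub>R axis i 1 \<in> J_set 0" for i :: 3
    using e by (intro subsetD[OF e(2)]) (simp add: dist_norm)
  have i: "(1::3) \<noteq> 2" "(1::3) \<noteq> 3" "(2::3) \<noteq> 3" by auto
  show "c$1 > 0" using J[of 1] e(1) by (simp add: J_set_def)
  show "c$2 > 0" using J[of 2] e(1) by (simp add: J_set_def)
  show "c$3 > c3_star (c$1) (c$2)" using J[of 3] e(1) i by (simp add: J_set_def c3_star_def axis_def)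
qed

lemma interior_P_lower:
  assumes "c \<in> interior (J_set 0)"
  obtains p where "p > 0" "\<And>x. x \<in> {-1..1} \<Longrightarrow> 2 * p \<le> P_poly c x"
proof -
  note pos = interior_J_positive[OF assms]
  have J: "c \<in> J_set 0" using assms interior_subset by blast
  have P: "0 < P_poly c x" if x: "x \<in> {-1..1}" for x
  proof (cases "x = 1 \<or> x = -1")
    case True
    then show ?thesis using pos by (auto simp: P_poly_def)
  next
    case False
    then have "x \<in> {-1<..<1}" using x by auto
    from one_minus_sq_pos[OF this] show ?thesis
      unfolding P_poly_split[OF J] using pos(3) by (intro add_nonneg_pos) auto
  qed
  have "\<exists>x\<in>{-1..1}. \<forall>y\<in>{-1..1}. P_poly c x \<le> P_poly c (y::real)"
    by (rule continuous_attains_inf) (auto intro: P_poly_continuous)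
  then obtain x0 where "x0 \<in> {-1..1}" "\<And>y. y \<in> {-1..1} \<Longrightarrow> P_poly c x0 \<le> P_poly c y" by blast
  then show ?thesis using P[of x0] by (intro that[of "P_poly c x0 / 2"]) auto
qed

lemma nonvanishing_sign:
  assumes "is_solution \<nu> c U" "\<forall>y\<in>{-1<..<1}. U y \<noteq> 0"
  shows "(\<forall>y\<in>{-1<..<1}. U y > 0) \<or> (\<forall>y\<in>{-1<..<1}. U y < 0)"
proof (rule ccontr)
  assume "\<not> ?thesis"
  then obtain x y where xy: "x \<in> {-1<..<1}" "U x \<le> 0" "y \<in> {-1<..<1}" "0 \<le> U y" by force
  have "connected (U ` {-1<..<1})"
    by (intro connected_continuous_image solution_continuous[OF assms(1)]) simp
  then have "0 \<in> U ` {-1<..<1}"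
    using xy unfolding connected_iff_interval by blast
  then show False using assms(2) by force
qed

text \<open>A solution without zeros has a fixed sign and is therefore extremal as soon as \<open>32 \<nu>\<^sup>2\<close> is below \<open>c1\<close> and \<open>c2\<close>.\<close>

lemma eventually_zero_exists:
  assumes V: "vanishing_viscosity_seq c \<nu> cs U" and c: "c$1 > 0" "c$2 > 0"
  shows "\<forall>\<^sub>F k in sequentially. \<exists>y\<in>{-1<..<1}. U k y = 0"
proof -
  have nu: "\<nu> \<longlonglongrightarrow> 0" and cs: "cs \<longlonglongrightarrow> c" using V by (auto simp: vanishing_viscosity_seq_def)
  have "\<forall>\<^sub>F k in sequentially. 32 * (\<nu> k)\<^sup>2 < cs k $ i" if "c $ i > 0" for i
  proof -
    have "(\<lambda>k. cs k $ i - 32 * (\<nu> k)\<^sup>2) \<longlonglongrightarrow> c $ i - 32 * 0\<^sup>2"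
      by (intro tendsto_intros tendsto_vec_nth cs nu)
    then have "\<forall>\<^sub>F k in sequentially. 0 < cs k $ i - 32 * (\<nu> k)\<^sup>2"
      by (rule order_tendstoD) (use that in simp)
    then show ?thesis by eventually_elim simp
  qed
  from this[OF c(1)] this[OF c(2)] vanishing_seq_eventually[OF V zero_less_one] show ?thesis
  proof eventually_elim
    case (elim k)
    have k: "is_solution (\<nu> k) (cs k) (U k)" "cs k \<in> J_set 0" "0 < \<nu> k"
      "\<not> is_greatest_solution (\<nu> k) (cs k) (U k)" "\<not> is_least_solution (\<nu> k) (cs k) (U k)"
      using V by (auto simp: vanishing_viscosity_seq_def)
    have "\<not> (\<forall>y\<in>{-1<..<1}. 0 < U k y)"
    proof
      assume "\<forall>y\<in>{-1<..<1}. 0 < U k y"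
      then have "is_greatest_solution (\<nu> k) (cs k) (U k)"
        by (intro positive_solution_greatest[OF k(1-3)]) (use elim in auto)
      then show False using k(4) by simp
    qed
    moreover have "\<not> (\<forall>y\<in>{-1<..<1}. U k y < 0)"
    proof
      assume "\<forall>y\<in>{-1<..<1}. U k y < 0"
      then have "is_least_solution (\<nu> k) (cs k) (U k)"
        by (intro negative_solution_least[OF k(1-3)]) (use elim in auto)
      then show False using k(5) by simp
    qed
    ultimately show ?case using nonvanishing_sign[OF k(1)] by blast
  qed
qed

lemma conv_a_if_nonneg:
  assumes c1: "c$1 = 0" and V: "vanishing_viscosity_seq c \<nu> cs U'"
    and sol: "\<And>k. is_solution (\<nu> k) (cs k) (U k)"
    and a: "a \<longlonglongrightarrow> -1"
    and pos: "\<forall>\<^sub>F k in sequentially. -1 \<le> a k \<and> (\<forall>x\<in>{a k<..<1}. 0 \<le> U k x)"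
  shows "conv_a c U"
proof -
  obtain B where B: "B \<longlonglongrightarrow> 0"
    "\<forall>\<^sub>F k in sequentially. \<forall>x\<in>{-1<..<1}. \<bar>U k x - sqrt (2 * P_poly c x)\<bar> \<le> B k"
    using nonneg_solutions_converge[OF assms] by blast
  show ?thesis unfolding conv_a_def
  proof (rule ennreal_tendsto_0_sandwich[OF _ B(1)])
    show "\<forall>\<^sub>F k in sequentially. Linf_norm {-1<..<1} (\<lambda>y. U k y - sqrt (2 * P_poly c y)) \<le> ennreal (B k)"
      using B(2)
    proof eventually_elim
      case (elim k)
      show ?case
        by (rule Linf_norm_le) (use elim in \<open>auto intro!: continuous_intros P_poly_continuous solution_continuous[OF sol]\<close>)
    qed
  qed
qed

lemma vanishing_seq_reflect:
  assumes V: "vanishing_viscosity_seq c \<nu> cs U"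
  shows "vanishing_viscosity_seq (reflect_c c) \<nu> (\<lambda>k. reflect_c (cs k)) (\<lambda>k. reflect_U (U k))"
proof -
  have nu: "0 < \<nu> k" for k using V by (simp add: vanishing_viscosity_seq_def)
  have "norm (reflect_c (cs k) - reflect_c c) = norm (cs k - c)" for k by (simp add: reflect_c_diff)
  then have "(\<lambda>k. reflect_c (cs k)) \<longlonglongrightarrow> reflect_c c"
    using V by (simp add: vanishing_viscosity_seq_def LIMSEQ_iff)
  moreover have "is_solution (\<nu> k) (reflect_c (cs k)) (reflect_U (U k)) \<and>
      \<not> is_greatest_solution (\<nu> k) (reflect_c (cs k)) (reflect_U (U k)) \<and>
      \<not> is_least_solution (\<nu> k) (reflect_c (cs k)) (reflect_U (U k))" for k
    using V nu[of k] least_if_reflect_greatest[of "\<nu> k" "cs k" "U k"]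
      greatest_if_reflect_least[of "\<nu> k" "cs k" "U k"] solution_reflect[of "\<nu> k" "cs k" "U k"]
    unfolding vanishing_viscosity_seq_def by blast
  ultimately show ?thesis
    using V J_set_reflect unfolding vanishing_viscosity_seq_def by blast
qed

lemma conv_b_if_nonpos:
  assumes c2: "c$2 = 0" and V: "vanishing_viscosity_seq c \<nu> cs U'"
    and sol: "\<And>k. is_solution (\<nu> k) (cs k) (U k)"
    and a: "a \<longlonglongrightarrow> 1"
    and neg: "\<forall>\<^sub>F k in sequentially. a k \<le> 1 \<and> (\<forall>x\<in>{-1<..<a k}. U k x \<le> 0)"
  shows "conv_b c U"
proof -
  have nu: "0 < \<nu> k" for k using V by (simp add: vanishing_viscosity_seq_def)
  have "\<exists>B. B \<longlonglongrightarrow> 0 \<and> (\<forall>\<^sub>F k in sequentially. \<forall>x\<in>{-1<..<1}.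
      \<bar>reflect_U (U k) x - sqrt (2 * P_poly (reflect_c c) x)\<bar> \<le> B k)"
  proof (rule nonneg_solutions_converge[OF _ vanishing_seq_reflect[OF V], of _ "\<lambda>k. - a k"])
    show "is_solution (\<nu> k) (reflect_c (cs k)) (reflect_U (U k))" for k
      by (rule solution_reflect[OF sol nu])
    show "(\<lambda>k. - a k) \<longlonglongrightarrow> -1" by (rule tendsto_minus[OF a])
    show "\<forall>\<^sub>F k in sequentially. -1 \<le> - a k \<and> (\<forall>x\<in>{- a k<..<1}. 0 \<le> reflect_U (U k) x)"
      using neg by eventually_elim (auto simp: reflect_U_def)
  qed (use c2 in simp)
  then obtain B where B: "B \<longlonglongrightarrow> 0" "\<forall>\<^sub>F k in sequentially. \<forall>x\<in>{-1<..<1}.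
      \<bar>reflect_U (U k) x - sqrt (2 * P_poly (reflect_c c) x)\<bar> \<le> B k" by blast
  show ?thesis unfolding conv_b_def
  proof (rule ennreal_tendsto_0_sandwich[OF _ B(1)])
    show "\<forall>\<^sub>F k in sequentially. Linf_norm {-1<..<1} (\<lambda>y. U k y + sqrt (2 * P_poly c y)) \<le> ennreal (B k)"
      using B(2)
    proof eventually_elim
      case (elim k)
      show ?case
      proof (rule Linf_norm_le)
        fix x :: real assume "x \<in> {-1<..<1}"
        then have "- x \<in> {-1<..<1}" by simp
        with elim have "\<bar>reflect_U (U k) (- x) - sqrt (2 * P_poly (reflect_c c) (- x))\<bar> \<le> B k" by blast
        then show "\<bar>U k x + sqrt (2 * P_poly c x)\<bar> \<le> B k" by (simp add: reflect_U_def)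
      qed (auto intro!: continuous_intros P_poly_continuous solution_continuous[OF sol])
    qed
  qed
qed

text \<open>The index set \<open>A\<close> collects all admissible data, so that the bounds for families become constants that depend only on
  \<open>c\<close>, \<open>\<epsilon>\<close> and \<open>m\<close>. The left side is the family of reflected solutions, reflected back.\<close>

lemma interior_estimates:
  assumes c: "c \<in> interior (J_set 0)" and eps: "\<epsilon> > 0"
  obtains C \<delta> where "C > 0" "\<delta> > 0"
    "\<forall>\<nu> d U z. 0 < \<nu> \<and> \<nu> \<le> \<delta> \<and> d \<in> J_set 0 \<and> norm d \<le> norm c + 1 \<and> norm (d - c) \<le> \<delta> \<and>
       is_solution \<nu> d U \<and> z \<in> {-1<..<1} \<and> U z = 0 \<longrightarrow>
       Linf_norm {-1<..<z - \<epsilon>} (\<lambda>y. U y + sqrt (2 * P_poly d y))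
         + Linf_norm {z + \<epsilon><..<1} (\<lambda>y. U y - sqrt (2 * P_poly d y)) \<le> ennreal (C * \<nu>) \<and>
       Cm_norm m {-1 + \<epsilon><..<z - \<epsilon>} (\<lambda>y. U y + sqrt (2 * P_poly d y))
         + Cm_norm m {z + \<epsilon><..<1 - \<epsilon>} (\<lambda>y. U y - sqrt (2 * P_poly d y)) \<le> ennreal (C * \<nu>)"
proof -
  obtain p where p: "p > 0" "\<And>x. x \<in> {-1..1} \<Longrightarrow> 2 * p \<le> P_poly c x" using interior_P_lower[OF c] by blast
  define R where "R = norm c + 1"
  have R: "1 \<le> R" by (simp add: R_def)
  define K where "K = 100 * R + 10 * R / (\<epsilon> / 2)"
  define K' where "K' = 100 * R + 10 * R / \<epsilon>"
  have K: "K > 0" "K' > 0" using R eps by (auto simp: K_def K'_def add_pos_nonneg)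
  (* The bound p / 5 keeps P above p for nearby data; the others are the smallness conditions on nu. *)
  define \<delta> where "\<delta> = min (min 1 (p / 5)) (min (p / (2 * K)) (sqrt p / 4))"
  have \<delta>: "\<delta> > 0" using p K by (simp add: \<delta>_def)
  define A where "A = {(\<nu>, d, U, z). 0 < \<nu> \<and> \<nu> \<le> \<delta> \<and> d \<in> J_set 0 \<and> norm d \<le> R \<and> norm (d - c) \<le> \<delta> \<and>
       is_solution \<nu> d U \<and> z \<in> {-1<..<1::real} \<and> U z = 0}"
  have P: "p \<le> P_poly d x" if "norm (d - c) \<le> \<delta>" "x \<in> {-1<..<1}" for d x
  proof -
    have "\<bar>P_poly d x - P_poly c x\<bar> \<le> 5 * norm (d - c)" by (rule P_poly_close[OF that(2)])
    also have "\<dots> \<le> p" using that(1) by (simp add: \<delta>_def)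
    finally show ?thesis using p(2)[of x] that(2) by (auto simp: abs_le_iff)
  qed
  have small: "\<nu> \<le> 1 \<and> 2 * K * \<nu> \<le> p \<and> 4 * \<nu> \<le> sqrt p" if "\<nu> \<le> \<delta>" for \<nu>
  proof -
    have "\<nu> \<le> p / (2 * K)" using that by (simp add: \<delta>_def)
    then show ?thesis using that K by (simp add: \<delta>_def field_simps)
  qed
  have nonneg: "0 \<le> U x" if "(\<nu>, d, U, z) \<in> A" "x \<in> {z<..<1}" for \<nu> d U z x
    using that solution_nonneg_right_of_zero[of \<nu> d U z x] unfolding A_def by auto
  have reflA: "(\<nu>, reflect_c d, reflect_U U, - z) \<in> {(\<nu>, d, U, z). 0 < \<nu> \<and> \<nu> \<le> \<delta> \<and> d \<in> J_set 0 \<and> norm d \<le> R \<and>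
       is_solution \<nu> d U \<and> z \<in> {-1<..<1::real} \<and> U z = 0}" if "(\<nu>, d, U, z) \<in> A" for \<nu> d U z
    using that by (auto simp: A_def reflect_U_def intro: J_set_reflect solution_reflect)
  have nonneg': "0 \<le> reflect_U U x" if "(\<nu>, d, U, z) \<in> A" "x \<in> {- z<..<1}" for \<nu> d U z x
    using reflA[OF that(1)] that(2) solution_nonneg_right_of_zero[of \<nu> "reflect_c d" "reflect_U U" "- z" x] by auto
  have right: "unif_bdd (Suc m) A (\<lambda>i. {snd (snd (snd i)) + \<epsilon><..<1 - \<epsilon>})
      (\<lambda>i x. (fst (snd (snd i)) x - sqrt (2 * P_poly (fst (snd i)) x)) / fst i)"
  proof (rule deviation_quotient_unif_bdd[OF R eps p(1) K_def])
    fix i assume i: "i \<in> A"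
    obtain \<nu> d U z where [simp]: "i = (\<nu>, d, U, z)" by (cases i)
    show "0 < fst i \<and> fst i \<le> 1 \<and> 2 * K * fst i \<le> p \<and> 4 * fst i \<le> sqrt p" using i small by (auto simp: A_def)
    show "fst (snd i) \<in> J_set 0 \<and> norm (fst (snd i)) \<le> R" "is_solution (fst i) (fst (snd i)) (fst (snd (snd i)))"
      "-1 \<le> snd (snd (snd i))" using i by (auto simp: A_def)
    show "0 \<le> fst (snd (snd i)) x" if "x \<in> {snd (snd (snd i))<..<1}" for x
      using nonneg i that by auto
    show "p \<le> P_poly (fst (snd i)) x" if "x \<in> {-1<..<1}" for x using i P[OF _ that] by (auto simp: A_def)
  qed
  have left: "unif_bdd (Suc m) A (\<lambda>i. {- snd (snd (snd i)) + \<epsilon><..<1 - \<epsilon>})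
      (\<lambda>i x. (reflect_U (fst (snd (snd i))) x - sqrt (2 * P_poly (reflect_c (fst (snd i))) x)) / fst i)"
  proof (rule deviation_quotient_unif_bdd[OF R eps p(1) K_def])
    fix i assume i: "i \<in> A"
    obtain \<nu> d U z where [simp]: "i = (\<nu>, d, U, z)" by (cases i)
    show "0 < fst i \<and> fst i \<le> 1 \<and> 2 * K * fst i \<le> p \<and> 4 * fst i \<le> sqrt p" using i small by (auto simp: A_def)
    show "reflect_c (fst (snd i)) \<in> J_set 0 \<and> norm (reflect_c (fst (snd i))) \<le> R"
      "is_solution (fst i) (reflect_c (fst (snd i))) (reflect_U (fst (snd (snd i))))"
      "-1 \<le> - snd (snd (snd i))" using i reflA[of \<nu> d U z] by auto
    show "0 \<le> reflect_U (fst (snd (snd i))) x" if "x \<in> {- snd (snd (snd i))<..<1}" for x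
      using nonneg' i that by auto
    show "p \<le> P_poly (reflect_c (fst (snd i))) x" if "x \<in> {-1<..<1}" for x
      using i P[of d "- x"] that by (auto simp: A_def)
  qed
  have "unif_bdd (Suc m) A (\<lambda>i. {-1 + \<epsilon><..<snd (snd (snd i)) - \<epsilon>})
      (\<lambda>i x. - ((reflect_U (fst (snd (snd i))) (- x) - sqrt (2 * P_poly (reflect_c (fst (snd i))) (- x))) / fst i))"
    by (intro unif_bdd_minus unif_bdd_reflect[OF left]) auto
  moreover have "- ((reflect_U U (- x) - sqrt (2 * P_poly (reflect_c d) (- x))) / \<nu>)
      = (U x + sqrt (2 * P_poly d x)) / \<nu>" for U d x \<nu>
    by (simp add: reflect_U_def minus_divide_left)
  ultimately have left': "unif_bdd (Suc m) A (\<lambda>i. {-1 + \<epsilon><..<snd (snd (snd i)) - \<epsilon>})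
      (\<lambda>i x. (fst (snd (snd i)) x + sqrt (2 * P_poly (fst (snd i)) x)) / fst i)"
    by (simp only:)
  obtain M1 where M1: "M1 > 0" "\<forall>i\<in>A. \<forall>j\<le>m. \<forall>x\<in>{snd (snd (snd i)) + \<epsilon><..<1 - \<epsilon>}.
      \<bar>(deriv ^^ j) (\<lambda>x. (fst (snd (snd i)) x - sqrt (2 * P_poly (fst (snd i)) x)) / fst i) x\<bar> \<le> M1 \<and>
      (\<exists>d. ((deriv ^^ j) (\<lambda>x. (fst (snd (snd i)) x - sqrt (2 * P_poly (fst (snd i)) x)) / fst i) has_real_derivative d) (at x))"
    by (rule unif_bdd_deriv_bounds[OF right]) auto
  obtain M2 where M2: "M2 > 0" "\<forall>i\<in>A. \<forall>j\<le>m. \<forall>x\<in>{-1 + \<epsilon><..<snd (snd (snd i)) - \<epsilon>}.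
      \<bar>(deriv ^^ j) (\<lambda>x. (fst (snd (snd i)) x + sqrt (2 * P_poly (fst (snd i)) x)) / fst i) x\<bar> \<le> M2 \<and>
      (\<exists>d. ((deriv ^^ j) (\<lambda>x. (fst (snd (snd i)) x + sqrt (2 * P_poly (fst (snd i)) x)) / fst i) has_real_derivative d) (at x))"
    by (rule unif_bdd_deriv_bounds[OF left']) auto
  define C1 where "C1 = 2 * K' / sqrt p"
  have C1: "C1 \<ge> 0" using K p by (simp add: C1_def)
  define C2 where "C2 = real (Suc m) * M1 + real (Suc m) * M2"
  have C2: "C2 > 0" using M1(1) M2(1) by (simp add: C2_def add_pos_pos)
  show ?thesis
  proof (rule that[of "2 * C1 + C2" \<delta>])
    show "0 < 2 * C1 + C2" "0 < \<delta>" using C1 C2 \<delta> by simp_all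
  next
    show "\<forall>\<nu> d U z. 0 < \<nu> \<and> \<nu> \<le> \<delta> \<and> d \<in> J_set 0 \<and> norm d \<le> norm c + 1 \<and> norm (d - c) \<le> \<delta> \<and>
       is_solution \<nu> d U \<and> z \<in> {-1<..<1} \<and> U z = 0 \<longrightarrow>
       Linf_norm {-1<..<z - \<epsilon>} (\<lambda>y. U y + sqrt (2 * P_poly d y))
         + Linf_norm {z + \<epsilon><..<1} (\<lambda>y. U y - sqrt (2 * P_poly d y)) \<le> ennreal ((2 * C1 + C2) * \<nu>) \<and>
       Cm_norm m {-1 + \<epsilon><..<z - \<epsilon>} (\<lambda>y. U y + sqrt (2 * P_poly d y))
         + Cm_norm m {z + \<epsilon><..<1 - \<epsilon>} (\<lambda>y. U y - sqrt (2 * P_poly d y)) \<le> ennreal ((2 * C1 + C2) * \<nu>)"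
    proof (intro allI impI)
      fix \<nu> d U z
      assume "0 < \<nu> \<and> \<nu> \<le> \<delta> \<and> d \<in> J_set 0 \<and> norm d \<le> norm c + 1 \<and> norm (d - c) \<le> \<delta> \<and>
         is_solution \<nu> d U \<and> z \<in> {-1<..<1} \<and> U z = 0"
      then have nu: "0 < \<nu>" "\<nu> \<le> \<delta>" and d: "d \<in> J_set 0" "norm d \<le> norm c + 1" "norm (d - c) \<le> \<delta>"
        and sol: "is_solution \<nu> d U" and z: "z \<in> {-1<..<1}" "U z = 0" by auto
      have iA: "(\<nu>, d, U, z) \<in> A" using nu d sol z by (auto simp: A_def R_def)
      have nu1: "\<nu> \<le> 1" using small[OF nu(2)] by simp
      have dR: "norm d \<le> R" using d by (simp add: R_def)
      note res = residual_bound_zero[OF sol d(1) dR R nu(1) nu1 z eps]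
      have Uc: "continuous_on {-1<..<1} U" by (rule solution_continuous[OF sol])
      have L1: "Linf_norm {z + \<epsilon><..<1} (\<lambda>y. U y - sqrt (2 * P_poly d y)) \<le> ennreal (C1 * \<nu>)"
      proof (rule Linf_norm_le)
        show "continuous_on {z + \<epsilon><..<1} (\<lambda>y. U y - sqrt (2 * P_poly d y))"
          using z eps by (intro continuous_intros P_poly_continuous continuous_on_subset[OF Uc]) auto
        fix x assume x: "x \<in> {z + \<epsilon><..<1}"
        then have "x \<in> {-1<..<1}" using z eps by auto
        then have "\<bar>U x - sqrt (2 * P_poly d x)\<bar> \<le> 2 * (K' * \<nu>) / sqrt p"
          using res(1)[OF x] unfolding K'_def by (intro deviation_bound p(1) P[OF d(3)]) auto
        then show "\<bar>U x - sqrt (2 * P_poly d x)\<bar> \<le> C1 * \<nu>" by (simp add: C1_def)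
      qed simp
      have L2: "Linf_norm {-1<..<z - \<epsilon>} (\<lambda>y. U y + sqrt (2 * P_poly d y)) \<le> ennreal (C1 * \<nu>)"
      proof (rule Linf_norm_le)
        show "continuous_on {-1<..<z - \<epsilon>} (\<lambda>y. U y + sqrt (2 * P_poly d y))"
          using z eps by (intro continuous_intros P_poly_continuous continuous_on_subset[OF Uc]) auto
        fix x assume x: "x \<in> {-1<..<z - \<epsilon>}"
        then have "x \<in> {-1<..<1}" using z eps by auto
        then have "\<bar>- U x - sqrt (2 * P_poly d x)\<bar> \<le> 2 * (K' * \<nu>) / sqrt p"
          using res(2)[OF x] unfolding K'_def by (intro deviation_bound p(1) P[OF d(3)]) auto
        then show "\<bar>U x + sqrt (2 * P_poly d x)\<bar> \<le> C1 * \<nu>" by (simp add: C1_def)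
      qed simp
      have cancel: "(\<lambda>x. \<nu> * (f x / \<nu>)) = f" for f :: "real \<Rightarrow> real" using nu by simp
      have M: "Cm_norm m {z + \<epsilon><..<1 - \<epsilon>} (\<lambda>y. U y - sqrt (2 * P_poly d y)) \<le> ennreal (real (Suc m) * M1 * \<nu>)"
        "Cm_norm m {-1 + \<epsilon><..<z - \<epsilon>} (\<lambda>y. U y + sqrt (2 * P_poly d y)) \<le> ennreal (real (Suc m) * M2 * \<nu>)"
      proof -
        have "Cm_norm m {z + \<epsilon><..<1 - \<epsilon>} (\<lambda>x. \<nu> * ((U x - sqrt (2 * P_poly d x)) / \<nu>)) \<le> ennreal (real (Suc m) * M1 * \<nu>)"
          using bspec[OF M1(2) iA] by (intro Cm_norm_scaled_le nu M1(1)) simp_all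
        then show "Cm_norm m {z + \<epsilon><..<1 - \<epsilon>} (\<lambda>y. U y - sqrt (2 * P_poly d y)) \<le> ennreal (real (Suc m) * M1 * \<nu>)"
          unfolding cancel .
        have "Cm_norm m {-1 + \<epsilon><..<z - \<epsilon>} (\<lambda>x. \<nu> * ((U x + sqrt (2 * P_poly d x)) / \<nu>)) \<le> ennreal (real (Suc m) * M2 * \<nu>)"
          using bspec[OF M2(2) iA] by (intro Cm_norm_scaled_le nu M2(1)) simp_all
        then show "Cm_norm m {-1 + \<epsilon><..<z - \<epsilon>} (\<lambda>y. U y + sqrt (2 * P_poly d y)) \<le> ennreal (real (Suc m) * M2 * \<nu>)"
          unfolding cancel .
      qed
      have "ennreal (C1 * \<nu>) + ennreal (C1 * \<nu>) \<le> ennreal ((2 * C1 + C2) * \<nu>)"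
        using C1 C2 nu by (subst ennreal_plus[symmetric]) (auto intro!: ennreal_leI simp: algebra_simps)
      moreover have "ennreal (real (Suc m) * M2 * \<nu>) + ennreal (real (Suc m) * M1 * \<nu>) \<le> ennreal ((2 * C1 + C2) * \<nu>)"
        using C1 M1(1) M2(1) nu unfolding C2_def
        by (subst ennreal_plus[symmetric]) (auto intro!: ennreal_leI simp: algebra_simps)
      ultimately show "Linf_norm {-1<..<z - \<epsilon>} (\<lambda>y. U y + sqrt (2 * P_poly d y))
           + Linf_norm {z + \<epsilon><..<1} (\<lambda>y. U y - sqrt (2 * P_poly d y)) \<le> ennreal ((2 * C1 + C2) * \<nu>) \<and>
         Cm_norm m {-1 + \<epsilon><..<z - \<epsilon>} (\<lambda>y. U y + sqrt (2 * P_poly d y))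
           + Cm_norm m {z + \<epsilon><..<1 - \<epsilon>} (\<lambda>y. U y - sqrt (2 * P_poly d y)) \<le> ennreal ((2 * C1 + C2) * \<nu>)"
        using add_mono[OF L2 L1] add_mono[OF M(2) M(1)] by (meson order_trans)
    qed
  qed
qed

lemma uniform_convergence_away_from_zero:
  assumes V: "vanishing_viscosity_seq c \<nu> cs U" and x: "zero_seq U x" and eps: "\<epsilon> > 0"
  shows "(\<lambda>k. Linf_norm {-1<..<x k - \<epsilon>} (\<lambda>y. U k y + sqrt (2 * P_poly c y))
            + Linf_norm {x k + \<epsilon><..<1} (\<lambda>y. U k y - sqrt (2 * P_poly c y))) \<longlonglongrightarrow> 0"
proof -
  define R where "R = norm c + 1"
  have R: "1 \<le> R" by (simp add: R_def)
  define K where "K = 100 * R + 10 * R / \<epsilon>"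
  define B where "B k = sqrt (2 * (K * \<nu> k) + 2 * (5 * norm (cs k - c)))" for k
  have nu: "\<nu> \<longlonglongrightarrow> 0" "\<And>k. \<nu> k > 0" and cs: "cs \<longlonglongrightarrow> c" "\<And>k. cs k \<in> J_set 0"
    and sol: "\<And>k. is_solution (\<nu> k) (cs k) (U k)"
    using V by (auto simp: vanishing_viscosity_seq_def)
  have cJ: "c \<in> J_set 0" by (rule vanishing_seq_limit_in_J[OF V])
  have "B \<longlonglongrightarrow> sqrt (2 * (K * 0) + 2 * (5 * norm (c - c)))"
    unfolding B_def[abs_def] by (intro tendsto_intros nu cs)
  then have "(\<lambda>k. B k + B k) \<longlonglongrightarrow> 0" using tendsto_add[of B 0 _ B 0] by simp
  moreover have "\<forall>\<^sub>F k in sequentially. Linf_norm {-1<..<x k - \<epsilon>} (\<lambda>y. U k y + sqrt (2 * P_poly c y))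
            + Linf_norm {x k + \<epsilon><..<1} (\<lambda>y. U k y - sqrt (2 * P_poly c y)) \<le> ennreal (B k + B k)"
    using vanishing_seq_eventually[OF V zero_less_one] x[unfolded zero_seq_def]
  proof eventually_elim
    case (elim k)
    have Rk: "norm (cs k) \<le> R" and nuk: "\<nu> k \<le> 1" using elim by (auto simp: R_def)
    have z: "x k \<in> {-1<..<1}" "U k (x k) = 0" using elim by auto
    note res = residual_bound_zero[OF sol cs(2) Rk R nu(2) nuk z eps, folded K_def]
    have Uc: "continuous_on {-1<..<1} (U k)" by (rule solution_continuous[OF sol])
    have B0: "0 \<le> B k"
    proof -
      have "0 \<le> K" using R eps by (simp add: K_def)
      then show ?thesis using nu(2)[of k] by (simp add: B_def)
    qed
    have close: "\<bar>u - sqrt (2 * P_poly c y)\<bar> \<le> B k"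
      if "y \<in> {-1<..<1}" "0 \<le> u" "\<bar>(1/2) * u\<^sup>2 - P_poly (cs k) y\<bar> \<le> K * \<nu> k" for u y
      unfolding B_def
      by (rule abs_diff_sqrt_le[OF that(2) _ that(3) P_poly_close[OF that(1)]])
         (use P_poly_nonneg[OF cJ, of y] that in simp)
    have "Linf_norm {-1<..<x k - \<epsilon>} (\<lambda>y. U k y + sqrt (2 * P_poly c y)) \<le> ennreal (B k)"
    proof (rule Linf_norm_le)
      show "continuous_on {-1<..<x k - \<epsilon>} (\<lambda>y. U k y + sqrt (2 * P_poly c y))"
        using z eps by (intro continuous_intros P_poly_continuous continuous_on_subset[OF Uc]) auto
      fix y assume y: "y \<in> {-1<..<x k - \<epsilon>}"
      then show "\<bar>U k y + sqrt (2 * P_poly c y)\<bar> \<le> B k"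
        using close[of y "- U k y"] res(2)[OF y] z eps by auto
    qed simp
    moreover have "Linf_norm {x k + \<epsilon><..<1} (\<lambda>y. U k y - sqrt (2 * P_poly c y)) \<le> ennreal (B k)"
    proof (rule Linf_norm_le)
      show "continuous_on {x k + \<epsilon><..<1} (\<lambda>y. U k y - sqrt (2 * P_poly c y))"
        using z eps by (intro continuous_intros P_poly_continuous continuous_on_subset[OF Uc]) auto
      fix y assume y: "y \<in> {x k + \<epsilon><..<1}"
      then show "\<bar>U k y - sqrt (2 * P_poly c y)\<bar> \<le> B k"
        using close[of y "U k y"] res(1)[OF y] z eps by auto
    qed simp
    ultimately show ?case unfolding ennreal_plus[OF B0 B0] by (rule add_mono)
  qed
  ultimately show ?thesis by (intro ennreal_tendsto_0_sandwich)
qed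

text \<open>The residual is of order \<open>\<nu>\<close> in all cases, and \<open>\<nu> \<le> \<nu> powr alpha_exp c\<close> for \<open>\<nu> \<le> 1\<close>.\<close>

lemma residual_estimate_eventually:
  assumes eps: "\<epsilon> > 0" and beta: "0 < \<beta>" "\<beta> < alpha_exp c"
  shows "\<exists>C>0. \<forall>\<nu> cs U x. vanishing_viscosity_seq c \<nu> cs U \<and> zero_seq U x \<longrightarrow>
     (\<forall>\<^sub>F k in sequentially.
              Linf_norm ({-1<..<x k - \<epsilon>} \<union> {x k + \<epsilon><..<1})
                (\<lambda>y. (1/2) * (U k y)\<^sup>2 - P_poly (cs k) y)
              + ennreal (\<nu> k powr \<beta>) *
                Holder_norm \<beta> ({-1 + \<epsilon><..<x k - \<epsilon>} \<union> {x k + \<epsilon><..<1 - \<epsilon>})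
                  (\<lambda>y. (1/2) * (U k y)\<^sup>2 - P_poly (cs k) y)
              \<le> ennreal (C * \<nu> k powr alpha_exp c))"
proof -
  define R where "R = norm c + 1"
  have R: "1 \<le> R" by (simp add: R_def)
  define K where "K = 100 * R + 10 * R / \<epsilon>"
  define L where "L = 15 * R * ((K + 30 * R) / \<epsilon>) + 4 * R"
  have K: "K > 0" using R eps by (simp add: K_def add_pos_nonneg)
  have L: "L > 0" using R eps K by (simp add: L_def add_nonneg_pos)
  show ?thesis
  proof (intro exI[of _ "4 * K + L"] conjI allI impI)
    show "0 < 4 * K + L" using K L by simp
    fix \<nu> cs U x assume "vanishing_viscosity_seq c \<nu> cs U \<and> zero_seq U x"
    then have V: "vanishing_viscosity_seq c \<nu> cs U" and x: "zero_seq U x" by auto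
    have "min 1 (2 * \<epsilon>) > 0" using eps by simp
    from vanishing_seq_eventually[OF V this] x[unfolded zero_seq_def]
    show "\<forall>\<^sub>F k in sequentially.
              Linf_norm ({-1<..<x k - \<epsilon>} \<union> {x k + \<epsilon><..<1})
                (\<lambda>y. (1/2) * (U k y)\<^sup>2 - P_poly (cs k) y)
              + ennreal (\<nu> k powr \<beta>) *
                Holder_norm \<beta> ({-1 + \<epsilon><..<x k - \<epsilon>} \<union> {x k + \<epsilon><..<1 - \<epsilon>})
                  (\<lambda>y. (1/2) * (U k y)\<^sup>2 - P_poly (cs k) y)
              \<le> ennreal ((4 * K + L) * \<nu> k powr alpha_exp c)"
    proof eventually_elim
      case (elim k)
      have nu: "0 < \<nu> k" "\<nu> k \<le> 1" "\<nu> k \<le> 2 * \<epsilon>" using V elim by (auto simp: vanishing_viscosity_seq_def)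
      have "\<nu> k powr 1 \<le> \<nu> k powr alpha_exp c" by (rule powr_mono'[OF alpha_exp_le_1]) (use nu in auto)
      then have "(4 * K + L) * \<nu> k \<le> (4 * K + L) * \<nu> k powr alpha_exp c"
        using nu K L by (intro mult_left_mono) auto
      then have "ennreal ((4 * K + L) * \<nu> k) \<le> ennreal ((4 * K + L) * \<nu> k powr alpha_exp c)" by (rule ennreal_leI)
      moreover have "\<beta> < 1" using beta alpha_exp_le_1[of c] by linarith
      then have "Linf_norm ({-1<..<x k - \<epsilon>} \<union> {x k + \<epsilon><..<1})
                (\<lambda>y. (1/2) * (U k y)\<^sup>2 - P_poly (cs k) y)
              + ennreal (\<nu> k powr \<beta>) *
                Holder_norm \<beta> ({-1 + \<epsilon><..<x k - \<epsilon>} \<union> {x k + \<epsilon><..<1 - \<epsilon>})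
                  (\<lambda>y. (1/2) * (U k y)\<^sup>2 - P_poly (cs k) y) \<le> ennreal ((4 * K + L) * \<nu> k)"
        by (intro residual_norm_bound[OF _ _ _ R nu _ _ eps beta(1) _ K_def L_def])
           (use V elim in \<open>auto simp: vanishing_viscosity_seq_def R_def\<close>)
      ultimately show ?case by (rule order_trans[rotated])
    qed
  qed
qed

lemma zero_seq_nonneg_right:
  assumes V: "vanishing_viscosity_seq c \<nu> cs U" and x: "zero_seq U x"
  shows "\<forall>\<^sub>F k in sequentially. -1 \<le> x k \<and> (\<forall>y\<in>{x k<..<1}. 0 \<le> U k y)"
  using x unfolding zero_seq_def
proof eventually_elim
  case (elim k)
  then show ?case
    using solution_nonneg_right_of_zero[of "\<nu> k" "cs k" "U k" "x k"] V
    by (auto simp: vanishing_viscosity_seq_def)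
qed

lemma zero_seq_nonpos_left:
  assumes V: "vanishing_viscosity_seq c \<nu> cs U" and x: "zero_seq U x"
  shows "\<forall>\<^sub>F k in sequentially. x k \<le> 1 \<and> (\<forall>y\<in>{-1<..<x k}. U k y \<le> 0)"
proof -
  have "zero_seq (\<lambda>k. reflect_U (U k)) (\<lambda>k. - x k)"
    using x unfolding zero_seq_def by eventually_elim (auto simp: reflect_U_def)
  from zero_seq_nonneg_right[OF vanishing_seq_reflect[OF V] this] show ?thesis
  proof eventually_elim
    case (elim k)
    have "U k y \<le> 0" if "y \<in> {-1<..<x k}" for y
      using elim that bspec[of "{- x k<..<1}" "\<lambda>y. 0 \<le> reflect_U (U k) y" "- y"] by (auto simp: reflect_U_def)
    then show ?case using elim by auto
  qed
qed

text \<open>A solution without zeros is positive or negative, and in the second case it would be the least one.\<close>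

lemma nonvanishing_positive:
  assumes V: "vanishing_viscosity_seq c \<nu> cs U" and nz: "nonvanishing_seq U" and c2: "c$2 > 0"
  shows "\<forall>\<^sub>F k in sequentially. \<forall>y\<in>{-1<..<1}. 0 < U k y"
proof -
  have nu: "\<nu> \<longlonglongrightarrow> 0" and cs: "cs \<longlonglongrightarrow> c" using V by (auto simp: vanishing_viscosity_seq_def)
  have "(\<lambda>k. cs k $ 2 - 32 * (\<nu> k)\<^sup>2) \<longlonglongrightarrow> c $ 2 - 32 * 0\<^sup>2"
    by (intro tendsto_intros tendsto_vec_nth cs nu)
  then have "\<forall>\<^sub>F k in sequentially. 0 < cs k $ 2 - 32 * (\<nu> k)\<^sup>2"
    by (rule order_tendstoD) (use c2 in simp)
  with vanishing_seq_eventually[OF V zero_less_one] nz[unfolded nonvanishing_seq_def] show ?thesis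
  proof eventually_elim
    case (elim k)
    have k: "is_solution (\<nu> k) (cs k) (U k)" "cs k \<in> J_set 0" "0 < \<nu> k"
      "\<not> is_least_solution (\<nu> k) (cs k) (U k)"
      using V by (auto simp: vanishing_viscosity_seq_def)
    have "\<not> (\<forall>y\<in>{-1<..<1}. U k y < 0)"
    proof
      assume neg: "\<forall>y\<in>{-1<..<1}. U k y < 0"
      have "is_least_solution (\<nu> k) (cs k) (U k)"
        by (rule negative_solution_least[OF k(1-3)]) (use elim neg in auto)
      then show False using k(4) by simp
    qed
    then show ?case using nonvanishing_sign[OF k(1)] elim by blast
  qed
qed

lemma nonvanishing_negative:
  assumes V: "vanishing_viscosity_seq c \<nu> cs U" and nz: "nonvanishing_seq U" and c1: "c$1 > 0"
  shows "\<forall>\<^sub>F k in sequentially. \<forall>y\<in>{-1<..<1}. U k y < 0"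
proof -
  have "nonvanishing_seq (\<lambda>k. reflect_U (U k))"
    using nz unfolding nonvanishing_seq_def by eventually_elim (auto simp: reflect_U_def)
  from nonvanishing_positive[OF vanishing_seq_reflect[OF V] this] c1
  have "\<forall>\<^sub>F k in sequentially. \<forall>y\<in>{-1<..<1}. 0 < reflect_U (U k) y" by simp
  then show ?thesis
  proof eventually_elim
    case (elim k)
    show ?case
    proof
      fix y :: real assume "y \<in> {-1<..<1}"
      then have "- y \<in> {-1<..<1}" by simp
      then have "0 < reflect_U (U k) (- y)" using elim by blast
      then show "U k y < 0" by (simp add: reflect_U_def)
    qed
  qed
qed

lemma vanishing_seq_subseq:
  assumes "vanishing_viscosity_seq c \<nu> cs U" "strict_mono r"
  shows "vanishing_viscosity_seq c (\<nu> \<circ> r) (cs \<circ> r) (U \<circ> r)"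
  using assms LIMSEQ_subseq_LIMSEQ[of \<nu> 0 r] LIMSEQ_subseq_LIMSEQ[of cs c r]
  unfolding vanishing_viscosity_seq_def comp_def by blast

text \<open>Here nothing decides the sign, but one of the two signs occurs for infinitely many \<open>k\<close>; the subsequence keeps those.\<close>

lemma nonvanishing_subseq_converges:
  assumes V: "vanishing_viscosity_seq c \<nu> cs U" and nz: "nonvanishing_seq U" and c: "c$1 = 0" "c$2 = 0"
  shows "\<exists>r :: nat \<Rightarrow> nat. strict_mono r \<and> (conv_a c (U \<circ> r) \<or> conv_b c (U \<circ> r))"
proof -
  have ev: "\<forall>\<^sub>F k in sequentially. (\<forall>y\<in>{-1<..<1}. 0 < U k y) \<or> (\<forall>y\<in>{-1<..<1}. U k y < 0)"
    using nz unfolding nonvanishing_seq_def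
  proof eventually_elim
    case (elim k)
    have "is_solution (\<nu> k) (cs k) (U k)" using V by (simp add: vanishing_viscosity_seq_def)
    then show ?case using elim by (rule nonvanishing_sign)
  qed
  show ?thesis
  proof (cases "\<exists>\<^sub>\<infinity>k. \<forall>y\<in>{-1<..<1}. 0 < U k y")
    case True
    then have inf: "infinite {k. \<forall>y\<in>{-1<..<1}. 0 < U k y}" by (simp add: frequently_cofinite)
    define r where "r = enumerate {k. \<forall>y\<in>{-1<..<1}. 0 < U k y}"
    have r: "strict_mono r" unfolding r_def by (rule strict_mono_enumerate[OF inf])
    have pos: "0 < U (r k) y" if "y \<in> {-1<..<1}" for k y
      using enumerate_in_set[OF inf, of k] that by (simp add: r_def)
    have V': "vanishing_viscosity_seq c (\<nu> \<circ> r) (cs \<circ> r) (U \<circ> r)" by (rule vanishing_seq_subseq[OF V r])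
    have "conv_a c (U \<circ> r)"
      by (rule conv_a_if_nonneg[OF c(1) V' _ tendsto_const])
         (use V' pos in \<open>auto simp: vanishing_viscosity_seq_def intro!: always_eventually less_imp_le\<close>)
    then show ?thesis using r by blast
  next
    case False
    then have "\<forall>\<^sub>F k in sequentially. \<not> (\<forall>y\<in>{-1<..<1}. 0 < U k y)"
      by (simp add: not_frequently cofinite_eq_sequentially)
    with ev have "\<forall>\<^sub>F k in sequentially. (\<forall>y\<in>{-1<..<1}. U k y < 0)" by eventually_elim blast
    then have neg: "\<forall>\<^sub>F k in sequentially. 1 \<le> (1::real) \<and> (\<forall>y\<in>{-1<..<1}. U k y \<le> 0)"
      by eventually_elim (auto intro: less_imp_le)
    have "conv_b c U"
      by (rule conv_b_if_nonpos[OF c(2) V _ tendsto_const neg])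
         (use V in \<open>simp add: vanishing_viscosity_seq_def\<close>)
    then show ?thesis by (intro exI[of _ id]) (auto simp: strict_mono_id)
  qed
qed

theorem theorem1p8:
  fixes c :: "real^3"
  assumes "c \<noteq> 0"
  shows
    "(\<forall>\<nu> cs U. vanishing_viscosity_seq c \<nu> cs U \<longrightarrow>
        (\<forall>k. cs k \<noteq> 0 \<longrightarrow>
           (\<forall>y\<in>{-1<..<1}. \<forall>z\<in>{-1<..<1}. U k y = 0 \<and> U k z = 0 \<longrightarrow> y = z)) \<and>
        (c $ 1 > 0 \<and> c $ 2 > 0 \<longrightarrow>
           (\<forall>\<^sub>F k in sequentially. \<exists>y\<in>{-1<..<1}. U k y = 0)))
     \<and>
     (\<forall>\<nu> cs U x. vanishing_viscosity_seq c \<nu> cs U \<and> zero_seq U x \<longrightarrow>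
        (\<forall>\<epsilon>>0. (\<lambda>k. Linf_norm {-1<..<x k - \<epsilon>} (\<lambda>y. U k y + sqrt (2 * P_poly c y))
                  + Linf_norm {x k + \<epsilon><..<1} (\<lambda>y. U k y - sqrt (2 * P_poly c y))) \<longlonglongrightarrow> 0))
     \<and>
     (\<forall>\<epsilon>>0. \<forall>\<beta>. 0 < \<beta> \<and> \<beta> < alpha_exp c \<longrightarrow>
        (\<exists>C>0. \<forall>\<nu> cs U x. vanishing_viscosity_seq c \<nu> cs U \<and> zero_seq U x \<longrightarrow>
           (\<forall>\<^sub>F k in sequentially.
              Linf_norm ({-1<..<x k - \<epsilon>} \<union> {x k + \<epsilon><..<1})
                (\<lambda>y. (1/2) * (U k y)\<^sup>2 - P_poly (cs k) y)
              + ennreal (\<nu> k powr \<beta>) *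
                Holder_norm \<beta> ({-1 + \<epsilon><..<x k - \<epsilon>} \<union> {x k + \<epsilon><..<1 - \<epsilon>})
                  (\<lambda>y. (1/2) * (U k y)\<^sup>2 - P_poly (cs k) y)
              \<le> ennreal (C * \<nu> k powr alpha_exp c))))
     \<and>
     (\<forall>\<nu> cs U. vanishing_viscosity_seq c \<nu> cs U \<longrightarrow>
        ((\<exists>x. zero_seq U x \<and> x \<longlonglongrightarrow> -1) \<and> c $ 1 = 0 \<or>
         nonvanishing_seq U \<and> c $ 2 > 0 \<and> c $ 1 = 0 \<longrightarrow> conv_a c U) \<and>
        ((\<exists>x. zero_seq U x \<and> x \<longlonglongrightarrow> 1) \<and> c $ 2 = 0 \<or>
         nonvanishing_seq U \<and> c $ 1 > 0 \<and> c $ 2 = 0 \<longrightarrow> conv_b c U) \<and>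
        (nonvanishing_seq U \<and> c $ 1 = 0 \<and> c $ 2 = 0 \<longrightarrow>
           (\<exists>r :: nat \<Rightarrow> nat. strict_mono r \<and> (conv_a c (U \<circ> r) \<or> conv_b c (U \<circ> r)))))
     \<and>
     (c \<in> interior (J_set 0) \<longrightarrow>
        (\<forall>\<nu> cs U. vanishing_viscosity_seq c \<nu> cs U \<longrightarrow> (\<exists>x. zero_seq U x)) \<and>
        (\<forall>\<epsilon>>0. \<forall>m::nat. m > 0 \<longrightarrow>
           (\<exists>C>0. \<forall>\<nu> cs U x. vanishing_viscosity_seq c \<nu> cs U \<and> zero_seq U x \<longrightarrow>
              (\<forall>\<^sub>F k in sequentially.
                 Linf_norm {-1<..<x k - \<epsilon>} (\<lambda>y. U k y + sqrt (2 * P_poly (cs k) y))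
                 + Linf_norm {x k + \<epsilon><..<1} (\<lambda>y. U k y - sqrt (2 * P_poly (cs k) y))
                 \<le> ennreal (C * \<nu> k) \<and>
                 Cm_norm m {-1 + \<epsilon><..<x k - \<epsilon>} (\<lambda>y. U k y + sqrt (2 * P_poly (cs k) y))
                 + Cm_norm m {x k + \<epsilon><..<1 - \<epsilon>} (\<lambda>y. U k y - sqrt (2 * P_poly (cs k) y))
                 \<le> ennreal (C * \<nu> k)))))"
proof (intro conjI allI impI, goal_cases)
  case (1 \<nu> cs U k)
  then show ?case
    using solution_zero_unique[of "\<nu> k" "cs k" "U k"] unfolding vanishing_viscosity_seq_def by blast
next
  case (2 \<nu> cs U)
  then show ?case using eventually_zero_exists by blast
next
  case (3 \<nu> cs U x \<epsilon>)
  then show ?case using uniform_convergence_away_from_zero by blast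
next
  case (4 \<epsilon> \<beta>)
  show ?case by (rule residual_estimate_eventually) (use 4 in auto)
next
  case (5 \<nu> cs U)
  have sol: "is_solution (\<nu> k) (cs k) (U k)" for k using 5(1) by (simp add: vanishing_viscosity_seq_def)
  from 5(2) show ?case
  proof
    assume "(\<exists>x. zero_seq U x \<and> x \<longlonglongrightarrow> -1) \<and> c $ 1 = 0"
    then show ?thesis using conv_a_if_nonneg[OF _ 5(1) sol _ zero_seq_nonneg_right[OF 5(1)]] by blast
  next
    assume a: "nonvanishing_seq U \<and> c $ 2 > 0 \<and> c $ 1 = 0"
    then have "\<forall>\<^sub>F k in sequentially. \<forall>y\<in>{-1<..<1}. 0 < U k y" using nonvanishing_positive[OF 5(1)] by blast
    then have "\<forall>\<^sub>F k in sequentially. -1 \<le> (-1::real) \<and> (\<forall>y\<in>{-1<..<1}. 0 \<le> U k y)"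
      by eventually_elim (auto intro: less_imp_le)
    then show ?thesis using a by (intro conv_a_if_nonneg[OF _ 5(1) sol tendsto_const]) auto
  qed
next
  case (6 \<nu> cs U)
  have sol: "is_solution (\<nu> k) (cs k) (U k)" for k using 6(1) by (simp add: vanishing_viscosity_seq_def)
  from 6(2) show ?case
  proof
    assume "(\<exists>x. zero_seq U x \<and> x \<longlonglongrightarrow> 1) \<and> c $ 2 = 0"
    then show ?thesis using conv_b_if_nonpos[OF _ 6(1) sol _ zero_seq_nonpos_left[OF 6(1)]] by blast
  next
    assume a: "nonvanishing_seq U \<and> c $ 1 > 0 \<and> c $ 2 = 0"
    then have "\<forall>\<^sub>F k in sequentially. \<forall>y\<in>{-1<..<1}. U k y < 0" using nonvanishing_negative[OF 6(1)] by blast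
    then have "\<forall>\<^sub>F k in sequentially. 1 \<le> (1::real) \<and> (\<forall>y\<in>{-1<..<1}. U k y \<le> 0)"
      by eventually_elim (auto intro: less_imp_le)
    then show ?thesis using a by (intro conv_b_if_nonpos[OF _ 6(1) sol tendsto_const]) auto
  qed
next
  case (7 \<nu> cs U)
  then show ?case using nonvanishing_subseq_converges by blast
next
  case (8 \<nu> cs U)
  have "\<forall>\<^sub>F k in sequentially. \<exists>y\<in>{-1<..<1}. U k y = 0"
    by (rule eventually_zero_exists[OF 8(2) interior_J_positive(1,2)[OF 8(1)]])
  then have "zero_seq U (\<lambda>k. SOME y. y \<in> {-1<..<1} \<and> U k y = 0)"
    unfolding zero_seq_def
  proof eventually_elim
    case (elim k)
    then have "\<exists>y. y \<in> {-1<..<1} \<and> U k y = 0" by blast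
    from someI_ex[OF this] show ?case .
  qed
  then show ?case by blast
next
  case (9 \<epsilon> m)
  obtain C \<delta> where C: "C > 0" "\<delta> > 0" and est:
    "\<forall>\<nu> d U z. 0 < \<nu> \<and> \<nu> \<le> \<delta> \<and> d \<in> J_set 0 \<and> norm d \<le> norm c + 1 \<and> norm (d - c) \<le> \<delta> \<and>
       is_solution \<nu> d U \<and> z \<in> {-1<..<1} \<and> U z = 0 \<longrightarrow>
       Linf_norm {-1<..<z - \<epsilon>} (\<lambda>y. U y + sqrt (2 * P_poly d y))
         + Linf_norm {z + \<epsilon><..<1} (\<lambda>y. U y - sqrt (2 * P_poly d y)) \<le> ennreal (C * \<nu>) \<and>
       Cm_norm m {-1 + \<epsilon><..<z - \<epsilon>} (\<lambda>y. U y + sqrt (2 * P_poly d y))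
         + Cm_norm m {z + \<epsilon><..<1 - \<epsilon>} (\<lambda>y. U y - sqrt (2 * P_poly d y)) \<le> ennreal (C * \<nu>)"
    by (rule interior_estimates[OF 9(1,2)])
  show ?case
  proof (intro exI[of _ C] conjI allI impI C(1))
    fix \<nu> cs U x assume Vx: "vanishing_viscosity_seq c \<nu> cs U \<and> zero_seq U x"
    then have V: "vanishing_viscosity_seq c \<nu> cs U" by simp
    from vanishing_seq_eventually[OF V C(2)] Vx[THEN conjunct2, unfolded zero_seq_def]
    show "\<forall>\<^sub>F k in sequentially.
                 Linf_norm {-1<..<x k - \<epsilon>} (\<lambda>y. U k y + sqrt (2 * P_poly (cs k) y))
                 + Linf_norm {x k + \<epsilon><..<1} (\<lambda>y. U k y - sqrt (2 * P_poly (cs k) y))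
                 \<le> ennreal (C * \<nu> k) \<and>
                 Cm_norm m {-1 + \<epsilon><..<x k - \<epsilon>} (\<lambda>y. U k y + sqrt (2 * P_poly (cs k) y))
                 + Cm_norm m {x k + \<epsilon><..<1 - \<epsilon>} (\<lambda>y. U k y - sqrt (2 * P_poly (cs k) y))
                 \<le> ennreal (C * \<nu> k)"
    proof eventually_elim
      case (elim k)
      show ?case
        by (rule est[rule_format]) (use V elim in \<open>auto simp: vanishing_viscosity_seq_def\<close>)
    qed
  qed
qed

end
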